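(* Let $R$ be the ring of algebraic integers in a number field. The subset $\bigsqcup_IR/I$ ($I$ running over all non-zero ideals of $R$; the point $x\in R/I$ being identified with the character $\eta_I^x$) is dense in $\operatorname{Spec}\bar{\mathcal D}$. Thus, for any choice of $\alpha>1$, $\operatorname{Spec}\bar{\mathcal D}$ is the completion of $\bigsqcup_IR/I$ for the metric $$d_\alpha(\varphi,\psi)=\sum_{I\text{ ideal in }R,\ x\in R/I}N(I)^{-\alpha}\,|(\varphi-\psi)(e_I^x)| .$$
   Context: $R^\times=R\setminus\{0\}$; ideals are always non-zero; $N(I)=|R/I|$. $\mathfrak T[R]$ is the universal C*-algebra generated by $u^x$ ($x\in R$), $s_a$ ($a\in R^\times$), $e_I$ ($I$ a non-zero ideal) with relations: (Ta) the $u^x$ are unitary with $u^xu^y=u^{x+y}$, the $s_a$ are isometries with $s_as_b=s_{ab}$, and $s_au^x=u^{ax}s_a$; (Tb) the $e_I$ are projections, $e_{I\cap J}=e_Ie_J$, $e_R=1$; (Tc) $s_ae_Is_a^*=e_{aI}$; (Td) $u^xe_I=e_Iu^x$ if $x\in I$, $e_Iu^xe_I=0$ if $x\notin I$. $e_I^x=u^xe_Iu^{-x}$ for $x\in R/I$; $\bar{\mathcal D}$ is the commutative C*-subalgebra generated by all $e_I^x$, and $\operatorname{Spec}\bar{\mathcal D}$ is its Gelfand spectrum (space of characters). For each prime ideal $P$, $\bar{\mathcal D}_P$ is the C*-subalgebra generated by the $e^x_{P^n}$, $n\ge0$, $x\in R/P^n$; $\bar{\mathcal D}$ is naturally the infinite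 tensor product $\bigotimes_P\bar{\mathcal D}_P$ over all prime ideals. With $f_I=\sum_{x\in R/I}u^xe_Iu^{-x}$ and $\varepsilon_{P^{n}}=f_{P^{n-1}}-f_{P^{n}}$ ($n\geq 1$), put $\delta^x_{P^n}=u^xe_{P^n}\varepsilon_{P^{n+1}}u^{-x}$ for $n\ge0$, $x\in R/P^n$; $\eta^x_{P^n}$ is the unique character of $\bar{\mathcal D}_P$ with $\eta^x_{P^n}(\delta^x_{P^n})=1$. Let $P_1,P_2,\dots$ be an enumeration of the prime ideals. For $I=\prod_iP_i^{k_i}$ (with $k_i=0$ for almost all $i$) and $x\in R/I$, $\eta_I^x=\bigotimes_i\eta^{x_i}_{P_i^{k_i}}$, where $x_i$ is the image of $x$ in $R/P_i^{k_i}$. *)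

theory Defs
  imports
    "HOL-Analysis.Analysis"
    "HOL-Library.Poly_Mapping"
    "HOL-Algebra.Ideal_Product"
    "HOL-Algebra.QuotRing"
begin

section \<open>Number fields and their rings of integers\<close>

class number_field = field_char_0 +
  assumes finite_degree: "\<exists>B. finite B \<and> (\<forall>x. \<exists>c::'a \<Rightarrow> rat. x = (\<Sum>b\<in>B. of_rat (c b) * b))"

definition ring_of_integers :: "'k::number_field ring"  (\<open>\<O>\<close>)
  where "\<O> = \<lparr>carrier = {x. algebraic_int x}, mult = (*), one = 1, zero = 0, add = (+)\<rparr>"

definition nonzero_ideals :: "'k::number_field set set"
  where "nonzero_ideals = {I. ideal I \<O> \<and> I \<noteq> {0}}"

definition prime_ideals :: "'k::number_field set set"
  where "prime_ideals = {P. primeideal P \<O> \<and> P \<noteq> {0}}"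

text \<open>Elements of \<open>R / I\<close> are cosets, i.e. elements of \<^term>\<open>carrier (\<O> Quot I)\<close>.\<close>

definition ideal_norm :: "'k::number_field set \<Rightarrow> nat"
  where "ideal_norm I = card (carrier (\<O> Quot I))"

definition ideal_pow :: "'k::number_field set \<Rightarrow> nat \<Rightarrow> 'k set"
  where "ideal_pow P n = P [^]\<^bsub>ideals_set \<O>\<^esub> n"

definition prime_exponents :: "'k::number_field set \<Rightarrow> 'k set \<Rightarrow> nat"
  where "prime_exponents I = (THE k. finite {P. k P \<noteq> 0} \<and> {P. k P \<noteq> 0} \<subseteq> prime_ideals \<and>
     I = finprod (ideals_set \<O>) (\<lambda>P. ideal_pow P (k P)) {P. k P \<noteq> 0})"

text \<open>The disjoint union of the quotients \<open>R / I\<close>.\<close>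

definition points :: "('k::number_field set \<times> 'k set) set"
  where "points = (SIGMA I:nonzero_ideals. carrier (\<O> Quot I))"


section \<open>C*-algebras\<close>

class cstar_algebra = real_normed_algebra_1 + complete_space +
  fixes scaleC :: "complex \<Rightarrow> 'a \<Rightarrow> 'a"  (infixr \<open>*\<^sub>C\<close> 75)
    and star :: "'a \<Rightarrow> 'a"
  assumes scaleC_add_right: "c *\<^sub>C (x + y) = c *\<^sub>C x + c *\<^sub>C y"
    and scaleC_add_left: "(c + d) *\<^sub>C x = c *\<^sub>C x + d *\<^sub>C x"
    and scaleC_scaleC: "c *\<^sub>C (d *\<^sub>C x) = (c * d) *\<^sub>C x"
    and scaleC_of_real: "complex_of_real r *\<^sub>C x = r *\<^sub>R x"
    and mult_scaleC_left: "(c *\<^sub>C x) * y = c *\<^sub>C (x * y)"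
    and mult_scaleC_right: "x * (c *\<^sub>C y) = c *\<^sub>C (x * y)"
    and norm_scaleC: "norm (c *\<^sub>C x) = cmod c * norm x"
    and star_star: "star (star x) = x"
    and star_add: "star (x + y) = star x + star y"
    and star_scaleC: "star (c *\<^sub>C x) = cnj c *\<^sub>C star x"
    and star_mult: "star (x * y) = star y * star x"
    and cstar_identity: "norm (star x * x) = (norm x)\<^sup>2"

definition cstar_subalgebra :: "'a::cstar_algebra set \<Rightarrow> bool"
  where "cstar_subalgebra B \<longleftrightarrow> closed B \<and> 0 \<in> B \<and>
     (\<forall>x\<in>B. \<forall>y\<in>B. x + y \<in> B \<and> x * y \<in> B) \<and>
     (\<forall>c. \<forall>x\<in>B. c *\<^sub>C x \<in> B) \<and> (\<forall>x\<in>B. star x \<in> B)"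

definition cstar_generated :: "'a::cstar_algebra set \<Rightarrow> 'a set"
  where "cstar_generated S = cstar_subalgebra hull S"

text \<open>
  The characters of a subalgebra \<open>B\<close> are functions on \<open>B\<close>; as usual for \<^const>\<open>extensional\<close>
  functions they take the value \<^term>\<open>undefined\<close> outside of \<open>B\<close>.
\<close>

definition spectrum :: "'a::cstar_algebra set \<Rightarrow> ('a \<Rightarrow> complex) set"
  where "spectrum B = {\<phi> \<in> extensional B.
     (\<forall>x\<in>B. \<forall>y\<in>B. \<phi> (x + y) = \<phi> x + \<phi> y \<and> \<phi> (x * y) = \<phi> x * \<phi> y) \<and>
     (\<forall>c. \<forall>x\<in>B. \<phi> (c *\<^sub>C x) = c * \<phi> x) \<and>
     (\<exists>x\<in>B. \<phi> x \<noteq> 0)}"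

text \<open>The weak* topology, i.e. pointwise convergence on \<open>B\<close>.\<close>

definition gelfand_topology :: "'a::cstar_algebra set \<Rightarrow> ('a \<Rightarrow> complex) topology"
  where "gelfand_topology B = subtopology (product_topology (\<lambda>_. euclidean) B) (spectrum B)"


section \<open>Universal C*-algebras\<close>

text \<open>
  The free unital complex *-algebra on the symbols \<^typ>\<open>'g\<close> is the complex monoid algebra of the
  monoid of words in the letters \<open>g\<close>, encoded as \<open>(g, False)\<close>, and \<open>g*\<close>, encoded as
  \<open>(g, True)\<close>. Its multiplication is the convolution product of \<^typ>\<open>'w \<Rightarrow>\<^sub>0 complex\<close>, which is
  why concatenation of words is written additively.
\<close>

datatype 'g word = Word (letters: "('g \<times> bool) list")

instantiation word :: (type) monoid_add
begin
definition zero_word :: "'a word" where "0 = Word []"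
definition plus_word :: "'a word \<Rightarrow> 'a word \<Rightarrow> 'a word" where "v + w = Word (letters v @ letters w)"
instance by standard (simp_all add: zero_word_def plus_word_def)
end

type_synonym 'g star_poly = "'g word \<Rightarrow>\<^sub>0 complex"

definition gen :: "'g \<Rightarrow> 'g star_poly"
  where "gen g = Poly_Mapping.single (Word [(g, False)]) 1"

definition star_word :: "'g word \<Rightarrow> 'g word"
  where "star_word w = Word (rev (map (\<lambda>(g, b). (g, \<not> b)) (letters w)))"

definition fstar :: "'g star_poly \<Rightarrow> 'g star_poly"
  where "fstar p = (\<Sum>w\<in>Poly_Mapping.keys p. Poly_Mapping.single (star_word w) (cnj (Poly_Mapping.lookup p w)))"

definition fscale :: "complex \<Rightarrow> 'g star_poly \<Rightarrow> 'g star_poly"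
  where "fscale c p = Poly_Mapping.single 0 c * p"

text \<open>The free unital *-algebra on a set \<open>G\<close> of symbols.\<close>

definition free_star_algebra :: "'g set \<Rightarrow> 'g star_poly set"
  where "free_star_algebra G = {p. \<forall>w\<in>Poly_Mapping.keys p. fst ` set (letters w) \<subseteq> G}"

definition eval_word :: "('g \<Rightarrow> 'a::cstar_algebra) \<Rightarrow> 'g word \<Rightarrow> 'a"
  where "eval_word f w = prod_list (map (\<lambda>(g, b). if b then star (f g) else f g) (letters w))"

definition eval_star_poly :: "('g \<Rightarrow> 'a::cstar_algebra) \<Rightarrow> 'g star_poly \<Rightarrow> 'a"
  where "eval_star_poly f p = (\<Sum>w\<in>Poly_Mapping.keys p. Poly_Mapping.lookup p w *\<^sub>C eval_word f w)"

definition cstar_seminorm_on :: "'g star_poly set \<Rightarrow> ('g star_poly \<Rightarrow> real) \<Rightarrow> bool"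
  where "cstar_seminorm_on F \<rho> \<longleftrightarrow>
     (\<forall>p\<in>F. 0 \<le> \<rho> p \<and> \<rho> (fstar p * p) = (\<rho> p)\<^sup>2) \<and>
     (\<forall>p\<in>F. \<forall>q\<in>F. \<rho> (p + q) \<le> \<rho> p + \<rho> q \<and> \<rho> (p * q) \<le> \<rho> p * \<rho> q) \<and>
     (\<forall>c. \<forall>p\<in>F. \<rho> (fscale c p) = cmod c * \<rho> p)"

text \<open>
  The type \<^typ>\<open>'a\<close> together with \<open>f\<close> is the universal C*-algebra with generators \<open>G\<close> and relations
  \<open>r = 0\<close> for \<open>r \<in> Rel\<close>. As HOL does not allow quantification over all C*-algebras, universality is
  stated in the usual way through the enveloping C*-norm: families \<open>(b g)\<close>, \<open>g \<in> G\<close>, that satisfy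
  the relations in a C*-algebra \<open>B\<close> give C*-seminorms \<open>p \<mapsto> \<parallel>p(b)\<parallel>\<close> vanishing on \<open>Rel\<close>, every
  C*-seminorm vanishing on \<open>Rel\<close> arises like this (take for \<open>B\<close> the completion of the quotient of
  the free *-algebra by its null space), and \<open>f g \<mapsto> b g\<close> extends to a *-homomorphism into \<open>B\<close>
  iff \<open>\<parallel>p(b)\<parallel> \<le> \<parallel>p(f)\<parallel>\<close> for all \<open>p\<close>.
\<close>

definition universal_cstar_algebra ::
    "'g set \<Rightarrow> 'g star_poly set \<Rightarrow> ('g \<Rightarrow> 'a::cstar_algebra) \<Rightarrow> bool"
  where "universal_cstar_algebra G Rel f \<longleftrightarrow>
     (\<forall>r\<in>Rel. eval_star_poly f r = 0) \<and>
     cstar_generated (f ` G) = UNIV \<and>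
     (\<forall>\<rho>. cstar_seminorm_on (free_star_algebra G) \<rho> \<longrightarrow> (\<forall>r\<in>Rel. \<rho> r = 0) \<longrightarrow>
        (\<forall>p\<in>free_star_algebra G. \<rho> p \<le> norm (eval_star_poly f p)))"


section \<open>The algebra \<open>\<TT>[R]\<close>\<close>

datatype 'k toeplitz_gen = U 'k | S 'k | E "'k set"

definition toeplitz_gens :: "'k::number_field toeplitz_gen set"
  where "toeplitz_gens = U ` carrier \<O> \<union> S ` (carrier \<O> - {0}) \<union> E ` nonzero_ideals"

definition relators_Ta :: "'k::number_field toeplitz_gen star_poly set"
  where "relators_Ta =
     {gen (U x) * fstar (gen (U x)) - 1 | x. x \<in> carrier \<O>} \<union>
     {fstar (gen (U x)) * gen (U x) - 1 | x. x \<in> carrier \<O>} \<union>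
     {gen (U x) * gen (U y) - gen (U (x + y)) | x y. x \<in> carrier \<O> \<and> y \<in> carrier \<O>} \<union>
     {fstar (gen (S a)) * gen (S a) - 1 | a. a \<in> carrier \<O> - {0}} \<union>
     {gen (S a) * gen (S b) - gen (S (a * b)) | a b. a \<in> carrier \<O> - {0} \<and> b \<in> carrier \<O> - {0}} \<union>
     {gen (S a) * gen (U x) - gen (U (a * x)) * gen (S a) | a x.
        a \<in> carrier \<O> - {0} \<and> x \<in> carrier \<O>}"

definition relators_Tb :: "'k::number_field toeplitz_gen star_poly set"
  where "relators_Tb =
     {fstar (gen (E I)) - gen (E I) | I. I \<in> nonzero_ideals} \<union>
     {gen (E I) * gen (E I) - gen (E I) | I. I \<in> nonzero_ideals} \<union>
     {gen (E (I \<inter> J)) - gen (E I) * gen (E J) | I J. I \<in> nonzero_ideals \<and> J \<in> nonzero_ideals} \<union>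
     {gen (E (carrier \<O>)) - 1}"

definition relators_Tc :: "'k::number_field toeplitz_gen star_poly set"
  where "relators_Tc =
     {gen (S a) * gen (E I) * fstar (gen (S a)) - gen (E ((*) a ` I)) | a I.
        a \<in> carrier \<O> - {0} \<and> I \<in> nonzero_ideals}"

definition relators_Td :: "'k::number_field toeplitz_gen star_poly set"
  where "relators_Td =
     {gen (U x) * gen (E I) - gen (E I) * gen (U x) | x I. I \<in> nonzero_ideals \<and> x \<in> I} \<union>
     {gen (E I) * gen (U x) * gen (E I) | x I. I \<in> nonzero_ideals \<and> x \<in> carrier \<O> - I}"

text \<open>The values of \<open>u\<close>, \<open>s\<close>, \<open>e\<close> outside of \<open>R\<close>, \<open>R - {0}\<close> and the non-zero ideals are irrelevant.\<close>

definition is_toeplitz_algebra ::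
    "('k::number_field \<Rightarrow> 'a::cstar_algebra) \<Rightarrow> ('k \<Rightarrow> 'a) \<Rightarrow> ('k set \<Rightarrow> 'a) \<Rightarrow> bool"
  where "is_toeplitz_algebra u s e \<longleftrightarrow>
     universal_cstar_algebra toeplitz_gens (relators_Ta \<union> relators_Tb \<union> relators_Tc \<union> relators_Td)
       (case_toeplitz_gen u s e)"


section \<open>The commutative subalgebra and its characters\<close>

context
  fixes u :: "'k::number_field \<Rightarrow> 'a::cstar_algebra" and e :: "'k set \<Rightarrow> 'a"
begin

text \<open>
  Conjugation of \<open>b\<close> by \<open>u\<^sup>x\<close> for a coset \<open>X = x + I\<close>. It is only used for \<open>b\<close> commuting with all
  \<open>u\<^sup>y\<close>, \<open>y \<in> I\<close>, so that the choice of the representative \<open>x\<close> does not matter.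
\<close>

definition conj_coset :: "'k set \<Rightarrow> 'a \<Rightarrow> 'a"
  where "conj_coset X b = (let x = (SOME x. x \<in> X) in u x * b * u (- x))"

definition ecos :: "'k set \<Rightarrow> 'k set \<Rightarrow> 'a"
  where "ecos I X = conj_coset X (e I)"

definition Dbar :: "'a set"
  where "Dbar = cstar_generated {ecos I X | I X. (I, X) \<in> points}"

definition Dbar_at :: "'k set \<Rightarrow> 'a set"
  where "Dbar_at P =
     cstar_generated {ecos (ideal_pow P n) X | n X. X \<in> carrier (\<O> Quot ideal_pow P n)}"

definition fsum :: "'k set \<Rightarrow> 'a"
  where "fsum I = (\<Sum>X\<in>carrier (\<O> Quot I). ecos I X)"

text \<open>Only meaningful for \<open>n \<ge> 1\<close>.\<close>

definition eps :: "'k set \<Rightarrow> nat \<Rightarrow> 'a"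
  where "eps P n = fsum (ideal_pow P (n - 1)) - fsum (ideal_pow P n)"

definition delta :: "'k set \<Rightarrow> nat \<Rightarrow> 'k set \<Rightarrow> 'a"
  where "delta P n X = conj_coset X (e (ideal_pow P n) * eps P (n + 1))"

definition eta_at :: "'k set \<Rightarrow> nat \<Rightarrow> 'k set \<Rightarrow> 'a \<Rightarrow> complex"
  where "eta_at P n X = (THE \<phi>. \<phi> \<in> spectrum (Dbar_at P) \<and> \<phi> (delta P n X) = 1)"

text \<open>
  Under the identification of \<^const>\<open>Dbar\<close> with the infinite tensor product of its subalgebras
  \<^term>\<open>Dbar_at P\<close>, the elementary tensors are the products of finitely many elements taken from
  the subalgebras of pairwise distinct primes.
\<close>

definition tensor_character :: "('k set \<Rightarrow> 'a \<Rightarrow> complex) \<Rightarrow> 'a \<Rightarrow> complex"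
  where "tensor_character \<phi> = (THE \<psi>. \<psi> \<in> spectrum Dbar \<and>
     (\<forall>Ps a. distinct Ps \<and> set Ps \<subseteq> prime_ideals \<and> (\<forall>P\<in>set Ps. a P \<in> Dbar_at P) \<longrightarrow>
        \<psi> (prod_list (map a Ps)) = (\<Prod>P\<in>set Ps. \<phi> P (a P))))"

text \<open>The image of the coset \<open>X = x + I\<close> in \<open>R / P\<^sup>k\<close>, where \<open>I \<subseteq> P\<^sup>k\<close>, is the coset \<open>X + P\<^sup>k\<close>.\<close>

definition eta :: "'k set \<Rightarrow> 'k set \<Rightarrow> 'a \<Rightarrow> complex"
  where "eta I X = tensor_character (\<lambda>P.
     let k = prime_exponents I P in eta_at P k (X <+>\<^bsub>\<O>\<^esub> ideal_pow P k))"

definition metric_term ::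
    "real \<Rightarrow> ('a \<Rightarrow> complex) \<Rightarrow> ('a \<Rightarrow> complex) \<Rightarrow> 'k set \<times> 'k set \<Rightarrow> real"
  where "metric_term \<alpha> \<phi> \<psi> = (\<lambda>(I, X).
     real (ideal_norm I) powr (- \<alpha>) * cmod (\<phi> (ecos I X) - \<psi> (ecos I X)))"

definition d_alpha :: "real \<Rightarrow> ('a \<Rightarrow> complex) \<Rightarrow> ('a \<Rightarrow> complex) \<Rightarrow> real"
  where "d_alpha \<alpha> \<phi> \<psi> = infsum (metric_term \<alpha> \<phi> \<psi>) points"

end

end

theory Submission
  imports Defs
begin

text \<open>
  The algebra acts on the Hilbert space whose basis consists of the non-empty subsets \<open>Y\<close> of \<open>R\<close>: \<open>u\<^sup>x\<close> translates
  by \<open>x\<close>, \<open>s\<^sub>a\<close> multiplies by \<open>a\<close>, and \<open>e\<^sub>I\<close> is the projection to the span of the \<open>Y \<subseteq> I\<close>. Each basis vector \<open>Y\<close> is an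
  eigenvector of all \<open>e\<^sub>I\<^sup>x\<close>, with eigenvalue 1 if \<open>Y \<subseteq> x + I\<close> and 0 otherwise, so by the universal property the
  eigenvalues define a character of the commutative subalgebra. For a coset \<open>X\<close> of an ideal \<open>I\<close>, unique
  factorization of ideals identifies this character with \<open>\<eta>\<close> at \<open>X\<close>.

  An arbitrary character takes the values 0 and 1 on the \<open>e\<^sub>I\<^sup>x\<close>. If it is 1 on finitely many of them, then the
  corresponding cosets intersect in a coset \<open>X\<close> on which it is 1 as well, and it agrees with \<open>\<eta>\<close> at \<open>X\<close> on the given
  cosets; this gives density. At most one coset of each ideal contributes to each character in \<open>d\<^sub>\<alpha>\<close>, so the
  series is dominated by the Dedekind zeta series at \<open>\<alpha>\<close>. Hence \<open>d\<^sub>\<alpha>\<close> is continuous for the compact Gelfand topology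
  and induces it.
\<close>

section \<open>Finitely generated additive groups and integrality\<close>

text \<open>The delicate point is the existence of characters, since relations alone do not exclude
  that the algebra collapses. Universality says that every C*-seminorm vanishing on the relators is
  bounded by the norm. For the operator seminorm of the representation this bounds the eigenvalue of
  a linear combination of coset projections by the norm of that combination. Hence the eigenvalue
  depends only on the element, not on how it is written, and it extends continuously to the closed
  subalgebra.

  The arithmetic starts from one consequence of finite degree: there is an n such that every finite
  subset of the field lies in an additive group with at most n generators. It gives N(I) \<le> m^n
  for an integer m > 0 in I. Finite quotients yield Noetherian induction and maximality of primes,
  and the same bound shows that at most n primes share their least positive integer, which compares
  the zeta series with the sum of the m^(-\<alpha>).

  The topologies agree because a continuous bijection from a compact space to a Hausdorff space is a
  homeomorphism, and compactness of the metric space gives completeness.\<close>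

definition additive_subgroup_on :: "'a::ab_group_add set \<Rightarrow> bool"
  where "additive_subgroup_on H \<longleftrightarrow> 0 \<in> H \<and> (\<forall>x\<in>H. \<forall>y\<in>H. x - y \<in> H)"

text \<open>The generators form a list, possibly with repetitions and dependences, so that its
  length serves as a bound on the rank.\<close>

fun zspan :: "'a::comm_ring_1 list \<Rightarrow> 'a set" where
  "zspan [] = {0}"
| "zspan (g # gs) = {of_int c * g + y | c y. y \<in> zspan gs}"

lemma zspan_ConsI: "y \<in> zspan gs \<Longrightarrow> of_int c * g + y \<in> zspan (g # gs)"
  by auto

context
  fixes H :: "'a::comm_ring_1 set"
  assumes H: "additive_subgroup_on H"
begin

lemma additive_subgroup_on_zero: "0 \<in> H"
  using H by (simp add: additive_subgroup_on_def)

lemma additive_subgroup_on_diff: "x \<in> H \<Longrightarrow> y \<in> H \<Longrightarrow> x - y \<in> H"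
  using H by (simp add: additive_subgroup_on_def)

lemma additive_subgroup_on_uminus: "x \<in> H \<Longrightarrow> - x \<in> H"
  using additive_subgroup_on_diff[OF additive_subgroup_on_zero] by simp

lemma additive_subgroup_on_add: "x \<in> H \<Longrightarrow> y \<in> H \<Longrightarrow> x + y \<in> H"
  using additive_subgroup_on_diff[of x "- y"] additive_subgroup_on_uminus by simp

lemma additive_subgroup_on_of_int: assumes "x \<in> H" shows "of_int c * x \<in> H"
proof -
  have nat: "of_nat n * x \<in> H" for n
    by (induction n) (auto simp: algebra_simps additive_subgroup_on_zero additive_subgroup_on_add assms)
  show ?thesis
    using nat additive_subgroup_on_uminus[OF nat] by (cases c rule: int_cases2) auto
qed

lemma additive_subgroup_on_sum: "(\<And>i. i \<in> A \<Longrightarrow> f i \<in> H) \<Longrightarrow> sum f A \<in> H"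
  by (induction A rule: infinite_finite_induct)
     (auto simp: additive_subgroup_on_zero additive_subgroup_on_add)

lemma zspan_least: "set gs \<subseteq> H \<Longrightarrow> zspan gs \<subseteq> H"
  by (induction gs)
     (auto intro: additive_subgroup_on_zero additive_subgroup_on_add additive_subgroup_on_of_int)

end

lemma additive_subgroup_on_zspan: "additive_subgroup_on (zspan gs)"
proof (induction gs)
  case (Cons g gs)
  show ?case unfolding additive_subgroup_on_def
  proof (intro conjI ballI)
    show "0 \<in> zspan (g # gs)"
      using zspan_ConsI[OF additive_subgroup_on_zero[OF Cons], of 0 g] by simp
    fix x y assume "x \<in> zspan (g # gs)" "y \<in> zspan (g # gs)"
    then obtain c x' d y' where "x = of_int c * g + x'" "y = of_int d * g + y'"
      "x' \<in> zspan gs" "y' \<in> zspan gs" by auto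
    thus "x - y \<in> zspan (g # gs)"
      using zspan_ConsI[OF additive_subgroup_on_diff[OF Cons, of x' y'], of "c - d" g]
      by (simp add: algebra_simps del: zspan.simps)
  qed
qed (auto simp: additive_subgroup_on_def)

lemmas zspan_zero = additive_subgroup_on_zero[OF additive_subgroup_on_zspan]
  and zspan_diff = additive_subgroup_on_diff[OF additive_subgroup_on_zspan]
  and zspan_add = additive_subgroup_on_add[OF additive_subgroup_on_zspan]
  and zspan_uminus = additive_subgroup_on_uminus[OF additive_subgroup_on_zspan]
  and zspan_of_int = additive_subgroup_on_of_int[OF additive_subgroup_on_zspan]
  and zspan_sum = additive_subgroup_on_sum[OF additive_subgroup_on_zspan]

lemma set_subset_zspan: "set gs \<subseteq> zspan gs"
proof (induction gs)
  case (Cons g gs)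
  have "of_int 1 * g + 0 \<in> zspan (g # gs)" using zspan_zero[of gs] by (rule zspan_ConsI)
  hence "g \<in> zspan (g # gs)" by simp
  moreover have "y \<in> zspan (g # gs)" if "y \<in> zspan gs" for y
    using zspan_ConsI[OF that, of 0 g] by simp
  ultimately show ?case using Cons by auto
qed auto

lemma int_subgroup_principal:
  assumes D: "additive_subgroup_on (D :: int set)"
  obtains d where "D = range ((*) d)"
proof (cases "\<exists>c\<in>D. c > 0")
  case False
  have "c = 0" if "c \<in> D" for c
    using False that additive_subgroup_on_uminus[OF D that] by (meson linorder_neqE_linordered_idom neg_0_less_iff_less)
  hence "D = {0}" using additive_subgroup_on_zero[OF D] by auto
  thus ?thesis using that[of 0] by auto
next
  case True
  define n where "n = (LEAST n. n > 0 \<and> int n \<in> D)"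
  have ex: "\<exists>n. n > 0 \<and> int n \<in> D"
    using True by (metis nat_0_le less_imp_le zero_less_nat_eq)
  have n: "n > 0" "int n \<in> D" using LeastI_ex[OF ex] by (auto simp: n_def)
  have mult: "c * x \<in> D" if "x \<in> D" for c x
    using additive_subgroup_on_of_int[OF D that, of c] by simp
  have "c \<in> range ((*) (int n))" if c: "c \<in> D" for c
  proof -
    have r: "c mod int n \<in> D"
      using additive_subgroup_on_diff[OF D c mult[OF n(2), of "c div int n"]]
      by (simp add: minus_div_mult_eq_mod)
    have "c mod int n = 0"
    proof (rule ccontr)
      assume "c mod int n \<noteq> 0"
      hence "nat (c mod int n) > 0 \<and> int (nat (c mod int n)) \<in> D"
        using r n(1) by (metis nat_0_le of_nat_0_less_iff pos_mod_sign zero_less_nat_eq order_less_le)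
      hence "n \<le> nat (c mod int n)" unfolding n_def by (rule Least_le)
      thus False using pos_mod_bound[of "int n" c] n(1) by linarith
    qed
    thus ?thesis by (metis mod_0_imp_dvd dvd_def rangeI)
  qed
  moreover have "range ((*) (int n)) \<subseteq> D" using mult[OF n(2)] by (auto simp: mult.commute)
  ultimately show ?thesis using that by blast
qed

text \<open>Induction on the generators. The coefficients of \<open>g\<close> in all expressions of
  elements of \<open>H\<close> form a subgroup of the integers, hence consist of the multiples of
  some \<open>d\<close>. One element \<open>h\<close> of \<open>H\<close> with coefficient
  \<open>d\<close>, together with generators of \<open>H \<inter> zspan gs\<close>, generates
  \<open>H\<close>.\<close>

lemma subgroup_of_zspan_fg:
  assumes "additive_subgroup_on H" "H \<subseteq> zspan gs"
  obtains hs where "length hs \<le> length gs" "H = zspan hs"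
proof -
  have "\<exists>hs. length hs \<le> length gs \<and> H = zspan hs"
    using assms
  proof (induction gs arbitrary: H)
    case Nil
    hence "H = {0}" using additive_subgroup_on_zero[OF Nil(1)] by auto
    thus ?case by (intro exI[of _ "[]"]) auto
  next
    case (Cons g gs)
    note H = Cons.prems(1)
    define D where "D = {c. \<exists>y\<in>zspan gs. of_int c * g + y \<in> H}"
    have "additive_subgroup_on D" unfolding additive_subgroup_on_def
    proof (intro conjI ballI)
      show "0 \<in> D" using additive_subgroup_on_zero[OF H] zspan_zero by (auto simp: D_def)
      fix c d assume "c \<in> D" "d \<in> D"
      then obtain y z where yz: "y \<in> zspan gs" "z \<in> zspan gs" "of_int c * g + y \<in> H" "of_int d * g + z \<in> H"
        by (auto simp: D_def)
      have "(of_int c * g + y) - (of_int d * g + z) = of_int (c - d) * g + (y - z)"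
        by (simp add: algebra_simps)
      thus "c - d \<in> D" unfolding D_def
        using additive_subgroup_on_diff[OF H yz(3,4)] zspan_diff[OF yz(1,2)] by (metis (mono_tags, lifting) mem_Collect_eq)
    qed
    then obtain d where d: "D = range ((*) d)" by (rule int_subgroup_principal)
    hence "d \<in> D" by (metis mult.right_neutral rangeI)
    then obtain y0 where y0: "y0 \<in> zspan gs" "of_int d * g + y0 \<in> H" by (auto simp: D_def)
    define h where "h = of_int d * g + y0"
    have "additive_subgroup_on (H \<inter> zspan gs)"
      using H additive_subgroup_on_zspan[of gs] by (auto simp: additive_subgroup_on_def)
    then obtain hs where hs: "length hs \<le> length gs" "H \<inter> zspan gs = zspan hs"
      using Cons.IH[of "H \<inter> zspan gs"] by auto
    have "H \<subseteq> zspan (h # hs)"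
    proof
      fix x assume x: "x \<in> H"
      then obtain c y where cy: "x = of_int c * g + y" "y \<in> zspan gs" using Cons.prems by auto
      then obtain k where k: "c = d * k" using x d by (auto simp: D_def)
      have "x - of_int k * h = y - of_int k * y0" by (simp add: cy k h_def algebra_simps)
      moreover have "x - of_int k * h \<in> H"
        using x y0 H by (simp add: additive_subgroup_on_diff additive_subgroup_on_of_int h_def)
      moreover have "y - of_int k * y0 \<in> zspan gs" using cy y0 by (intro zspan_diff zspan_of_int)
      ultimately have "x - of_int k * h \<in> zspan hs" using hs by auto
      from zspan_ConsI[OF this, of k h] show "x \<in> zspan (h # hs)" by (simp del: zspan.simps)
    qed
    moreover have "zspan (h # hs) \<subseteq> H"
      using y0 hs set_subset_zspan[of hs] by (intro zspan_least[OF H]) (auto simp: h_def)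
    ultimately show ?case using hs(1) by (intro exI[of _ "h # hs"]) auto
  qed
  thus ?thesis using that by blast
qed

text \<open>The union of the chain is a subgroup of a finitely generated group, hence finitely
  generated, and its finitely many generators already lie in one member.\<close>

lemma zspan_chain_stabilises:
  assumes "\<And>n. additive_subgroup_on (M n)" "\<And>n. M n \<subseteq> M (Suc n)" "\<And>n. M n \<subseteq> zspan gs"
  obtains N where "M (Suc N) \<subseteq> M N"
proof -
  have mono: "M i \<subseteq> M j" if "i \<le> j" for i j using lift_Suc_mono_le[of M, OF assms(2) that] .
  have "additive_subgroup_on (\<Union>n. M n)" unfolding additive_subgroup_on_def
  proof (intro conjI ballI)
    show "0 \<in> (\<Union>n. M n)" using additive_subgroup_on_zero[OF assms(1)] by auto
    fix x y assume "x \<in> (\<Union>n. M n)" "y \<in> (\<Union>n. M n)"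
    then obtain i j where "x \<in> M i" "y \<in> M j" by auto
    hence "x \<in> M (max i j)" "y \<in> M (max i j)" using mono[of i "max i j"] mono[of j "max i j"] by auto
    hence "x - y \<in> M (max i j)" by (rule additive_subgroup_on_diff[OF assms(1)])
    thus "x - y \<in> (\<Union>n. M n)" by blast
  qed
  moreover have "(\<Union>n. M n) \<subseteq> zspan gs" using assms(3) by auto
  ultimately obtain hs where hs: "(\<Union>n. M n) = zspan hs" by (rule subgroup_of_zspan_fg)
  have "\<exists>N. A \<subseteq> M N" if "finite A" "A \<subseteq> (\<Union>n. M n)" for A
    using that
  proof (induction rule: finite_induct)
    case (insert a A)
    then obtain N n where "A \<subseteq> M N" "a \<in> M n" by auto
    hence "insert a A \<subseteq> M (max N n)" using mono[of N "max N n"] mono[of n "max N n"] by auto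
    thus ?case by blast
  qed auto
  from this[of "set hs"] obtain N where "set hs \<subseteq> M N" using set_subset_zspan[of hs] by (auto simp: hs)
  hence "zspan hs \<subseteq> M N" by (rule zspan_least[OF assms(1)])
  thus ?thesis using that[of N] hs by blast
qed

section \<open>Integrality through finitely generated groups stable under multiplication\<close>

definition stabilises :: "'a::comm_ring_1 \<Rightarrow> 'a list \<Rightarrow> bool"
  where "stabilises x gs \<longleftrightarrow> (\<forall>z\<in>zspan gs. x * z \<in> zspan gs)"

lemma stabilises_generators:
  assumes "\<And>g. g \<in> set gs \<Longrightarrow> x * g \<in> zspan gs"
  shows "stabilises x gs"
proof -
  have "additive_subgroup_on {z. x * z \<in> zspan gs}"
    by (auto simp: additive_subgroup_on_def zspan_zero right_diff_distrib intro: zspan_diff)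
  from zspan_least[OF this] show ?thesis unfolding stabilises_def using assms by blast
qed

lemma stabilises_of_int: "stabilises (of_int c) gs"
  by (simp add: stabilises_def zspan_of_int)

text \<open>An ascending chain takes the place of a determinant. The groups \<open>M n\<close> of
  all p(x) m, with p integral of degree at most n, stay inside \<open>zspan gs\<close>, so the chain
  stops growing at some N. Then x^(N+1) m = q(x) m with q of degree at most N, and cancelling m
  leaves a monic equation.\<close>

lemma algebraic_int_if_stabilises:
  fixes x :: "'a::field_char_0"
  assumes stab: "stabilises x gs" and m: "m \<in> zspan gs" "m \<noteq> 0"
  shows "algebraic_int x"
proof -
  define M where "M = (\<lambda>n. {poly p x * m | p. (\<forall>i. coeff p i \<in> \<int>) \<and> degree p \<le> n})"
  obtain N where N: "M (Suc N) \<subseteq> M N"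
  proof (rule zspan_chain_stabilises[of M gs])
    fix n
    show "additive_subgroup_on (M n)" unfolding additive_subgroup_on_def
    proof (intro conjI ballI)
      show "0 \<in> M n" by (auto simp: M_def intro!: exI[of _ 0])
      fix y z assume "y \<in> M n" "z \<in> M n"
      then obtain p q where pq: "y = poly p x * m" "\<forall>i. coeff p i \<in> \<int>" "degree p \<le> n"
         "z = poly q x * m" "\<forall>i. coeff q i \<in> \<int>" "degree q \<le> n" unfolding M_def by auto
      thus "y - z \<in> M n" unfolding M_def mem_Collect_eq
        by (intro exI[of _ "p - q"]) (auto simp: algebra_simps degree_diff_le)
    qed
    show "M n \<subseteq> M (Suc n)" unfolding M_def using le_Suc_eq by blast
    have "poly p x * m \<in> zspan gs" if "\<forall>i. coeff p i \<in> \<int>" for p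
      using that
    proof (induction p)
      case (pCons a p)
      from pCons.prems have "a \<in> \<int>" "\<forall>i. coeff p i \<in> \<int>"
        by (metis coeff_pCons_0, metis coeff_pCons_Suc)
      then obtain c where "a = of_int c" "poly p x * m \<in> zspan gs" using pCons.IH by (auto elim: Ints_cases)
      thus ?case using m(1) stab
        by (auto simp: distrib_right mult.assoc stabilises_def intro!: zspan_add zspan_of_int)
    qed (simp add: zspan_zero)
    thus "M n \<subseteq> zspan gs" unfolding M_def by blast
  qed
  have "poly (monom 1 (Suc N)) x * m \<in> M (Suc N)"
    unfolding M_def by (auto intro!: exI[of _ "monom 1 (Suc N)"] simp: degree_monom_eq poly_monom)
  then obtain q where q: "\<forall>i. coeff q i \<in> \<int>" "degree q \<le> N" "x ^ Suc N * m = poly q x * m"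
    using N unfolding M_def poly_monom mult_1_left by blast
  define p where "p = monom 1 (Suc N) - q"
  have deg: "degree p = Suc N"
    unfolding p_def using q(2) by (subst diff_conv_add_uminus, subst degree_add_eq_left) (auto simp: degree_monom_eq)
  show ?thesis
  proof
    show "lead_coeff p = 1" unfolding deg using q(2) by (simp add: p_def coeff_eq_0)
    show "\<forall>i. coeff p i \<in> \<int>" using q(1) by (auto simp: p_def)
    show "poly p x = 0" using q(3) m(2) by (simp add: p_def poly_monom)
  qed
qed

text \<open>The products of the old generators with x^i, i < n, generate a group stable under
  \<open>x\<close>, because the monic equation rewrites x^n by lower powers whose coefficients
  stabilise the old group. Whatever stabilised the old group still stabilises the new one, so the
  step can be iterated.\<close>

lemma adjoin_integral:
  fixes x :: "'a::idom"
  assumes gs: "1 \<in> zspan gs" and p: "lead_coeff p = 1" "poly p x = 0" "\<And>i. i < degree p \<Longrightarrow> stabilises (coeff p i) gs"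
  obtains hs where "1 \<in> zspan hs" "stabilises x hs" "\<And>y. stabilises y gs \<Longrightarrow> stabilises y hs"
proof -
  define n where "n = degree p"
  have n: "n > 0"
  proof (rule ccontr)
    assume "\<not> n > 0"
    then obtain c where "p = [:c:]" using n_def by (auto elim: degree_eq_zeroE)
    thus False using p by auto
  qed
  define hs where "hs = concat (map (\<lambda>a. map (\<lambda>i. a * x ^ i) [0..<n]) gs)"
  have prod: "a * x ^ i \<in> zspan hs" if "a \<in> zspan gs" "i < n" for a i
  proof -
    have "additive_subgroup_on {a. a * x ^ i \<in> zspan hs}"
      by (auto simp: additive_subgroup_on_def zspan_zero left_diff_distrib intro: zspan_diff)
    moreover have "set gs \<subseteq> {a. a * x ^ i \<in> zspan hs}"
      using set_subset_zspan[of hs] that(2) by (fastforce simp: hs_def)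
    ultimately show ?thesis using zspan_least that(1) by blast
  qed
  have gen: "\<exists>a i. a \<in> zspan gs \<and> i < n \<and> h = a * x ^ i" if "h \<in> set hs" for h
    using that set_subset_zspan[of gs] by (fastforce simp: hs_def)
  have top: "x ^ n = - (\<Sum>i<n. coeff p i * x ^ i)"
  proof -
    have "poly p x = (\<Sum>i<n. coeff p i * x ^ i) + x ^ n"
      using p(1) by (simp add: poly_altdef n_def flip: lessThan_Suc_atMost)
    thus ?thesis using p(2) by (simp add: eq_neg_iff_add_eq_0 add.commute)
  qed
  show ?thesis
  proof
    show "1 \<in> zspan hs" using prod[OF gs n] by simp
    show "stabilises x hs"
    proof (rule stabilises_generators)
      fix h assume "h \<in> set hs"
      then obtain a i where h: "a \<in> zspan gs" "i < n" "h = a * x ^ i" using gen by blast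
      show "x * h \<in> zspan hs"
      proof (cases "Suc i < n")
        case True
        thus ?thesis using prod[OF h(1) True] by (simp add: h mult_ac)
      next
        case False
        hence "n = Suc i" using h by simp
        hence "x * h = a * x ^ n" using h by (simp add: mult_ac)
        also have "\<dots> = - (\<Sum>i<n. (coeff p i * a) * x ^ i)"
          unfolding top by (simp add: sum_distrib_left sum_distrib_right mult_ac)
        also have "\<dots> \<in> zspan hs"
          using p(3) h(1) prod by (intro zspan_uminus zspan_sum) (auto simp: stabilises_def n_def)
        finally show ?thesis .
      qed
    qed
    fix y assume y: "stabilises y gs"
    show "stabilises y hs"
    proof (rule stabilises_generators)
      fix h assume "h \<in> set hs"
      then obtain a i where h: "a \<in> zspan gs" "i < n" "h = a * x ^ i" using gen by blast
      thus "y * h \<in> zspan hs" using prod[of "y * a" i] y by (simp add: stabilises_def mult.assoc)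
    qed
  qed
qed

lemma adjoin_algebraic_int:
  fixes x :: "'a::field_char_0"
  assumes "1 \<in> zspan gs" "algebraic_int x"
  obtains hs where "1 \<in> zspan hs" "stabilises x hs" "\<And>y. stabilises y gs \<Longrightarrow> stabilises y hs"
proof -
  from assms(2) obtain p where p: "lead_coeff p = 1" "\<forall>i. coeff p i \<in> \<int>" "poly p x = 0"
    by (auto elim: algebraic_int.cases)
  have "stabilises (coeff p i) gs" for i
    using p(2) stabilises_of_int by (metis Ints_cases)
  from adjoin_integral[OF assms(1) p(1,3) this] that show ?thesis by blast
qed

text \<open>After adjoining both elements, \<open>x\<close> and \<open>y\<close> stabilise a common
  finitely generated group containing 1, and so do their sum and product.\<close>

lemma algebraic_int_sum_prod:
  fixes x y :: "'a::field_char_0"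
  assumes "algebraic_int x" "algebraic_int y"
  shows "algebraic_int (x + y)" and "algebraic_int (x * y)"
proof -
  have "1 \<in> zspan [1::'a]" using set_subset_zspan[of "[1::'a]"] by simp
  then obtain gs where gs: "1 \<in> zspan gs" "stabilises x gs" using assms(1) by (rule adjoin_algebraic_int)
  from adjoin_algebraic_int[OF gs(1) assms(2)] gs(2)
  obtain hs where hs: "1 \<in> zspan hs" "stabilises x hs" "stabilises y hs" by metis
  have "stabilises (x + y) hs" "stabilises (x * y) hs"
    using hs(2,3) by (auto simp: stabilises_def distrib_right mult.assoc intro: zspan_add)
  from this[THEN algebraic_int_if_stabilises, OF hs(1) one_neq_zero]
  show "algebraic_int (x + y)" and "algebraic_int (x * y)" .
qed

text \<open>Transitivity of integrality: the coefficients are adjoined one after the other, then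
  \<open>x\<close> itself, and the final group contains 1 and is stable under
  \<open>x\<close>.\<close>

lemma algebraic_int_integral_closure:
  fixes x :: "'a::field_char_0"
  assumes p: "lead_coeff p = 1" "poly p x = 0" "\<And>i. algebraic_int (coeff p i)"
  shows "algebraic_int x"
proof -
  have "\<exists>gs. 1 \<in> zspan gs \<and> (\<forall>i<n. stabilises (coeff p i) gs)" for n
  proof (induction n)
    case 0
    show ?case using set_subset_zspan[of "[1::'a]"] by (intro exI[of _ "[1]"]) simp
  next
    case (Suc n)
    then obtain gs where gs: "1 \<in> zspan gs" "\<forall>i<n. stabilises (coeff p i) gs" by blast
    from adjoin_algebraic_int[OF gs(1) p(3)[of n]] gs(2) less_Suc_eq show ?case by metis
  qed
  then obtain gs where gs: "1 \<in> zspan gs" "\<forall>i<degree p. stabilises (coeff p i) gs" by blast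
  then obtain hs where "1 \<in> zspan hs" "stabilises x hs"
    using adjoin_integral[OF gs(1) p(1,2)] by metis
  thus ?thesis using algebraic_int_if_stabilises by fastforce
qed

section \<open>Ideals in the ring of integers\<close>

lemma ring_of_integers_simps [simp]:
  "x \<in> carrier \<O> \<longleftrightarrow> algebraic_int x" "x \<otimes>\<^bsub>\<O>\<^esub> y = x * y" "x \<oplus>\<^bsub>\<O>\<^esub> y = x + y"
  "\<one>\<^bsub>\<O>\<^esub> = 1" "\<zero>\<^bsub>\<O>\<^esub> = 0"
  by (simp_all add: ring_of_integers_def)

lemma algebraic_int_add [intro]: "algebraic_int x \<Longrightarrow> algebraic_int y \<Longrightarrow> algebraic_int (x + y)"
  for x :: "'a::field_char_0" by (rule algebraic_int_sum_prod)

lemma algebraic_int_mult [intro]: "algebraic_int x \<Longrightarrow> algebraic_int y \<Longrightarrow> algebraic_int (x * y)"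
  for x :: "'a::field_char_0" by (rule algebraic_int_sum_prod)

lemma algebraic_int_diff [intro]: "algebraic_int x \<Longrightarrow> algebraic_int y \<Longrightarrow> algebraic_int (x - y)"
  for x :: "'a::field_char_0" using algebraic_int_add[of x "- y"] by auto

lemma algebraic_int_1 [simp, intro]: "algebraic_int (1 :: 'a::field_char_0)"
  by (rule int_imp_algebraic_int) auto

lemma algebraic_int_of_int [simp, intro]: "algebraic_int (of_int c :: 'a::field_char_0)"
  by (rule int_imp_algebraic_int) auto

lemma algebraic_int_power [intro]: "algebraic_int x \<Longrightarrow> algebraic_int (x ^ n)"
  for x :: "'a::field_char_0" by (induction n) auto

lemma cring_ring_of_integers: "cring (\<O> :: 'k::number_field ring)"
proof (rule cringI)
  show "abelian_group (\<O> :: 'k ring)"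
    by (rule abelian_groupI) (auto simp: add_eq_0_iff2 intro!: exI[of _ "- x" for x] bexI[of _ "- x" for x])
  show "Group.comm_monoid (\<O> :: 'k ring)"
    by (rule comm_monoidI) (auto simp: mult_ac)
qed (auto simp: distrib_right)

lemmas ring_ring_of_integers = cring.axioms(1)[OF cring_ring_of_integers]

lemma ideal_ring_of_integers_iff:
  "ideal I (\<O> :: 'k::number_field ring) \<longleftrightarrow> I \<subseteq> carrier \<O> \<and> 0 \<in> I \<and> (\<forall>x\<in>I. \<forall>y\<in>I. x + y \<in> I) \<and>
     (\<forall>r\<in>carrier \<O>. \<forall>x\<in>I. r * x \<in> I)"
proof
  assume I: "ideal I (\<O> :: 'k ring)"
  interpret ideal I "\<O> :: 'k ring" by fact
  show "I \<subseteq> carrier \<O> \<and> 0 \<in> I \<and> (\<forall>x\<in>I. \<forall>y\<in>I. x + y \<in> I) \<and> (\<forall>r\<in>carrier \<O>. \<forall>x\<in>I. r * x \<in> I)"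
    using a_subset additive_subgroup.zero_closed[OF ideal.axioms(1)[OF I]]
      additive_subgroup.a_closed[OF ideal.axioms(1)[OF I]] I_l_closed
    by (intro conjI ballI) (simp_all only: ring_of_integers_simps)
next
  assume *: "I \<subseteq> carrier \<O> \<and> 0 \<in> I \<and> (\<forall>x\<in>I. \<forall>y\<in>I. x + y \<in> I) \<and> (\<forall>r\<in>carrier \<O>. \<forall>x\<in>I. r * x \<in> I)"
  interpret cring "\<O> :: 'k ring" by (rule cring_ring_of_integers)
  have "(-1) * x \<in> I" if "x \<in> I" for x
    using * that by (metis algebraic_int_1 algebraic_int_minus ring_of_integers_simps(1))
  hence neg: "- x \<in> I" if "x \<in> I" for x using that by simp
  show "ideal I (\<O> :: 'k ring)"
  proof (rule idealI)
    show "subgroup I (add_monoid (\<O> :: 'k ring))"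
    proof (rule add.subgroupI)
      fix a assume a: "a \<in> I"
      hence "a \<in> carrier \<O>" using * by auto
      hence "\<ominus>\<^bsub>\<O>\<^esub> a = - a" by (intro minus_equality) auto
      thus "\<ominus>\<^bsub>\<O>\<^esub> a \<in> I" using neg a by simp
    next
      show "I \<subseteq> carrier (\<O> :: 'k ring)" using * by blast
    next
      show "I \<noteq> {}" using * by auto
    next
      fix a b assume "a \<in> I" "b \<in> I"
      thus "a \<oplus>\<^bsub>\<O>\<^esub> b \<in> I" using * by simp
    qed
  next
    fix a x assume "a \<in> I" "x \<in> carrier (\<O> :: 'k ring)"
    hence "x * a \<in> I" using * by blast
    thus "x \<otimes>\<^bsub>\<O>\<^esub> a \<in> I" "a \<otimes>\<^bsub>\<O>\<^esub> x \<in> I" by (simp_all add: mult.commute)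
  qed (rule ring_ring_of_integers)
qed

context
  fixes I :: "'k::number_field set"
  assumes I: "ideal I \<O>"
begin

lemma ideal_algebraic_int: "x \<in> I \<Longrightarrow> algebraic_int x"
  using I by (auto simp: ideal_ring_of_integers_iff)

lemma ideal_zero: "0 \<in> I"
  using I by (auto simp: ideal_ring_of_integers_iff)

lemma ideal_add: "x \<in> I \<Longrightarrow> y \<in> I \<Longrightarrow> x + y \<in> I"
  using I by (auto simp: ideal_ring_of_integers_iff)

lemma ideal_mult_left: "algebraic_int r \<Longrightarrow> x \<in> I \<Longrightarrow> r * x \<in> I"
  using I by (auto simp: ideal_ring_of_integers_iff)

lemma ideal_mult_right: "algebraic_int r \<Longrightarrow> x \<in> I \<Longrightarrow> x * r \<in> I"
  using ideal_mult_left by (simp add: mult.commute)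

lemma ideal_uminus: "x \<in> I \<Longrightarrow> - x \<in> I"
  using ideal_mult_left[of "-1" x] by simp

lemma ideal_diff: "x \<in> I \<Longrightarrow> y \<in> I \<Longrightarrow> x - y \<in> I"
  using ideal_add[of x "- y"] ideal_uminus by simp

lemma ideal_diff_commute: "x - y \<in> I \<longleftrightarrow> y - x \<in> I"
  using ideal_uminus[of "x - y"] ideal_uminus[of "y - x"] by auto

lemma translate_eq_iff: "(+) x ` I = (+) y ` I \<longleftrightarrow> x - y \<in> I"
proof
  assume "(+) x ` I = (+) y ` I"
  hence "x + 0 \<in> (+) y ` I" using ideal_zero by blast
  thus "x - y \<in> I" by auto
next
  assume *: "x - y \<in> I"
  show "(+) x ` I = (+) y ` I"
  proof (intro equalityI subsetI)
    fix z assume "z \<in> (+) x ` I"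
    then obtain i where "i \<in> I" "z = x + i" by auto
    thus "z \<in> (+) y ` I" using ideal_add[OF *, of i] by (auto simp: image_iff algebra_simps intro!: bexI[of _ "x - y + i"])
  next
    fix z assume "z \<in> (+) y ` I"
    then obtain i where "i \<in> I" "z = y + i" by auto
    thus "z \<in> (+) x ` I" using ideal_diff[of i, OF _ *] by (auto simp: image_iff algebra_simps intro!: bexI[of _ "i - (x - y)"])
  qed
qed

lemma mem_translate_iff: "y \<in> (+) x ` I \<longleftrightarrow> y - x \<in> I"
  by (auto simp: image_iff intro: bexI[of _ "y - x"])

lemma translate_eqI: "y \<in> (+) x ` I \<Longrightarrow> (+) x ` I = (+) y ` I"
  by (simp add: translate_eq_iff mem_translate_iff ideal_diff_commute)

end

lemma carrier_Quot: "carrier (\<O> Quot I) = (\<lambda>x. (+) x ` I) ` carrier (\<O> :: 'k::number_field ring)"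
  by (auto simp: FactRing_def A_RCOSETS_def' a_r_coset_def' add.commute)

lemma set_add_ring_of_integers: "A <+>\<^bsub>\<O>\<^esub> B = {a + b | a b. a \<in> A \<and> b \<in> (B :: 'k::number_field set)}"
  by (auto simp: set_add_def')

lemma ideal_carrier: "ideal (carrier \<O>) (\<O> :: 'k::number_field ring)"
  by (auto simp: ideal_ring_of_integers_iff)

lemma ideal_Int: "ideal I \<O> \<Longrightarrow> ideal J \<O> \<Longrightarrow> ideal (I \<inter> J) (\<O> :: 'k::number_field ring)"
  by (auto simp: ideal_ring_of_integers_iff)

lemma ideal_set_add:
  assumes "ideal I \<O>" "ideal J (\<O> :: 'k::number_field ring)"
  shows "ideal (I <+>\<^bsub>\<O>\<^esub> J) \<O>"
  by (rule ring.add_ideals[OF ring_ring_of_integers assms])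

lemma ideal_colon:
  assumes "ideal I \<O>" "algebraic_int x"
  shows "ideal {r \<in> carrier \<O>. r * x \<in> I} (\<O> :: 'k::number_field ring)"
  using assms by (auto simp: ideal_ring_of_integers_iff distrib_right mult.assoc)

lemma ideal_times_carrier:
  assumes "algebraic_int x"
  shows "ideal ((*) x ` carrier \<O>) (\<O> :: 'k::number_field ring)"
proof -
  have "x * y + x * z \<in> (*) x ` carrier \<O>" if "algebraic_int y" "algebraic_int z" for y z :: 'k
    using that by (intro image_eqI[of _ _ "y + z"]) (auto simp: distrib_left)
  moreover have "y * (x * z) \<in> (*) x ` carrier \<O>" if "algebraic_int y" "algebraic_int z" for y z :: 'k
    using that by (auto simp: image_iff intro!: bexI[of _ "y * z"])
  moreover have "0 \<in> (*) x ` carrier \<O>" by (auto simp: image_iff intro!: bexI[of _ 0])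
  ultimately show ?thesis using assms by (auto simp: ideal_ring_of_integers_iff)
qed

lemma subset_set_add:
  assumes "ideal I \<O>" "ideal J (\<O> :: 'k::number_field ring)"
  shows "I \<subseteq> I <+>\<^bsub>\<O>\<^esub> J" "J \<subseteq> I <+>\<^bsub>\<O>\<^esub> J"
  using ideal_zero[OF assms(1)] ideal_zero[OF assms(2)]
  by (force simp: set_add_ring_of_integers)+

lemma ideal_one_iff:
  assumes "ideal I (\<O> :: 'k::number_field ring)"
  shows "1 \<in> I \<longleftrightarrow> I = carrier \<O>"
  using ideal_mult_left[OF assms, of _ 1] ideal_algebraic_int[OF assms] by auto

lemma nonzero_ideals_superset:
  "I \<in> nonzero_ideals \<Longrightarrow> ideal J \<O> \<Longrightarrow> I \<subseteq> J \<Longrightarrow> J \<in> nonzero_ideals"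
  by (auto simp: nonzero_ideals_def ideal_ring_of_integers_iff)

lemma nonzero_ideals_ideal: "I \<in> nonzero_ideals \<Longrightarrow> ideal I \<O>"
  by (simp add: nonzero_ideals_def)

lemma nonzero_ideals_obtain:
  assumes "I \<in> nonzero_ideals"
  obtains x where "x \<in> I" "x \<noteq> 0"
  using assms ideal_zero[of I] by (auto simp: nonzero_ideals_def)

lemma nonzero_ideals_carrier: "carrier \<O> \<in> (nonzero_ideals :: 'k::number_field set set)"
  using ideal_carrier ring_of_integers_simps(1)[of "1::'k"] unfolding nonzero_ideals_def
  by (metis (mono_tags, lifting) algebraic_int_1 mem_Collect_eq one_neq_zero singletonD)

lemma nonzero_ideals_Int:
  assumes "I \<in> nonzero_ideals" "J \<in> nonzero_ideals"
  shows "I \<inter> J \<in> nonzero_ideals"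
proof -
  obtain x y where xy: "x \<in> I" "x \<noteq> 0" "y \<in> J" "y \<noteq> 0" using assms nonzero_ideals_obtain by metis
  have I: "ideal I \<O>" "ideal J \<O>" using assms by (auto simp: nonzero_ideals_def)
  have "x * y \<in> I \<inter> J"
    using xy ideal_mult_left[OF I(2), of x y] ideal_mult_right[OF I(1), of y x] ideal_algebraic_int[OF I(1)] ideal_algebraic_int[OF I(2)] by auto
  moreover have "x * y \<noteq> 0" using xy by simp
  ultimately have "I \<inter> J \<noteq> {0}" by blast
  thus ?thesis using ideal_Int[OF I] by (simp add: nonzero_ideals_def)
qed

section \<open>Finiteness of quotients\<close>

text \<open>The elements with some positive integral multiple in \<open>zspan bs\<close> form a
  group, which contains all rational multiples of the spanning set and hence the whole
  field.\<close>

lemma number_field_common_denominator: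
  obtains bs :: "'k::number_field list" where "\<And>x. \<exists>d>0. of_int d * x \<in> zspan bs"
proof -
  obtain B where B: "finite B" "\<And>x. \<exists>c::'k \<Rightarrow> rat. x = (\<Sum>b\<in>B. of_rat (c b) * b)"
    using finite_degree by blast
  obtain bs where bs: "set bs = B" using B(1) finite_list by blast
  define H where "H = {x :: 'k. \<exists>d>0. of_int d * x \<in> zspan bs}"
  have "additive_subgroup_on H" unfolding additive_subgroup_on_def
  proof (intro conjI ballI)
    show "0 \<in> H" by (auto simp: H_def zspan_zero intro!: exI[of _ 1])
    fix x y assume "x \<in> H" "y \<in> H"
    then obtain d e where de: "d > 0" "of_int d * x \<in> zspan bs" "e > 0" "of_int e * y \<in> zspan bs"
      by (auto simp: H_def)
    have "of_int e * (of_int d * x) - of_int d * (of_int e * y) \<in> zspan bs"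
      by (intro zspan_diff zspan_of_int[OF de(2)] zspan_of_int[OF de(4)])
    moreover have "of_int e * (of_int d * x) - of_int d * (of_int e * y) = of_int (d * e) * (x - y)"
      by (simp add: algebra_simps)
    ultimately have "of_int (d * e) * (x - y) \<in> zspan bs" by simp
    thus "x - y \<in> H" using de unfolding H_def by (intro CollectI exI[of _ "d * e"]) auto
  qed
  moreover have "of_rat q * b \<in> H" if "b \<in> B" for q b
  proof -
    obtain n d where nd: "quotient_of q = (n, d)" by fastforce
    hence d: "d > 0" "q = of_int n / of_int d" using quotient_of_denom_pos quotient_of_div by auto
    have "of_int d * (of_rat q * b) = of_int n * b"
      using d by (simp add: of_rat_divide of_rat_of_int_eq)
    moreover have "of_int n * b \<in> zspan bs" using that bs set_subset_zspan zspan_of_int by blast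
    ultimately have "of_int d * (of_rat q * b) \<in> zspan bs" by (simp only:)
    thus ?thesis using d(1) unfolding H_def by blast
  qed
  ultimately have "(\<Sum>b\<in>B. of_rat (c b) * b) \<in> H" for c
    by (intro additive_subgroup_on_sum)
  hence "x \<in> H" for x using B(2)[of x] by auto
  thus ?thesis using that by (auto simp: H_def)
qed

text \<open>Plays the role of an integral basis. The list \<open>gs\<close> depends on
  \<open>T\<close>, being \<open>bs\<close> divided by a common denominator of \<open>T\<close>; its
  length does not.\<close>

lemma number_field_rank:
  obtains n where "\<And>T :: 'k::number_field set. finite T \<Longrightarrow> \<exists>gs. length gs \<le> n \<and> T \<subseteq> zspan gs"
proof -
  obtain bs :: "'k list" where bs: "\<And>x. \<exists>d>0. of_int d * x \<in> zspan bs"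
    using number_field_common_denominator by blast
  have "\<exists>gs. length gs \<le> length bs \<and> T \<subseteq> zspan gs" if "finite T" for T :: "'k set"
  proof -
    have "\<exists>d>0. \<forall>x\<in>T. of_int d * x \<in> zspan bs" using that
    proof (induction rule: finite_induct)
      case (insert y T)
      then obtain d where d: "d > 0" "\<And>x. x \<in> T \<Longrightarrow> of_int d * x \<in> zspan bs" by auto
      obtain e where e: "e > 0" "of_int e * y \<in> zspan bs" using bs by blast
      have "of_int (d * e) * x \<in> zspan bs" if "x \<in> insert y T" for x
        using that zspan_of_int[OF d(2), of x e] zspan_of_int[OF e(2), of d] by (auto simp: mult_ac)
      thus ?case using d(1) e(1) by (intro exI[of _ "d * e"]) auto
    qed (auto intro: exI[of _ 1])
    then obtain d where d: "d > 0" "\<And>x. x \<in> T \<Longrightarrow> of_int d * x \<in> zspan bs" by auto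
    define gs where "gs = map (\<lambda>b. b / of_int d) bs"
    have "additive_subgroup_on {z. z / of_int d \<in> zspan gs}"
      by (auto simp: additive_subgroup_on_def zspan_zero diff_divide_distrib intro: zspan_diff)
    moreover have "set bs \<subseteq> {z. z / of_int d \<in> zspan gs}"
      using set_subset_zspan[of gs] by (auto simp: gs_def)
    ultimately have "zspan bs \<subseteq> {z. z / of_int d \<in> zspan gs}" by (rule zspan_least)
    hence "T \<subseteq> zspan gs" using d by fastforce
    thus ?thesis by (intro exI[of _ gs]) (auto simp: gs_def)
  qed
  thus ?thesis using that by blast
qed

text \<open>Reducing every coefficient modulo \<open>m\<close> leaves at most m choices per
  generator. Dependent generators can only make residues coincide, hence a bound rather than an
  exact count.\<close>

lemma zspan_residues:
  assumes "m > 0"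
  shows "\<exists>F. finite F \<and> card F \<le> nat m ^ length hs \<and> (\<forall>t\<in>zspan hs. \<exists>f\<in>F. t - f \<in> (*) (of_int m) ` zspan hs)"
proof (induction hs)
  case (Cons h hs)
  then obtain F where F: "finite F" "card F \<le> nat m ^ length hs"
    "\<And>t. t \<in> zspan hs \<Longrightarrow> \<exists>f\<in>F. t - f \<in> (*) (of_int m) ` zspan hs" by blast
  define F' where "F' = (\<lambda>(c, f). of_int c * h + f) ` ({0..<m} \<times> F)"
  have "card F' \<le> card ({0..<m} \<times> F)" unfolding F'_def by (rule card_image_le) (use F in auto)
  also have "\<dots> \<le> nat m ^ length (h # hs)" using F(2) assms by (simp add: card_cartesian_product)
  finally have "card F' \<le> nat m ^ length (h # hs)" .
  moreover have "\<exists>f\<in>F'. t - f \<in> (*) (of_int m) ` zspan (h # hs)" if "t \<in> zspan (h # hs)" for t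
  proof -
    from that obtain c y where t: "t = of_int c * h + y" "y \<in> zspan hs" by auto
    obtain f z where f: "f \<in> F" "z \<in> zspan hs" "y - f = of_int m * z" using F(3)[OF t(2)] by auto
    have "of_int (c mod m) * h + f \<in> F'" using f(1) assms by (auto simp: F'_def)
    moreover have "t - (of_int (c mod m) * h + f) = of_int m * (of_int (c div m) * h + z)"
    proof -
      have c: "of_int c = of_int m * of_int (c div m) + (of_int (c mod m) :: 'a)"
        by (metis mult_div_mod_eq of_int_add of_int_mult)
      have "y = f + of_int m * z" using f(3) by (simp add: algebra_simps)
      thus ?thesis unfolding t c by (simp add: algebra_simps)
    qed
    ultimately show ?thesis using zspan_ConsI[OF f(2)] by blast
  qed
  ultimately show ?case using F(1) by (intro exI[of _ F']) (auto simp: F'_def simp del: zspan.simps)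
qed (auto intro!: exI[of _ "{0}"])

text \<open>Representatives of finitely many cosets generate a group with at most n generators,
  hence with at most m^n residues modulo m. As m lies in \<open>I\<close>, elements with equal
  residue lie in the same coset. A uniform bound on all finite sets of cosets gives finiteness of
  the quotient and the bound on its size together.\<close>

lemma card_quotient_bound:
  obtains n where "\<And>(I :: 'k::number_field set) m. ideal I \<O> \<Longrightarrow> m > 0 \<Longrightarrow> of_int m \<in> I \<Longrightarrow>
    finite (carrier (\<O> Quot I)) \<and> ideal_norm I \<le> nat m ^ n"
proof -
  obtain n where n: "\<And>T :: 'k set. finite T \<Longrightarrow> \<exists>gs. length gs \<le> n \<and> T \<subseteq> zspan gs"
    by (rule number_field_rank) blast
  have "finite (carrier (\<O> Quot I)) \<and> ideal_norm I \<le> nat m ^ n"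
    if I: "ideal I \<O>" and m: "m > 0" "of_int m \<in> I" for I :: "'k set" and m
    unfolding ideal_norm_def
  proof (rule finite_if_finite_subsets_card_bdd)
    fix C assume C: "C \<subseteq> carrier (\<O> Quot I)" "finite C"
    then obtain T where T: "T \<subseteq> carrier \<O>" "C = (\<lambda>x. (+) x ` I) ` T" "inj_on (\<lambda>x. (+) x ` I) T"
      unfolding carrier_Quot by (auto simp: subset_image_inj)
    have fT: "finite T" using C(2) T(2,3) finite_image_iff by blast
    then obtain ts where ts: "set ts = T" using finite_list by blast
    obtain gs where gs: "length gs \<le> n" "T \<subseteq> zspan gs" using n[OF fT] by blast
    \<comment> \<open>The elements of \<open>gs\<close> need not be algebraic integers. Passing to
      generators \<open>hs\<close> of the subgroup generated by \<open>T\<close> keeps the number of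
      generators and stays inside R, so that multiples of \<open>m\<close> by elements of
      \<open>zspan hs\<close> lie in \<open>I\<close>.\<close>
    have "zspan ts \<subseteq> zspan gs" using gs ts zspan_least[OF additive_subgroup_on_zspan] by blast
    then obtain hs where hs: "length hs \<le> length gs" "zspan ts = zspan hs"
      by (rule subgroup_of_zspan_fg[OF additive_subgroup_on_zspan])
    have "additive_subgroup_on (carrier (\<O> :: 'k ring))" by (auto simp: additive_subgroup_on_def)
    hence hsO: "zspan hs \<subseteq> carrier \<O>" using zspan_least[of "carrier \<O>" ts] ts T(1) hs by auto
    obtain F where F: "finite F" "card F \<le> nat m ^ length hs"
      "\<And>t. t \<in> zspan hs \<Longrightarrow> \<exists>f\<in>F. t - f \<in> (*) (of_int m) ` zspan hs"
      using zspan_residues[OF m(1), of hs] by blast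
    have "\<forall>t\<in>T. \<exists>f\<in>F. t - f \<in> I"
    proof
      fix t assume "t \<in> T"
      hence "t \<in> zspan hs" using ts set_subset_zspan hs by blast
      then obtain f z where "f \<in> F" "z \<in> zspan hs" "t - f = of_int m * z" using F(3) by fastforce
      thus "\<exists>f\<in>F. t - f \<in> I" using ideal_mult_right[OF I _ m(2), of z] hsO by (intro bexI[of _ f]) auto
    qed
    then obtain g where g: "\<And>t. t \<in> T \<Longrightarrow> g t \<in> F \<and> t - g t \<in> I" by metis
    have "inj_on g T"
    proof (rule inj_onI)
      fix s t assume st: "s \<in> T" "t \<in> T" "g s = g t"
      hence "s - t \<in> I" using ideal_diff[OF I, of "s - g s" "t - g t"] g[OF st(1)] g[OF st(2)] by simp
      thus "s = t" using T(3) st translate_eq_iff[OF I] by (auto simp: inj_on_def)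
    qed
    hence "card T \<le> card F" using g F(1) by (intro card_inj_on_le[of g]) auto
    also have "\<dots> \<le> nat m ^ n"
      using F(2) hs(1) gs(1) m(1) power_increasing[of "length hs" n "nat m"] by linarith
    finally show "card C \<le> nat m ^ n" using T by (simp add: card_image)
  qed
  thus ?thesis using that by blast
qed

text \<open>In an integral equation of a nonzero element x of \<open>I\<close>, a nonzero constant
  term is a multiple of x by an algebraic integer, hence lies in \<open>I\<close>. If the constant
  term vanishes, a factor x is cancelled; this is the induction on the polynomial in
  \<open>main\<close>, which also carries the integrality of p(x).\<close>

lemma nonzero_ideals_of_int:
  assumes "I \<in> nonzero_ideals"
  obtains m :: int where "m > 0" "of_int m \<in> I"
proof -
  obtain x where x: "x \<in> I" "x \<noteq> 0" using assms nonzero_ideals_obtain by metis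
  have I: "ideal I \<O>" using assms by (simp add: nonzero_ideals_def)
  have xO: "algebraic_int x" using ideal_algebraic_int[OF I x(1)] .
  have main: "algebraic_int (poly p x) \<and> (p \<noteq> 0 \<longrightarrow> poly p x = 0 \<longrightarrow> (\<exists>m. m \<noteq> 0 \<and> of_int m \<in> I))"
    if "\<forall>i. coeff p i \<in> \<int>" for p
    using that
  proof (induction p)
    case (pCons a p)
    from pCons.prems have "a \<in> \<int>" and p: "\<forall>i. coeff p i \<in> \<int>"
      by (metis coeff_pCons_0, metis coeff_pCons_Suc)
    then obtain c where c: "a = of_int c" by (auto elim: Ints_cases)
    note IH = pCons.IH[OF p]
    have "\<exists>m. m \<noteq> 0 \<and> of_int m \<in> I" if 0: "poly (pCons a p) x = 0"
    proof (cases "a = 0")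
      case True
      thus ?thesis using IH pCons.hyps 0 x(2) by auto
    next
      case False
      have "of_int c = x * (- poly p x)" using 0 c by (simp add: add_eq_0_iff2)
      moreover have "x * (- poly p x) \<in> I" using ideal_mult_right[OF I _ x(1), of "- poly p x"] IH by (simp only: algebraic_int_minus_iff)
      ultimately show ?thesis using False c by (intro exI[of _ c]) auto
    qed
    thus ?case using IH xO c by auto
  qed auto
  obtain p where p: "lead_coeff p = 1" "\<forall>i. coeff p i \<in> \<int>" "poly p x = 0"
    using xO by (auto elim: algebraic_int.cases)
  hence "p \<noteq> 0" by auto
  then obtain m where m: "m \<noteq> 0" "of_int m \<in> I" using main[OF p(2)] p(3) by blast
  hence "of_int \<bar>m\<bar> \<in> I" using ideal_uminus[OF I m(2)] by (auto simp: abs_if)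
  thus ?thesis using that[of "\<bar>m\<bar>"] m(1) by auto
qed

lemma finite_quotient:
  assumes "I \<in> nonzero_ideals"
  shows "finite (carrier (\<O> Quot I))"
  using nonzero_ideals_of_int[OF assms] card_quotient_bound nonzero_ideals_ideal[OF assms] by metis

lemma ideal_norm_pos:
  assumes "I \<in> nonzero_ideals"
  shows "ideal_norm I > 0"
  unfolding ideal_norm_def using finite_quotient[OF assms]
  by (auto simp: card_gt_0_iff carrier_Quot simp del: ring_of_integers_simps)
     (metis algebraic_int_0 empty_iff ring_of_integers_simps(1))

text \<open>The surjection from R/I to R/J is not injective: it identifies the coset of an element
  of \<open>J\<close> outside \<open>I\<close> with the zero coset.\<close>

lemma ideal_norm_strict_antimono:
  assumes I: "I \<in> nonzero_ideals" and J: "ideal J \<O>" "I \<subset> J"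
  shows "ideal_norm J < ideal_norm I"
proof -
  note I' = nonzero_ideals_ideal[OF I]
  obtain x where x: "x \<in> J" "x \<notin> I" using J(2) by blast
  define f where "f = (\<lambda>X. X <+>\<^bsub>\<O>\<^esub> J)"
  have f: "f ((+) y ` I) = (+) y ` J" for y
  proof -
    have "y + i + j \<in> (+) y ` J" if "i \<in> I" "j \<in> J" for i j
      using ideal_add[OF J(1), of i j] J(2) that by (auto simp: image_iff intro!: bexI[of _ "i + j"])
    moreover have "\<exists>a b. y + j = a + b \<and> a \<in> (+) y ` I \<and> b \<in> J" if "j \<in> J" for j
      using ideal_zero[OF I'] that by (intro exI[of _ y] exI[of _ j]) (auto simp: image_iff intro!: bexI[of _ 0])
    ultimately show ?thesis unfolding f_def set_add_ring_of_integers by auto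
  qed
  have img: "f ` carrier (\<O> Quot I) = carrier (\<O> Quot J)"
    unfolding carrier_Quot image_image f ..
  have "\<not> inj_on f (carrier (\<O> Quot I))"
  proof
    assume *: "inj_on f (carrier (\<O> Quot I))"
    have "f ((+) x ` I) = f ((+) 0 ` I)"
      unfolding f by (subst translate_eq_iff[OF J(1)]) (use x in auto)
    moreover have "(+) y ` I \<in> carrier (\<O> Quot I)" if "algebraic_int y" for y
      unfolding carrier_Quot using that by (intro imageI) simp
    ultimately have "(+) x ` I = (+) 0 ` I"
      using ideal_algebraic_int[OF J(1) x(1)] inj_onD[OF *] algebraic_int_0 by blast
    thus False using x(2) translate_eq_iff[OF I', of x 0] by auto
  qed
  hence "card (f ` carrier (\<O> Quot I)) < card (carrier (\<O> Quot I))"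
    using finite_quotient[OF I] card_image_le eq_card_imp_inj_on nat_less_le by metis
  thus ?thesis unfolding ideal_norm_def img .
qed

text \<open>Noetherian induction: the hypothesis concerns strictly larger ideals, and the norm is
  the decreasing measure.\<close>

lemma nonzero_ideals_induct [consumes 1, case_names larger]:
  assumes "I \<in> nonzero_ideals"
    and "\<And>I. I \<in> nonzero_ideals \<Longrightarrow> (\<And>J. ideal J \<O> \<Longrightarrow> I \<subset> J \<Longrightarrow> P J) \<Longrightarrow> P I"
  shows "P I"
  using assms(1)
proof (induction I rule: measure_induct_rule[of ideal_norm])
  case (less I)
  show ?case
  proof (rule assms(2)[OF less.prems])
    fix J assume J: "ideal J \<O>" "I \<subset> J"
    show "P J"
      using J nonzero_ideals_superset[OF less.prems J(1)]
      by (intro less.IH ideal_norm_strict_antimono[OF less.prems]) auto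
  qed
qed

section \<open>Unique factorization of ideals\<close>

lemma prime_ideals_iff:
  "P \<in> prime_ideals \<longleftrightarrow> P \<in> nonzero_ideals \<and> P \<noteq> carrier (\<O> :: 'k::number_field ring) \<and>
     (\<forall>x y. algebraic_int x \<longrightarrow> algebraic_int y \<longrightarrow> x * y \<in> P \<longrightarrow> x \<in> P \<or> y \<in> P)"
  unfolding prime_ideals_def nonzero_ideals_def primeideal_def primeideal_axioms_def
  using cring_ring_of_integers by auto

lemma prime_ideals_nonzero: "P \<in> prime_ideals \<Longrightarrow> P \<in> nonzero_ideals"
  by (simp add: prime_ideals_iff)

lemma prime_ideals_ideal: "P \<in> prime_ideals \<Longrightarrow> ideal P \<O>"
  by (simp add: prime_ideals_nonzero nonzero_ideals_ideal)

lemma prime_ideals_not_one: "P \<in> prime_ideals \<Longrightarrow> 1 \<notin> P"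
  using ideal_one_iff[OF prime_ideals_ideal] by (auto simp: prime_ideals_iff)

lemma prime_ideals_not_carrier_subset: "P \<in> prime_ideals \<Longrightarrow> \<not> carrier \<O> \<subseteq> P"
  using prime_ideals_not_one[of P] ring_of_integers_simps(1)[of 1] algebraic_int_1 by blast

lemma prime_ideals_multD:
  assumes "P \<in> prime_ideals" "x * y \<in> P" "algebraic_int x" "algebraic_int y"
  shows "x \<in> P \<or> y \<in> P"
  using assms unfolding prime_ideals_iff by blast

text \<open>A finite integral domain is a field. The powers of an element x outside \<open>P\<close>
  repeat modulo \<open>P\<close>, so x^i (1 - x^(j-i)) lies in \<open>P\<close> for some i < j.
  Since x^i does not, 1 - x^(j-i) does, and 1 lies in every ideal that contains \<open>P\<close> and
  x.\<close>

lemma prime_ideals_maximal: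
  assumes P: "P \<in> prime_ideals" and J: "ideal J \<O>" "P \<subset> J"
  shows "J = carrier (\<O> :: 'k::number_field ring)"
proof -
  note P' = prime_ideals_ideal[OF P]
  obtain x where x: "x \<in> J" "x \<notin> P" using J(2) by blast
  have xO: "algebraic_int x" using ideal_algebraic_int[OF J(1) x(1)] .
  have "range (\<lambda>i. (+) (x ^ i) ` P) \<subseteq> carrier (\<O> Quot P)"
    unfolding carrier_Quot using algebraic_int_power[OF xO] by (intro image_subsetI imageI) simp
  hence "finite (range (\<lambda>i. (+) (x ^ i) ` P))"
    using finite_quotient[OF prime_ideals_nonzero[OF P]] finite_subset by blast
  hence "\<not> inj (\<lambda>i. (+) (x ^ i) ` P)" using finite_imageD by blast
  then obtain i j where "i < j" "(+) (x ^ i) ` P = (+) (x ^ j) ` P"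
    unfolding inj_on_def by (metis linorder_neqE_nat)
  hence "x ^ i - x ^ (i + (j - i)) \<in> P" using translate_eq_iff[OF P'] by simp
  hence "x ^ i * (1 - x ^ (j - i)) \<in> P" by (simp add: power_add algebra_simps)
  hence "x ^ i \<in> P \<or> 1 - x ^ (j - i) \<in> P"
    using xO by (intro prime_ideals_multD[OF P]) auto
  moreover have "x ^ n \<notin> P" for n
  proof (induction n)
    case 0
    show ?case using prime_ideals_not_one[OF P] by simp
  next
    case (Suc n)
    thus ?case using prime_ideals_multD[OF P, of x "x ^ n"] xO x(2) by auto
  qed
  ultimately have "1 - x ^ (j - i) \<in> J" using J(2) by blast
  moreover have "x ^ (j - i) \<in> J"
    using ideal_mult_right[OF J(1) algebraic_int_power[OF xO] x(1), of "j - i - 1"] \<open>i < j\<close>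
    by (simp add: Suc_diff_Suc flip: power_Suc)
  ultimately have "1 \<in> J" using ideal_add[OF J(1)] by fastforce
  thus ?thesis using ideal_one_iff[OF J(1)] by simp
qed

section \<open>The inverse of a prime ideal\<close>

lemma not_prime_obtain:
  assumes "I \<in> nonzero_ideals" "I \<notin> prime_ideals" "I \<noteq> carrier (\<O> :: 'k::number_field ring)"
  obtains x y where "algebraic_int x" "algebraic_int y" "x \<notin> I" "y \<notin> I" "x * y \<in> I"
  using assms unfolding prime_ideals_iff by blast

lemma colon_superset:
  assumes "ideal I \<O>" "algebraic_int x" "algebraic_int y" "y \<notin> I" "y * x \<in> (I :: 'k::number_field set)"
  shows "I \<subset> {r \<in> carrier \<O>. r * x \<in> I}"
  using assms ideal_mult_right[OF assms(1,2)] ideal_algebraic_int[OF assms(1)] by auto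

lemma prime_superset_exists:
  assumes "I \<in> nonzero_ideals" "I \<noteq> carrier (\<O> :: 'k::number_field ring)"
  shows "\<exists>P\<in>prime_ideals. I \<subseteq> P"
  using assms
proof (induction I rule: nonzero_ideals_induct)
  case (larger I)
  show ?case
  proof (cases "I \<in> prime_ideals")
    case False
    then obtain x y where xy: "algebraic_int x" "algebraic_int y" "x \<notin> I" "y \<notin> I" "x * y \<in> I"
      using not_prime_obtain larger.hyps larger.prems by metis
    define J where "J = {r \<in> carrier \<O>. r * x \<in> I}"
    note I = nonzero_ideals_ideal[OF larger.hyps]
    have "ideal J \<O>" unfolding J_def by (rule ideal_colon[OF I xy(1)])
    moreover have "I \<subset> J" unfolding J_def
      using colon_superset[OF I xy(1,2,4)] xy(5) by (simp add: mult.commute)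
    moreover have "1 \<notin> J" using xy by (simp add: J_def)
    hence "J \<noteq> carrier \<O>" by auto
    ultimately show ?thesis using larger.IH[of J] by blast
  qed auto
qed

text \<open>\<open>P\<close> annihilates a nonzero class \<open>b\<close> of R/I. If
  \<open>I\<close> is not prime, take x y in \<open>I\<close> with x, y outside. Either the colon
  ideal of x lies in \<open>P\<close>, or some r outside \<open>P\<close> satisfies r x \<in> I;
  then the colon ideal of r lies in \<open>P\<close> because \<open>P\<close> is prime. Both colon
  ideals are strictly larger than \<open>I\<close>, and a class found for one of them is multiplied
  by x or r. Applied to a principal ideal, this produces a fraction in the inverse of
  \<open>P\<close>.\<close>

lemma prime_annihilates_outside:
  assumes "I \<in> nonzero_ideals" and P: "P \<in> prime_ideals" and "I \<subseteq> (P :: 'k::number_field set)"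
  shows "\<exists>b. algebraic_int b \<and> b \<notin> I \<and> (\<forall>p\<in>P. b * p \<in> I)"
  using assms(1,3)
proof (induction I rule: nonzero_ideals_induct)
  case (larger I)
  note I = nonzero_ideals_ideal[OF larger.hyps]
  have P1: "1 \<notin> P" using prime_ideals_not_one[OF P] .
  show ?case
  proof (cases "I \<in> prime_ideals")
    case True
    hence "I = P" using prime_ideals_maximal[OF True prime_ideals_ideal[OF P]] larger.prems P
      by (auto simp: prime_ideals_iff)
    thus ?thesis using P1 by (intro exI[of _ 1]) auto
  next
    case False
    have "I \<noteq> carrier \<O>" using larger.prems P1 by auto
    then obtain x y where xy: "algebraic_int x" "algebraic_int y" "x \<notin> I" "y \<notin> I" "x * y \<in> I"
      using not_prime_obtain larger.hyps False by metis
    have step: ?thesis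
      if r: "algebraic_int r" "algebraic_int s" "s \<notin> I" "s * r \<in> I" "{t \<in> carrier \<O>. t * r \<in> I} \<subseteq> P" for r s
    proof -
      have "\<exists>b. algebraic_int b \<and> b \<notin> {t \<in> carrier \<O>. t * r \<in> I} \<and> (\<forall>p\<in>P. b * p \<in> {t \<in> carrier \<O>. t * r \<in> I})"
        using r I by (intro larger.IH ideal_colon colon_superset[of I r s]) auto
      then obtain b where b: "algebraic_int b" "b * r \<notin> I" "\<And>p. p \<in> P \<Longrightarrow> b * p * r \<in> I" by auto
      show ?thesis using b r(1) by (intro exI[of _ "b * r"]) (auto simp: mult_ac)
    qed
    show ?thesis
    proof (cases "{t \<in> carrier \<O>. t * x \<in> I} \<subseteq> P")
      case True
      thus ?thesis using step[of x y] xy by (simp add: mult.commute)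
    next
      case False
      then obtain r where r: "algebraic_int r" "r * x \<in> I" "r \<notin> P" by auto
      have "{t \<in> carrier \<O>. t * r \<in> I} \<subseteq> P"
        using larger.prems prime_ideals_multD[OF P] r by auto
      thus ?thesis using step[of r x] r xy by (simp add: mult.commute)
    qed
  qed
qed

lemma nonzero_ideals_chain_stabilises:
  assumes "\<And>n. B n \<in> (nonzero_ideals :: 'k::number_field set set)" "\<And>n. B n \<subseteq> B (Suc n)"
  obtains N where "B (Suc N) \<subseteq> B N"
proof (rule ccontr)
  assume "\<not> thesis"
  hence strict: "B n \<subset> B (Suc n)" for n using assms(2) that by blast
  have "ideal_norm (B n) + n \<le> ideal_norm (B 0)" for n
  proof (induction n)
    case (Suc n)
    have "ideal_norm (B (Suc n)) < ideal_norm (B n)"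
      using ideal_norm_strict_antimono[OF assms(1) nonzero_ideals_ideal[OF assms(1)] strict] .
    thus ?case using Suc by simp
  qed auto
  from this[of "Suc (ideal_norm (B 0))"] show False by simp
qed

text \<open>The ideals \<open>B n\<close> of all q(g) a, with q over R of degree at most n, form an
  ascending chain inside \<open>I\<close>. Where it stops growing, cancelling a gives a monic
  equation of \<open>g\<close> over R, and R is integrally closed.\<close>

lemma algebraic_int_if_ideal_stable:
  assumes I: "I \<in> (nonzero_ideals :: 'k::number_field set set)" and g: "\<And>x. x \<in> I \<Longrightarrow> g * x \<in> I"
  shows "algebraic_int g"
proof -
  note I' = nonzero_ideals_ideal[OF I]
  obtain a where a: "a \<in> I" "a \<noteq> 0" using nonzero_ideals_obtain[OF I] .
  define B where "B = (\<lambda>n. {poly q g * a | q. (\<forall>i. algebraic_int (coeff q i)) \<and> degree q \<le> n})"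
  have poly_I: "poly q g * x \<in> I" if "\<forall>i. algebraic_int (coeff q i)" "x \<in> I" for q x
    using that
  proof (induction q arbitrary: x)
    case (pCons c q)
    from pCons.prems have c: "algebraic_int c" "\<forall>i. algebraic_int (coeff q i)"
      by (metis coeff_pCons_0, metis coeff_pCons_Suc)
    have "c * x + poly q g * (g * x) \<in> I"
      by (rule ideal_add[OF I' ideal_mult_left[OF I' c(1) pCons.prems(2)] pCons.IH[OF c(2) g[OF pCons.prems(2)]]])
    thus ?case by (simp add: algebra_simps)
  qed (simp add: ideal_zero[OF I'])
  obtain N where N: "B (Suc N) \<subseteq> B N"
  proof (rule nonzero_ideals_chain_stabilises[of B])
    fix n
    show "B n \<subseteq> B (Suc n)" unfolding B_def using le_Suc_eq by blast
    have "ideal (B n) \<O>" unfolding ideal_ring_of_integers_iff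
    proof (intro conjI ballI)
      show "B n \<subseteq> carrier \<O>" using poly_I[OF _ a(1)] ideal_algebraic_int[OF I'] by (auto simp: B_def)
      show "0 \<in> B n" unfolding B_def by (intro CollectI exI[of _ 0]) auto
      fix y z assume "y \<in> B n" "z \<in> B n"
      then obtain p q where pq: "y = poly p g * a" "\<forall>i. algebraic_int (coeff p i)" "degree p \<le> n"
         "z = poly q g * a" "\<forall>i. algebraic_int (coeff q i)" "degree q \<le> n" unfolding B_def by blast
      show "y + z \<in> B n" unfolding B_def
        by (intro CollectI exI[of _ "p + q"]) (use pq in \<open>auto simp: distrib_right degree_add_le\<close>)
    next
      fix r z assume "r \<in> carrier (\<O> :: 'k ring)" "z \<in> B n"
      then obtain q where q: "algebraic_int r" "z = poly q g * a" "\<forall>i. algebraic_int (coeff q i)" "degree q \<le> n"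
        unfolding B_def by auto
      show "r * z \<in> B n" unfolding B_def
        using q degree_smult_le[of r q] by (intro CollectI exI[of _ "smult r q"]) auto
    qed
    moreover have "a \<in> B n" unfolding B_def
      by (intro CollectI exI[of _ 1]) (auto simp: coeff_1)
    ultimately show "B n \<in> nonzero_ideals" using a(2) by (auto simp: nonzero_ideals_def)
  qed
  have "poly (monom 1 (Suc N)) g * a \<in> B (Suc N)" unfolding B_def
    by (intro CollectI exI[of _ "monom 1 (Suc N)"]) (auto simp: degree_monom_eq)
  then obtain q where q: "\<forall>i. algebraic_int (coeff q i)" "degree q \<le> N" "g ^ Suc N * a = poly q g * a"
    using N unfolding B_def poly_monom mult_1_left by blast
  define p where "p = monom 1 (Suc N) - q"
  have deg: "degree p = Suc N"
    unfolding p_def using q(2) by (subst diff_conv_add_uminus, subst degree_add_eq_left) (auto simp: degree_monom_eq)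
  show ?thesis
  proof (rule algebraic_int_integral_closure)
    show "lead_coeff p = 1" unfolding deg using q(2) by (simp add: p_def coeff_eq_0)
    show "algebraic_int (coeff p i)" for i using q(1) by (auto simp: p_def)
    show "poly p g = 0" using q(3) a(2) by (simp add: p_def poly_monom)
  qed
qed

text \<open>The fractional ideal \<open>R + Rg\<close> is the inverse of \<open>P\<close>.\<close>

lemma prime_inverse:
  assumes P: "P \<in> (prime_ideals :: 'k::number_field set set)"
  obtains g p q where "\<not> algebraic_int g" "\<And>x. x \<in> P \<Longrightarrow> algebraic_int (g * x)"
    "p \<in> P" "q \<in> P" "p + g * q = 1"
proof -
  note P' = prime_ideals_ideal[OF P]
  obtain a where a: "a \<in> P" "a \<noteq> 0" using nonzero_ideals_obtain[OF prime_ideals_nonzero[OF P]] .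
  have aO: "algebraic_int a" using ideal_algebraic_int[OF P' a(1)] .
  define L where "L = (*) a ` carrier \<O>"
  have "a * 1 \<in> L" unfolding L_def by (intro imageI) simp
  hence "L \<noteq> {0}" using a(2) by auto
  hence L1: "L \<in> nonzero_ideals"
    using ideal_times_carrier[OF aO] by (simp add: nonzero_ideals_def L_def)
  have L2: "L \<subseteq> P" using ideal_mult_right[OF P' _ a(1)] by (auto simp: L_def)
  obtain b where b: "algebraic_int b" "b \<notin> L" "\<And>p. p \<in> P \<Longrightarrow> b * p \<in> L"
    using prime_annihilates_outside[OF L1 P L2] by blast
  \<comment> \<open>As b P lies in the principal ideal a R but b does not, the fraction b/a maps
    \<open>P\<close> into R without lying in R.\<close>
  define g where "g = b / a"
  have b_eq: "b = a * g" using a by (simp add: g_def)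
  have g1: "\<not> algebraic_int g" using b(2) by (auto simp: b_eq L_def)
  have g2: "algebraic_int (g * x)" if "x \<in> P" for x
  proof -
    from b(3)[OF that] obtain r where "algebraic_int r" "b * x = a * r" by (auto simp: L_def)
    thus ?thesis using a(2) by (simp add: b_eq mult.assoc)
  qed
  define J where "J = {p + g * q | p q. p \<in> P \<and> q \<in> P}"
  have J: "ideal J \<O>" unfolding ideal_ring_of_integers_iff
  proof (intro conjI ballI)
    show "J \<subseteq> carrier \<O>" using g2 ideal_algebraic_int[OF P'] by (auto simp: J_def intro!: algebraic_int_add)
    show "0 \<in> J" unfolding J_def using ideal_zero[OF P'] by (intro CollectI exI[of _ 0]) auto
    fix x y assume "x \<in> J" "y \<in> J"
    then obtain p q p' q' where "x = p + g * q" "y = p' + g * q'" "p \<in> P" "p' \<in> P" "q \<in> P" "q' \<in> P"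
      by (auto simp: J_def)
    thus "x + y \<in> J" unfolding J_def using ideal_add[OF P']
      by (intro CollectI exI[of _ "p + p'"] exI[of _ "q + q'"]) (auto simp: algebra_simps)
  next
    fix r x assume "r \<in> carrier (\<O> :: 'k ring)" "x \<in> J"
    then obtain p q where "x = p + g * q" "algebraic_int r" "p \<in> P" "q \<in> P"
      by (auto simp: J_def)
    thus "r * x \<in> J" unfolding J_def using ideal_mult_left[OF P']
      by (intro CollectI exI[of _ "r * p"] exI[of _ "r * q"]) (simp add: distrib_left mult.left_commute)
  qed
  have "P \<subseteq> J" using ideal_zero[OF P'] by (force simp: J_def)
  \<comment> \<open>Otherwise \<open>g\<close> would map \<open>P\<close> into itself and be
    integral. So \<open>J\<close>, which is P + gP, properly contains the maximal ideal
    \<open>P\<close> and contains 1.\<close>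
  moreover have "\<not> J \<subseteq> P"
  proof
    assume "J \<subseteq> P"
    have "g * x \<in> J" if "x \<in> P" for x
      unfolding J_def using ideal_zero[OF P'] that by (intro CollectI exI[of _ 0] exI[of _ x]) auto
    hence "g * x \<in> P" if "x \<in> P" for x using that \<open>J \<subseteq> P\<close> by blast
    thus False using algebraic_int_if_ideal_stable[OF prime_ideals_nonzero[OF P]] g1 by blast
  qed
  ultimately have "J = carrier \<O>" using prime_ideals_maximal[OF P J] by blast
  hence "1 \<in> J" by simp
  then obtain p q where "p \<in> P" "q \<in> P" "p + g * q = 1" unfolding J_def by auto
  thus ?thesis using that[OF g1 g2, of p q] by blast
qed

section \<open>Products of ideals, division and cancellation\<close>

lemma ideal_prod_mem: "x \<in> I \<Longrightarrow> y \<in> J \<Longrightarrow> x * y \<in> I \<cdot>\<^bsub>\<O>\<^esub> (J :: 'k::number_field set)"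
  using ideal_prod.prod[of x I y J \<O>] by simp

lemma ideal_prod_subset:
  assumes "ideal K \<O>" "\<And>x y. x \<in> I \<Longrightarrow> y \<in> J \<Longrightarrow> x * y \<in> (K :: 'k::number_field set)"
  shows "I \<cdot>\<^bsub>\<O>\<^esub> J \<subseteq> K"
proof
  fix z assume "z \<in> I \<cdot>\<^bsub>\<O>\<^esub> J"
  thus "z \<in> K" by (induction z rule: ideal_prod.induct) (auto simp: assms ideal_add)
qed

lemma ideal_ideal_prod: "ideal I \<O> \<Longrightarrow> ideal J \<O> \<Longrightarrow> ideal (I \<cdot>\<^bsub>\<O>\<^esub> J) (\<O> :: 'k::number_field ring)"
  by (rule ring.ideal_prod_is_ideal[OF ring_ring_of_integers])

lemma ideal_prod_mono:
  "I \<subseteq> I' \<Longrightarrow> J \<subseteq> J' \<Longrightarrow> ideal I' \<O> \<Longrightarrow> ideal J' \<O> \<Longrightarrow> I \<cdot>\<^bsub>\<O>\<^esub> J \<subseteq> I' \<cdot>\<^bsub>\<O>\<^esub> (J' :: 'k::number_field set)"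
  by (rule ideal_prod_subset) (auto intro: ideal_ideal_prod ideal_prod_mem)

lemma ideal_prod_subset_left:
  "ideal I \<O> \<Longrightarrow> ideal J \<O> \<Longrightarrow> I \<cdot>\<^bsub>\<O>\<^esub> J \<subseteq> (I :: 'k::number_field set)"
  using ring.ideal_prod_inter[OF ring_ring_of_integers] by blast

lemma ideal_prod_subset_right:
  "ideal I \<O> \<Longrightarrow> ideal J \<O> \<Longrightarrow> I \<cdot>\<^bsub>\<O>\<^esub> J \<subseteq> (J :: 'k::number_field set)"
  using ring.ideal_prod_inter[OF ring_ring_of_integers] by blast

lemma nonzero_ideals_prod:
  assumes "I \<in> nonzero_ideals" "J \<in> nonzero_ideals"
  shows "I \<cdot>\<^bsub>\<O>\<^esub> J \<in> (nonzero_ideals :: 'k::number_field set set)"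
proof -
  obtain x y where "x \<in> I" "x \<noteq> 0" "y \<in> J" "y \<noteq> 0" using assms nonzero_ideals_obtain by metis
  hence "x * y \<in> I \<cdot>\<^bsub>\<O>\<^esub> J" "x * y \<noteq> 0" using ideal_prod_mem by auto
  hence "I \<cdot>\<^bsub>\<O>\<^esub> J \<noteq> {0}" by (metis singletonD)
  thus ?thesis
    using ideal_ideal_prod[OF nonzero_ideals_ideal[OF assms(1)] nonzero_ideals_ideal[OF assms(2)]]
    by (simp add: nonzero_ideals_def)
qed

text \<open>\<open>J\<close> is the product of \<open>I\<close> with the inverse R + Rg of
  \<open>P\<close>. It is strictly larger than \<open>I\<close>, since otherwise \<open>g\<close>
  would stabilise \<open>I\<close> and be integral. The identity p + g q = 1 writes every x in
  \<open>I\<close> as p x + q (g x), a member of the product of \<open>P\<close> and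
  \<open>J\<close>.\<close>

lemma prime_divides:
  assumes P: "P \<in> prime_ideals" and I: "I \<in> nonzero_ideals" "I \<subseteq> (P :: 'k::number_field set)"
  obtains J where "ideal J \<O>" "I \<subset> J" "I = P \<cdot>\<^bsub>\<O>\<^esub> J"
proof -
  note I' = nonzero_ideals_ideal[OF I(1)]
  obtain g p q where g: "\<not> algebraic_int g" "\<And>x. x \<in> P \<Longrightarrow> algebraic_int (g * x)"
    "p \<in> P" "q \<in> P" "p + g * q = 1" by (rule prime_inverse[OF P]) blast
  define J where "J = {x + g * y | x y. x \<in> I \<and> y \<in> I}"
  have J_mem: "x \<in> J" "g * x \<in> J" if "x \<in> I" for x
    using ideal_zero[OF I'] that by (force simp: J_def)+
  have J: "ideal J \<O>" unfolding ideal_ring_of_integers_iff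
  proof (intro conjI ballI)
    show "J \<subseteq> carrier \<O>" using g(2)[OF subsetD[OF I(2)]] ideal_algebraic_int[OF I'] by (auto simp: J_def intro!: algebraic_int_add)
    show "0 \<in> J" using J_mem ideal_zero[OF I'] by simp
    fix x y assume "x \<in> J" "y \<in> J"
    then obtain a b a' b' where "x = a + g * b" "y = a' + g * b'" "a \<in> I" "a' \<in> I" "b \<in> I" "b' \<in> I"
      by (auto simp: J_def)
    thus "x + y \<in> J" unfolding J_def using ideal_add[OF I']
      by (intro CollectI exI[of _ "a + a'"] exI[of _ "b + b'"]) (auto simp: algebra_simps)
  next
    fix r x assume "r \<in> carrier (\<O> :: 'k ring)" "x \<in> J"
    then obtain a b where "x = a + g * b" "algebraic_int r" "a \<in> I" "b \<in> I"
      by (auto simp: J_def)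
    thus "r * x \<in> J" unfolding J_def using ideal_mult_left[OF I']
      by (intro CollectI exI[of _ "r * a"] exI[of _ "r * b"]) (simp add: distrib_left mult.left_commute)
  qed
  have "\<not> J \<subseteq> I" using J_mem(2) algebraic_int_if_ideal_stable[OF I(1)] g(1) by blast
  hence "I \<subset> J" using J_mem by blast
  moreover have "P \<cdot>\<^bsub>\<O>\<^esub> J \<subseteq> I"
  proof (rule ideal_prod_subset[OF I'])
    fix x y assume x: "x \<in> P" and "y \<in> J"
    then obtain a b where ab: "y = a + g * b" "a \<in> I" "b \<in> I" by (auto simp: J_def)
    have "x * a + (g * x) * b \<in> I"
      using x ab g(2) ideal_algebraic_int[OF prime_ideals_ideal[OF P]]
      by (intro ideal_add[OF I'] ideal_mult_left[OF I']) auto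
    thus "x * y \<in> I" by (simp add: ab algebra_simps)
  qed
  moreover have "I \<subseteq> P \<cdot>\<^bsub>\<O>\<^esub> J"
  proof
    fix x assume x: "x \<in> I"
    have "p * x + q * (g * x) \<in> P \<cdot>\<^bsub>\<O>\<^esub> J"
      using J_mem[OF x] g by (intro ideal_add[OF ideal_ideal_prod[OF prime_ideals_ideal[OF P] J]] ideal_prod_mem)
    moreover have "p * x + q * (g * x) = (p + g * q) * x" by (simp add: algebra_simps)
    ultimately show "x \<in> P \<cdot>\<^bsub>\<O>\<^esub> J" using g(5) by simp
  qed
  ultimately show ?thesis using that J by blast
qed

text \<open>Multiplication by \<open>g\<close> maps the product of \<open>P\<close> and
  \<open>B\<close> into \<open>B\<close>, and a = p a + g (q a), where p a and q a lie in the
  product of \<open>P\<close> and \<open>A\<close>.\<close>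

lemma prime_cancel:
  assumes P: "P \<in> prime_ideals" and A: "ideal A \<O>" and B: "ideal B \<O>"
    and sub: "P \<cdot>\<^bsub>\<O>\<^esub> A \<subseteq> P \<cdot>\<^bsub>\<O>\<^esub> (B :: 'k::number_field set)"
  shows "A \<subseteq> B"
proof
  obtain g p q where g: "\<not> algebraic_int g" "\<And>x. x \<in> P \<Longrightarrow> algebraic_int (g * x)"
    "p \<in> P" "q \<in> P" "p + g * q = 1" by (rule prime_inverse[OF P]) blast
  have PB: "g * x \<in> B" if "x \<in> P \<cdot>\<^bsub>\<O>\<^esub> B" for x
    using that
  proof (induction x rule: ideal_prod.induct)
    case (prod i j)
    thus ?case using ideal_mult_left[OF B g(2)] by (simp flip: mult.assoc)
  qed (auto simp: distrib_left ideal_add[OF B])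
  fix a assume a: "a \<in> A"
  have "p * a \<in> P \<cdot>\<^bsub>\<O>\<^esub> B" "q * a \<in> P \<cdot>\<^bsub>\<O>\<^esub> B" using a g sub ideal_prod_mem by blast+
  hence "p * a + g * (q * a) \<in> B"
    using PB ideal_prod_subset_right[OF prime_ideals_ideal[OF P] B] by (intro ideal_add[OF B]) auto
  moreover have "p * a + g * (q * a) = (p + g * q) * a" by (simp add: algebra_simps)
  ultimately show "a \<in> B" using g(5) by simp
qed

lemma comm_monoid_ideals_set: "Group.comm_monoid (ideals_set (\<O> :: 'k::number_field ring))"
  by (rule cring.ideals_set_is_comm_monoid[OF cring_ring_of_integers])

lemma ideals_set_simps [simp]:
  "I \<in> carrier (ideals_set R) \<longleftrightarrow> ideal I R" "I \<otimes>\<^bsub>ideals_set R\<^esub> J = I \<cdot>\<^bsub>R\<^esub> J"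
  "\<one>\<^bsub>ideals_set R\<^esub> = carrier R"
  by (simp_all add: ideals_set_def)

lemma ideal_pow_0: "ideal_pow P 0 = carrier (\<O> :: 'k::number_field ring)"
  by (simp add: ideal_pow_def monoid.nat_pow_0[OF Group.comm_monoid.axioms(1)[OF comm_monoid_ideals_set]])

lemma ideal_pow_Suc: "ideal_pow P (Suc n) = ideal_pow P n \<cdot>\<^bsub>\<O>\<^esub> (P :: 'k::number_field set)"
  by (simp add: ideal_pow_def monoid.nat_pow_Suc[OF Group.comm_monoid.axioms(1)[OF comm_monoid_ideals_set]])

lemma ideal_ideal_pow: "ideal P \<O> \<Longrightarrow> ideal (ideal_pow P n) (\<O> :: 'k::number_field ring)"
  by (induction n) (auto simp: ideal_pow_0 ideal_pow_Suc ideal_carrier ideal_ideal_prod)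

lemma ideal_pow_nonzero: "P \<in> nonzero_ideals \<Longrightarrow> ideal_pow P n \<in> (nonzero_ideals :: 'k::number_field set set)"
  by (induction n) (auto simp: ideal_pow_0 ideal_pow_Suc nonzero_ideals_carrier nonzero_ideals_prod)

lemma ideal_pow_antimono:
  assumes "ideal P \<O>" "m \<le> n"
  shows "ideal_pow P n \<subseteq> ideal_pow P (m :: nat)"
  using assms(2)
proof (induction n rule: dec_induct)
  case (step n)
  thus ?case using ideal_prod_subset_left[OF ideal_ideal_pow[OF assms(1)] assms(1)] by (auto simp: ideal_pow_Suc)
qed auto

lemma prime_pow_cancel:
  assumes P: "P \<in> prime_ideals" and A: "ideal A \<O>" and B: "ideal B \<O>"
    and "ideal_pow P n \<cdot>\<^bsub>\<O>\<^esub> A \<subseteq> ideal_pow P n \<cdot>\<^bsub>\<O>\<^esub> (B :: 'k::number_field set)"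
  shows "A \<subseteq> B"
  using assms(4)
proof (induction n)
  case 0
  thus ?case
    using A B cring.ideal_prod_commute[OF cring_ring_of_integers] ring.ideal_prod_one[OF ring_ring_of_integers]
    by (metis ideal_carrier ideal_pow_0)
next
  case (Suc n)
  note P' = prime_ideals_ideal[OF P]
  have "ideal_pow P (Suc n) \<cdot>\<^bsub>\<O>\<^esub> C = P \<cdot>\<^bsub>\<O>\<^esub> (ideal_pow P n \<cdot>\<^bsub>\<O>\<^esub> C)" if "ideal C \<O>" for C
    unfolding ideal_pow_Suc
    using ring.ideal_prod_assoc[OF ring_ring_of_integers P' ideal_ideal_pow[OF P'] that]
      cring.ideal_prod_commute[OF cring_ring_of_integers P' ideal_ideal_pow[OF P']] by metis
  with Suc show ?case
    using prime_cancel[OF P] A B ideal_ideal_prod ideal_ideal_pow[OF P'] by metis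
qed

text \<open>Cancelling the n-th power from an equality of consecutive powers would leave R
  \<subseteq> P.\<close>

lemma prime_pow_strict:
  assumes P: "P \<in> (prime_ideals :: 'k::number_field set set)"
  shows "ideal_pow P (Suc n) \<subset> ideal_pow P n"
proof -
  note P' = prime_ideals_ideal[OF P]
  have "\<not> ideal_pow P n \<subseteq> ideal_pow P (Suc n)"
  proof
    assume "ideal_pow P n \<subseteq> ideal_pow P (Suc n)"
    hence "ideal_pow P n \<cdot>\<^bsub>\<O>\<^esub> carrier \<O> \<subseteq> ideal_pow P n \<cdot>\<^bsub>\<O>\<^esub> P"
      by (simp add: ring.ideal_prod_one[OF ring_ring_of_integers ideal_ideal_pow[OF P']] ideal_pow_Suc)
    hence "carrier \<O> \<subseteq> P" by (rule prime_pow_cancel[OF P ideal_carrier P'])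
    thus False using prime_ideals_not_carrier_subset[OF P] by simp
  qed
  thus ?thesis using ideal_pow_antimono[OF P', of n "Suc n"] by auto
qed

section \<open>Products of prime powers and their exponents\<close>

definition prime_power_product :: "'k::number_field set set \<Rightarrow> ('k set \<Rightarrow> nat) \<Rightarrow> 'k set"
  where "prime_power_product \<S> k = finprod (ideals_set \<O>) (\<lambda>P. ideal_pow P (k P)) \<S>"

lemma prime_power_product_empty: "prime_power_product {} k = carrier (\<O> :: 'k::number_field ring)"
  by (simp add: prime_power_product_def comm_monoid.finprod_empty[OF comm_monoid_ideals_set])

context
  fixes \<S> :: "'k::number_field set set"
  assumes \<S>: "finite \<S>" "\<S> \<subseteq> prime_ideals"
begin

lemma prime_pow_in_ideals_set: "P \<in> \<S> \<Longrightarrow> ideal (ideal_pow P n) \<O>"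
  using \<S> by (auto intro: ideal_ideal_pow prime_ideals_ideal)

lemma ideal_prime_power_product: "ideal (prime_power_product \<S> k) \<O>"
  using comm_monoid.finprod_closed[OF comm_monoid_ideals_set, of "\<lambda>P. ideal_pow P (k P)" \<S>]
    prime_pow_in_ideals_set by (auto simp: prime_power_product_def Pi_def)

lemma prime_power_product_insert:
  assumes "P \<in> prime_ideals" "P \<notin> \<S>"
  shows "prime_power_product (insert P \<S>) k = ideal_pow P (k P) \<cdot>\<^bsub>\<O>\<^esub> prime_power_product \<S> k"
  unfolding prime_power_product_def
  using assms \<S> prime_pow_in_ideals_set
  by (subst comm_monoid.finprod_insert[OF comm_monoid_ideals_set])
     (auto intro: ideal_ideal_pow prime_ideals_ideal)

lemma prime_power_product_cong:
  "(\<And>P. P \<in> \<S> \<Longrightarrow> k P = l P) \<Longrightarrow> prime_power_product \<S> k = prime_power_product \<S> l"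
  unfolding prime_power_product_def
  using prime_pow_in_ideals_set by (intro comm_monoid.finprod_cong'[OF comm_monoid_ideals_set]) auto

end

lemma prime_power_product_remove:
  assumes "finite \<S>" "\<S> \<subseteq> prime_ideals" "P \<in> \<S>"
  shows "prime_power_product \<S> k = ideal_pow P (k P) \<cdot>\<^bsub>\<O>\<^esub> prime_power_product (\<S> - {P}) k"
  using prime_power_product_insert[of "\<S> - {P}" P k] assms by (auto simp: insert_absorb)

lemma prime_power_product_mono:
  assumes "finite \<S>" "\<S> \<subseteq> (prime_ideals :: 'k::number_field set set)" "\<And>P. P \<in> \<S> \<Longrightarrow> l P \<le> k P"
  shows "prime_power_product \<S> k \<subseteq> prime_power_product \<S> l"
  using assms
proof (induction \<S> rule: finite_induct)
  case (insert P \<S>)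
  hence P: "P \<in> prime_ideals" "\<S> \<subseteq> prime_ideals" by auto
  show ?case
    unfolding prime_power_product_insert[OF insert.hyps(1) P(2,1) insert.hyps(2)]
    using insert P by (intro ideal_prod_mono ideal_prime_power_product ideal_ideal_pow ideal_pow_antimono prime_ideals_ideal) auto
qed (auto simp: prime_power_product_empty)

lemma prime_power_product_support:
  assumes "finite T" "T \<subseteq> (prime_ideals :: 'k::number_field set set)" "\<S> \<subseteq> T" "\<And>P. P \<in> T - \<S> \<Longrightarrow> k P = 0"
  shows "prime_power_product \<S> k = prime_power_product T k"
proof -
  have "(\<lambda>P. ideal_pow P (k P)) \<in> T \<rightarrow> carrier (ideals_set \<O>)"
    using prime_pow_in_ideals_set[OF assms(1,2)] by auto
  thus ?thesis unfolding prime_power_product_def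
    using assms by (intro comm_monoid.finprod_mono_neutral_cong_left[OF comm_monoid_ideals_set]) (auto simp: ideal_pow_0)
qed

lemma prime_pow_subset_prime:
  assumes P: "P \<in> prime_ideals" and Q: "Q \<in> prime_ideals" and "ideal_pow Q n \<subseteq> (P :: 'k::number_field set)"
  shows "Q = P"
proof -
  have "Q \<subseteq> P" using assms(3)
  proof (induction n)
    case 0
    thus ?case using prime_ideals_not_carrier_subset[OF P] by (simp add: ideal_pow_0)
  next
    case (Suc n)
    have "primeideal P \<O>" using P by (simp add: prime_ideals_def)
    from ring.primeideal_divides_ideal_prod[OF ring_ring_of_integers this ideal_ideal_pow[OF prime_ideals_ideal[OF Q]]
        prime_ideals_ideal[OF Q], of n]
    show ?case using Suc by (auto simp: ideal_pow_Suc)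
  qed
  thus ?thesis
    using prime_ideals_maximal[OF Q prime_ideals_ideal[OF P]] P by (auto simp: prime_ideals_iff)
qed

lemma prime_power_product_subset_prime:
  assumes "finite \<S>" "\<S> \<subseteq> prime_ideals" and P: "P \<in> prime_ideals" "P \<notin> \<S>"
  shows "\<not> prime_power_product \<S> k \<subseteq> (P :: 'k::number_field set)"
  using assms(1,2,4)
proof (induction \<S> rule: finite_induct)
  case empty
  show ?case using prime_ideals_not_carrier_subset[OF P(1)] by (simp add: prime_power_product_empty)
next
  case (insert Q \<S>)
  hence Q: "Q \<in> prime_ideals" "\<S> \<subseteq> prime_ideals" by auto
  have prim: "primeideal P \<O>" using P by (simp add: prime_ideals_def)
  have "\<not> ideal_pow Q (k Q) \<subseteq> P" using prime_pow_subset_prime[OF P(1) Q(1)] insert.prems by auto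
  thus ?case unfolding prime_power_product_insert[OF insert.hyps(1) Q(2,1) insert.hyps(2)]
    using ring.primeideal_divides_ideal_prod[OF ring_ring_of_integers prim ideal_ideal_pow[OF prime_ideals_ideal[OF Q(1)]]
        ideal_prime_power_product[OF insert.hyps(1) Q(2)]] insert.IH Q(2) insert.prems by blast
qed

text \<open>Containment in powers of \<open>P\<close> reads off the exponent of \<open>P\<close>. If
  a higher power contained the product, cancelling P^k0 would put the product \<open>J\<close> of
  the other prime powers inside \<open>P\<close>, which is impossible for a prime not among the
  factors.\<close>

lemma prime_power_product_subset_pow_iff:
  assumes \<S>: "finite \<S>" "\<S> \<subseteq> prime_ideals" and P: "P \<in> prime_ideals"
  shows "prime_power_product \<S> k \<subseteq> ideal_pow (P :: 'k::number_field set) m \<longleftrightarrow> m \<le> (if P \<in> \<S> then k P else 0)"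
proof -
  note P' = prime_ideals_ideal[OF P]
  define k0 where "k0 = (if P \<in> \<S> then k P else 0)"
  have S': "finite (\<S> - {P})" "\<S> - {P} \<subseteq> prime_ideals" using \<S> by auto
  define J where "J = prime_power_product (\<S> - {P}) k"
  have J: "ideal J \<O>" unfolding J_def by (rule ideal_prime_power_product[OF S'])
  have eq: "prime_power_product \<S> k = ideal_pow P k0 \<cdot>\<^bsub>\<O>\<^esub> J"
  proof (cases "P \<in> \<S>")
    case False
    thus ?thesis using J cring.ideal_prod_commute[OF cring_ring_of_integers ideal_carrier J]
      by (simp add: k0_def J_def ideal_pow_0 ring.ideal_prod_one[OF ring_ring_of_integers])
  qed (auto simp: k0_def J_def prime_power_product_remove[OF \<S>])
  show ?thesis unfolding k0_def[symmetric] eq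
  proof
    assume "m \<le> k0"
    thus "ideal_pow P k0 \<cdot>\<^bsub>\<O>\<^esub> J \<subseteq> ideal_pow P m"
      using ideal_prod_subset_left[OF ideal_ideal_pow[OF P'] J] ideal_pow_antimono[OF P'] by blast
  next
    assume *: "ideal_pow P k0 \<cdot>\<^bsub>\<O>\<^esub> J \<subseteq> ideal_pow P m"
    show "m \<le> k0"
    proof (rule ccontr)
      assume "\<not> m \<le> k0"
      hence "ideal_pow P k0 \<cdot>\<^bsub>\<O>\<^esub> J \<subseteq> ideal_pow P k0 \<cdot>\<^bsub>\<O>\<^esub> P"
        using * ideal_pow_antimono[OF P', of "Suc k0" m] by (simp add: ideal_pow_Suc)
      hence "J \<subseteq> P" by (rule prime_pow_cancel[OF P J P'])
      thus False using prime_power_product_subset_prime[OF S' P] by (simp add: J_def)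
    qed
  qed
qed

text \<open>A proper ideal lies in some prime \<open>P\<close>; dividing by \<open>P\<close> gives a
  strictly larger ideal, to which Noetherian induction applies, and the exponent of \<open>P\<close>
  is then raised by one.\<close>

lemma ideal_factorization_exists:
  assumes "I \<in> (nonzero_ideals :: 'k::number_field set set)"
  shows "\<exists>\<S> k. finite \<S> \<and> \<S> \<subseteq> prime_ideals \<and> I = prime_power_product \<S> k"
  using assms
proof (induction I rule: nonzero_ideals_induct)
  case (larger I)
  show ?case
  proof (cases "I = carrier \<O>")
    case True
    thus ?thesis using prime_power_product_empty by (intro exI[of _ "{}"]) auto
  next
    case False
    then obtain P where P: "P \<in> prime_ideals" "I \<subseteq> P" using prime_superset_exists larger.hyps by blast
    note P' = prime_ideals_ideal[OF P(1)]
    obtain J where J: "ideal J \<O>" "I \<subset> J" "I = P \<cdot>\<^bsub>\<O>\<^esub> J" using prime_divides[OF P(1) larger.hyps P(2)] .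
    then obtain \<S> k where \<S>: "finite \<S>" "\<S> \<subseteq> prime_ideals" "J = prime_power_product \<S> k" using larger.IH by blast
    define T where "T = insert P \<S>"
    \<comment> \<open>Extending the exponents by 0 treats both cases at once: a prime
      \<open>P\<close> outside \<open>\<S>\<close> enters \<open>T\<close> with exponent 0 before it
      is raised to \<open>Suc (l P)\<close>.\<close>
    define l where "l = (\<lambda>Q. if Q \<in> \<S> then k Q else 0)"
    have T: "finite T" "T \<subseteq> prime_ideals" "P \<in> T" using \<S> P by (auto simp: T_def)
    have T': "finite (T - {P})" "T - {P} \<subseteq> prime_ideals" using T by auto
    have "J = prime_power_product \<S> l"
      unfolding \<S>(3) by (rule prime_power_product_cong[OF \<S>(1,2)]) (simp add: l_def)
    also have "\<dots> = prime_power_product T l"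
      using T by (intro prime_power_product_support) (auto simp: T_def l_def)
    also have "\<dots> = ideal_pow P (l P) \<cdot>\<^bsub>\<O>\<^esub> prime_power_product (T - {P}) l"
      by (rule prime_power_product_remove[OF T])
    finally have "I = P \<cdot>\<^bsub>\<O>\<^esub> (ideal_pow P (l P) \<cdot>\<^bsub>\<O>\<^esub> prime_power_product (T - {P}) l)"
      using J by simp
    also have "\<dots> = ideal_pow P (Suc (l P)) \<cdot>\<^bsub>\<O>\<^esub> prime_power_product (T - {P}) l"
      unfolding ideal_pow_Suc
      using ring.ideal_prod_assoc[OF ring_ring_of_integers P' ideal_ideal_pow[OF P'] ideal_prime_power_product[OF T']]
        cring.ideal_prod_commute[OF cring_ring_of_integers P' ideal_ideal_pow[OF P']] by metis
    also have "prime_power_product (T - {P}) l = prime_power_product (T - {P}) (l(P := Suc (l P)))"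
      by (rule prime_power_product_cong[OF T']) auto
    also have "ideal_pow P (Suc (l P)) \<cdot>\<^bsub>\<O>\<^esub> prime_power_product (T - {P}) (l(P := Suc (l P))) =
        prime_power_product T (l(P := Suc (l P)))"
      using prime_power_product_remove[OF T, of "l(P := Suc (l P))"] by simp
    finally show ?thesis using T by blast
  qed
qed

text \<open>Uniqueness of the factorization: any two admissible exponent functions are determined by
  the same containments of \<open>I\<close> in prime powers.\<close>

lemma prime_exponents_eqI:
  assumes "finite {P. k P \<noteq> 0}" "{P. k P \<noteq> 0} \<subseteq> prime_ideals"
    "(I :: 'k::number_field set) = prime_power_product {P. k P \<noteq> 0} k"
  shows "prime_exponents I = k"
  unfolding prime_exponents_def prime_power_product_def[symmetric]
proof (rule the_equality)
  fix l assume l: "finite {P. l P \<noteq> 0} \<and> {P. l P \<noteq> 0} \<subseteq> prime_ideals \<and> I = prime_power_product {P. l P \<noteq> 0} l"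
  show "l = k"
  proof
    fix P
    show "l P = k P"
    proof (cases "P \<in> prime_ideals")
      case True
      have "m \<le> l P \<longleftrightarrow> m \<le> k P" for m
      proof -
        have "I \<subseteq> ideal_pow P m \<longleftrightarrow> m \<le> (if P \<in> {P. l P \<noteq> 0} then l P else 0)"
          using prime_power_product_subset_pow_iff[of "{P. l P \<noteq> 0}" P l m] l True by simp
        moreover have "I \<subseteq> ideal_pow P m \<longleftrightarrow> m \<le> (if P \<in> {P. k P \<noteq> 0} then k P else 0)"
          using prime_power_product_subset_pow_iff[OF assms(1,2) True, of k m] assms(3) by simp
        ultimately show ?thesis by (auto split: if_splits)
      qed
      thus ?thesis using le_antisym by blast
    next
      case False
      hence "l P = 0" "k P = 0" using assms(2) l by auto
      thus ?thesis by simp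
    qed
  qed
qed (use assms in auto)

lemma prime_exponents:
  assumes "I \<in> (nonzero_ideals :: 'k::number_field set set)"
  shows finite_prime_exponents: "finite {P. prime_exponents I P \<noteq> 0}"
    and prime_exponents_prime: "{P. prime_exponents I P \<noteq> 0} \<subseteq> prime_ideals"
    and ideal_factorization: "I = prime_power_product {P. prime_exponents I P \<noteq> 0} (prime_exponents I)"
proof -
  obtain \<S> k where \<S>: "finite \<S>" "\<S> \<subseteq> prime_ideals" "I = prime_power_product \<S> k"
    using ideal_factorization_exists[OF assms] by blast
  define l where "l = (\<lambda>P. if P \<in> \<S> then k P else 0)"
  have "I = prime_power_product \<S> l"
    unfolding \<S>(3) by (rule prime_power_product_cong[OF \<S>(1,2)]) (simp add: l_def)
  also have "\<dots> = prime_power_product {P. l P \<noteq> 0} l"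
    using \<S> by (intro prime_power_product_support[symmetric]) (auto simp: l_def)
  finally have I: "I = prime_power_product {P. l P \<noteq> 0} l" .
  have sub: "{P. l P \<noteq> 0} \<subseteq> \<S>" by (auto simp: l_def)
  hence fin: "finite {P. l P \<noteq> 0}" "{P. l P \<noteq> 0} \<subseteq> prime_ideals" using \<S> finite_subset by auto
  hence "prime_exponents I = l" using I by (rule prime_exponents_eqI)
  thus "finite {P. prime_exponents I P \<noteq> 0}" "{P. prime_exponents I P \<noteq> 0} \<subseteq> prime_ideals"
    "I = prime_power_product {P. prime_exponents I P \<noteq> 0} (prime_exponents I)"
    using I fin by auto
qed

lemma subset_prime_pow_iff:
  assumes "I \<in> (nonzero_ideals :: 'k::number_field set set)" "P \<in> prime_ideals"
  shows "I \<subseteq> ideal_pow P m \<longleftrightarrow> m \<le> prime_exponents I P"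
  using prime_power_product_subset_pow_iff[OF finite_prime_exponents[OF assms(1)] prime_exponents_prime[OF assms(1)] assms(2),
      of "prime_exponents I" m] ideal_factorization[OF assms(1)] by simp

lemma ideal_subset_if_prime_exponents_le:
  assumes I: "I \<in> (nonzero_ideals :: 'k::number_field set set)" and J: "J \<in> nonzero_ideals"
    and le: "\<And>P. P \<in> prime_ideals \<Longrightarrow> prime_exponents J P \<le> prime_exponents I P"
  shows "I \<subseteq> J"
proof -
  let ?\<S> = "{P. prime_exponents I P \<noteq> 0}"
  note \<S> = finite_prime_exponents[OF I] prime_exponents_prime[OF I]
  have "I = prime_power_product ?\<S> (prime_exponents I)" by (rule ideal_factorization[OF I])
  also have "\<dots> \<subseteq> prime_power_product ?\<S> (prime_exponents J)"
    using \<S> le by (intro prime_power_product_mono) auto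
  also have "\<dots> = prime_power_product {P. prime_exponents J P \<noteq> 0} (prime_exponents J)"
    using \<S> le prime_exponents_prime[OF J] by (intro prime_power_product_support[symmetric]) fastforce+
  also have "\<dots> = J" by (rule ideal_factorization[OF J, symmetric])
  finally show ?thesis .
qed

text \<open>The intersection contains \<open>I\<close>, and its exponents are at least those of
  \<open>I\<close>, so it is also contained in \<open>I\<close>. The factor
  \<open>carrier \<O>\<close> covers I = R, where the family of prime powers is empty.\<close>

lemma ideal_eq_Inter_prime_powers:
  assumes I: "I \<in> (nonzero_ideals :: 'k::number_field set set)"
  shows "I = carrier \<O> \<inter> (\<Inter>P\<in>{P. prime_exponents I P \<noteq> 0}. ideal_pow P (prime_exponents I P))" (is "I = ?M")
proof
  note \<S> = finite_prime_exponents[OF I] prime_exponents_prime[OF I]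
  show sub: "I \<subseteq> ?M"
    using subset_prime_pow_iff[OF I] \<S>(2) ideal_algebraic_int[OF nonzero_ideals_ideal[OF I]] by auto
  have pow: "ideal (ideal_pow P n) \<O>" if "prime_exponents I P \<noteq> 0" for P n
    using \<S>(2) that by (auto intro: ideal_ideal_pow prime_ideals_ideal)
  hence "ideal ?M \<O>" unfolding ideal_ring_of_integers_iff
    by (auto simp: ideal_zero ideal_add ideal_mult_left)
  hence M: "?M \<in> nonzero_ideals" using nonzero_ideals_superset[OF I] sub by blast
  show "?M \<subseteq> I"
  proof (rule ideal_subset_if_prime_exponents_le[OF M I])
    fix P :: "'k set" assume P: "P \<in> prime_ideals"
    show "prime_exponents I P \<le> prime_exponents ?M P"
    proof (cases "prime_exponents I P = 0")
      case False
      hence "?M \<subseteq> ideal_pow P (prime_exponents I P)" by blast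
      thus ?thesis using subset_prime_pow_iff[OF M P] by simp
    qed auto
  qed
qed

section \<open>Ideal norms and the Dedekind zeta series\<close>

text \<open>Shows in particular that multiplication by \<open>P\<close> changes the ideal, which
  provides the element \<open>a\<close> of the norm estimate that follows.\<close>

lemma prime_exponents_prime_mult:
  assumes P: "P \<in> prime_ideals" and I: "I \<in> (nonzero_ideals :: 'k::number_field set set)"
  shows "prime_exponents I P < prime_exponents (P \<cdot>\<^bsub>\<O>\<^esub> I) P"
proof -
  note P' = prime_ideals_ideal[OF P]
  let ?k = "prime_exponents I P"
  have "I \<subseteq> ideal_pow P ?k" using subset_prime_pow_iff[OF I P] by simp
  hence "P \<cdot>\<^bsub>\<O>\<^esub> I \<subseteq> P \<cdot>\<^bsub>\<O>\<^esub> ideal_pow P ?k"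
    by (rule ideal_prod_mono[OF order.refl _ P' ideal_ideal_pow[OF P']])
  also have "\<dots> = ideal_pow P (Suc ?k)"
    using cring.ideal_prod_commute[OF cring_ring_of_integers P' ideal_ideal_pow[OF P']] by (simp add: ideal_pow_Suc)
  finally show ?thesis
    using subset_prime_pow_iff[OF nonzero_ideals_prod[OF prime_ideals_nonzero[OF P] I] P] by simp
qed

text \<open>For a in \<open>I\<close> outside the product \<open>?J\<close>, the elements r with r a
  \<in> ?J form a proper ideal containing \<open>P\<close>, hence equal to \<open>P\<close>. So the
  elements y + x a, with y over representatives of R/I and x over representatives of R/P, are
  pairwise incongruent modulo \<open>?J\<close>: reduction modulo \<open>I\<close> recovers y, and
  then x is recovered modulo \<open>P\<close>.\<close>

lemma ideal_norm_prime_mult_ge: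
  assumes P: "P \<in> prime_ideals" and I: "I \<in> (nonzero_ideals :: 'k::number_field set set)"
  shows "ideal_norm P * ideal_norm I \<le> ideal_norm (P \<cdot>\<^bsub>\<O>\<^esub> I)"
proof -
  note P' = prime_ideals_ideal[OF P] and I' = nonzero_ideals_ideal[OF I]
  let ?J = "P \<cdot>\<^bsub>\<O>\<^esub> I"
  have J: "?J \<in> nonzero_ideals" by (rule nonzero_ideals_prod[OF prime_ideals_nonzero[OF P] I])
  note J' = nonzero_ideals_ideal[OF J]
  have "?J \<noteq> I" using prime_exponents_prime_mult[OF P I] by auto
  then obtain a where a: "a \<in> I" "a \<notin> ?J" using ideal_prod_subset_right[OF P' I'] by blast
  have aO: "algebraic_int a" by (rule ideal_algebraic_int[OF I' a(1)])
  define A where "A = {r \<in> carrier \<O>. r * a \<in> ?J}"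
  have "A = P"
  proof -
    have "ideal A \<O>" unfolding A_def by (rule ideal_colon[OF J' aO])
    moreover have "P \<subseteq> A" using ideal_prod_mem[OF _ a(1)] ideal_algebraic_int[OF P'] by (auto simp: A_def)
    moreover have "1 \<notin> A" using a(2) by (simp add: A_def)
    hence "A \<noteq> carrier \<O>" by auto
    ultimately show ?thesis using prime_ideals_maximal[OF P] by blast
  qed
  hence cancel: "r \<in> P" if "algebraic_int r" "r * a \<in> ?J" for r using that by (auto simp: A_def)
  define \<rho> where "\<rho> = (\<lambda>X :: 'k set. SOME x. x \<in> X)"
  have rep: "algebraic_int (\<rho> X) \<and> X = (+) (\<rho> X) ` K" if "ideal K \<O>" "X \<in> carrier (\<O> Quot K)" for X K
  proof -
    from that(2) obtain x where x: "algebraic_int x" "X = (+) x ` K" unfolding carrier_Quot by auto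
    have "x + 0 \<in> X" using ideal_zero[OF that(1)] x(2) by blast
    hence "\<rho> X \<in> X" unfolding \<rho>_def by (rule someI)
    thus ?thesis using x translate_eqI[OF that(1)] ideal_algebraic_int[OF that(1)] by (auto intro!: algebraic_int_add)
  qed
  define f where "f = (\<lambda>(X, Y). (+) (\<rho> Y + \<rho> X * a) ` ?J)"
  have "inj_on f (carrier (\<O> Quot P) \<times> carrier (\<O> Quot I))"
  proof (rule inj_onI, clarify)
    fix X Y X' Y'
    assume X: "X \<in> carrier (\<O> Quot P)" "X' \<in> carrier (\<O> Quot P)"
      and Y: "Y \<in> carrier (\<O> Quot I)" "Y' \<in> carrier (\<O> Quot I)" and eq: "f (X, Y) = f (X', Y')"
    note repX = rep[OF P' X(1)] rep[OF P' X(2)] and repY = rep[OF I' Y(1)] rep[OF I' Y(2)]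
    have *: "(\<rho> Y + \<rho> X * a) - (\<rho> Y' + \<rho> X' * a) \<in> ?J"
      using eq translate_eq_iff[OF J'] by (simp add: f_def)
    have "(\<rho> Y + \<rho> X * a) - (\<rho> Y' + \<rho> X' * a) \<in> I"
      using * ideal_prod_subset_right[OF P' I'] by blast
    moreover have "(\<rho> X' - \<rho> X) * a \<in> I"
      using repX a(1) by (intro ideal_mult_left[OF I'] algebraic_int_diff) auto
    ultimately have "\<rho> Y - \<rho> Y' \<in> I"
      using ideal_add[OF I'] by (fastforce simp: algebra_simps)
    hence Yeq: "Y = Y'" using repY translate_eq_iff[OF I'] by metis
    hence "(\<rho> X - \<rho> X') * a \<in> ?J" using * by (simp add: algebra_simps)
    hence "\<rho> X - \<rho> X' \<in> P" using repX by (intro cancel algebraic_int_diff) auto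
    hence "X = X'" using repX translate_eq_iff[OF P'] by metis
    with Yeq show "X = X' \<and> Y = Y'" by simp
  qed
  moreover have "f ` (carrier (\<O> Quot P) \<times> carrier (\<O> Quot I)) \<subseteq> carrier (\<O> Quot ?J)"
  proof clarify
    fix X Y assume "X \<in> carrier (\<O> Quot P)" "Y \<in> carrier (\<O> Quot I)"
    hence "algebraic_int (\<rho> Y + \<rho> X * a)"
      using rep[OF P'] rep[OF I'] aO by (intro algebraic_int_add algebraic_int_mult) auto
    thus "f (X, Y) \<in> carrier (\<O> Quot ?J)" unfolding carrier_Quot f_def by (simp del: image_add_0)
  qed
  ultimately have "card (carrier (\<O> Quot P) \<times> carrier (\<O> Quot I)) \<le> card (carrier (\<O> Quot ?J))"
    using finite_quotient[OF J] by (intro card_inj_on_le[of f])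
  thus ?thesis by (simp add: ideal_norm_def card_cartesian_product)
qed

lemma prime_power_product_nonzero:
  assumes "finite \<S>" "\<S> \<subseteq> (prime_ideals :: 'k::number_field set set)"
  shows "prime_power_product \<S> k \<in> nonzero_ideals"
  using assms
proof (induction \<S> rule: finite_induct)
  case (insert P \<S>)
  thus ?case
    by (simp add: prime_power_product_insert nonzero_ideals_prod ideal_pow_nonzero prime_ideals_nonzero)
qed (simp add: prime_power_product_empty nonzero_ideals_carrier)

lemma ideal_norm_prime_pow_mult_ge:
  assumes P: "P \<in> prime_ideals" and I: "I \<in> (nonzero_ideals :: 'k::number_field set set)"
  shows "ideal_norm P ^ n * ideal_norm I \<le> ideal_norm (ideal_pow P n \<cdot>\<^bsub>\<O>\<^esub> I)"
proof (induction n)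
  case 0
  have "carrier \<O> \<cdot>\<^bsub>\<O>\<^esub> I = I"
    using cring.ideal_prod_commute[OF cring_ring_of_integers ideal_carrier nonzero_ideals_ideal[OF I]]
      ring.ideal_prod_one[OF ring_ring_of_integers nonzero_ideals_ideal[OF I]] by simp
  thus ?case by (simp add: ideal_pow_0)
next
  case (Suc n)
  note P' = prime_ideals_ideal[OF P] and I' = nonzero_ideals_ideal[OF I]
  have "ideal_norm P ^ Suc n * ideal_norm I \<le> ideal_norm P * ideal_norm (ideal_pow P n \<cdot>\<^bsub>\<O>\<^esub> I)"
    using Suc by (simp add: mult.assoc)
  also have "\<dots> \<le> ideal_norm (P \<cdot>\<^bsub>\<O>\<^esub> (ideal_pow P n \<cdot>\<^bsub>\<O>\<^esub> I))"
    by (rule ideal_norm_prime_mult_ge[OF P nonzero_ideals_prod[OF ideal_pow_nonzero[OF prime_ideals_nonzero[OF P]] I]])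
  also have "P \<cdot>\<^bsub>\<O>\<^esub> (ideal_pow P n \<cdot>\<^bsub>\<O>\<^esub> I) = ideal_pow P (Suc n) \<cdot>\<^bsub>\<O>\<^esub> I"
    unfolding ideal_pow_Suc
    using ring.ideal_prod_assoc[OF ring_ring_of_integers P' ideal_ideal_pow[OF P'] I']
      cring.ideal_prod_commute[OF cring_ring_of_integers P' ideal_ideal_pow[OF P']] by metis
  finally show ?case .
qed

lemma ideal_norm_prime_power_product_ge:
  assumes "finite \<S>" "\<S> \<subseteq> (prime_ideals :: 'k::number_field set set)"
  shows "(\<Prod>P\<in>\<S>. ideal_norm P ^ k P) \<le> ideal_norm (prime_power_product \<S> k)"
  using assms
proof (induction \<S> rule: finite_induct)
  case empty
  have "ideal_norm (carrier (\<O> :: 'k ring)) > 0" by (rule ideal_norm_pos[OF nonzero_ideals_carrier])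
  thus ?case by (simp add: prime_power_product_empty)
next
  case (insert P \<S>)
  hence P: "P \<in> prime_ideals" "\<S> \<subseteq> prime_ideals" by auto
  have "(\<Prod>P\<in>insert P \<S>. ideal_norm P ^ k P) \<le> ideal_norm P ^ k P * ideal_norm (prime_power_product \<S> k)"
    using insert P by simp
  also have "\<dots> \<le> ideal_norm (ideal_pow P (k P) \<cdot>\<^bsub>\<O>\<^esub> prime_power_product \<S> k)"
    by (rule ideal_norm_prime_pow_mult_ge[OF P(1) prime_power_product_nonzero[OF insert.hyps(1) P(2)]])
  finally show ?case by (simp add: prime_power_product_insert[OF insert.hyps(1) P(2,1) insert.hyps(2)])
qed

text \<open>The index set may exceed the support of the exponents, so that several ideals can share
  one finite set of primes.\<close>

lemma ideal_norm_ge_prime_product: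
  assumes "I \<in> (nonzero_ideals :: 'k::number_field set set)" "finite \<S>" "{P. prime_exponents I P \<noteq> 0} \<subseteq> \<S>"
  shows "(\<Prod>P\<in>\<S>. ideal_norm P ^ prime_exponents I P) \<le> ideal_norm I"
proof -
  have "(\<Prod>P\<in>\<S>. ideal_norm P ^ prime_exponents I P) =
      (\<Prod>P\<in>{P. prime_exponents I P \<noteq> 0}. ideal_norm P ^ prime_exponents I P)"
    using assms(2,3) by (intro prod.mono_neutral_right) auto
  also have "\<dots> \<le> ideal_norm (prime_power_product {P. prime_exponents I P \<noteq> 0} (prime_exponents I))"
    by (rule ideal_norm_prime_power_product_ge[OF finite_prime_exponents[OF assms(1)] prime_exponents_prime[OF assms(1)]])
  finally show ?thesis using ideal_factorization[OF assms(1)] by simp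
qed

section \<open>Primes over a given integer and convergence of the zeta series\<close>

definition least_positive_integer :: "'k::number_field set \<Rightarrow> nat"
  where "least_positive_integer P = (LEAST m. m > 0 \<and> of_nat m \<in> P)"

text \<open>By minimality of c the integers 0, ..., c - 1 are pairwise incongruent modulo
  \<open>I\<close>, so there are at least c cosets.\<close>

lemma least_positive_integer:
  assumes "I \<in> (nonzero_ideals :: 'k::number_field set set)"
  shows least_positive_integer_pos: "least_positive_integer I > 0"
    and least_positive_integer_mem: "of_nat (least_positive_integer I) \<in> I"
    and least_positive_integer_le_norm: "least_positive_integer I \<le> ideal_norm I"
proof -
  note I = nonzero_ideals_ideal[OF assms]
  obtain m :: int where "m > 0" "of_int m \<in> I" using nonzero_ideals_of_int[OF assms] .
  hence "nat m > 0 \<and> of_nat (nat m) \<in> I" by simp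
  hence ex: "\<exists>m. m > 0 \<and> of_nat m \<in> I" by blast
  let ?c = "least_positive_integer I"
  show pos: "?c > 0" and "of_nat ?c \<in> I"
    using LeastI_ex[OF ex] unfolding least_positive_integer_def by auto
  have least: "?c \<le> m" if "m > 0" "of_nat m \<in> I" for m
    unfolding least_positive_integer_def using that by (intro Least_le) auto
  have inj: "inj_on (\<lambda>i. (+) (of_nat i) ` I) {..<?c}"
  proof (rule linorder_inj_onI')
    fix i j assume ij: "i \<in> {..<?c}" "j \<in> {..<?c}" "i < j"
    show "(+) (of_nat i) ` I \<noteq> (+) (of_nat j) ` I"
    proof
      assume "(+) (of_nat i) ` I = (+) (of_nat j) ` I"
      hence "of_nat j - of_nat i \<in> I" using translate_eq_iff[OF I] ideal_diff_commute[OF I] by blast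
      hence "of_nat (j - i) \<in> I" using ij by (simp add: of_nat_diff)
      thus False using least[of "j - i"] ij by auto
    qed
  qed
  have sub: "(\<lambda>i. (+) (of_nat i) ` I) ` {..<?c} \<subseteq> carrier (\<O> Quot I)"
    unfolding carrier_Quot by (intro image_subsetI imageI) (metis algebraic_int_of_int of_int_of_nat_eq ring_of_integers_simps(1))
  have "card {..<?c} \<le> card (carrier (\<O> Quot I))"
    using inj sub finite_quotient[OF assms] by (rule card_inj_on_le)
  thus "?c \<le> ideal_norm I" by (simp add: ideal_norm_def)
qed

lemma prime_least_positive_integer_ge_2:
  assumes "P \<in> (prime_ideals :: 'k::number_field set set)"
  shows "least_positive_integer P \<ge> 2"
proof -
  have "least_positive_integer P \<noteq> 1"
    using least_positive_integer_mem[OF prime_ideals_nonzero[OF assms]] prime_ideals_not_one[OF assms] by auto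
  thus ?thesis using least_positive_integer_pos[OF prime_ideals_nonzero[OF assms]] by linarith
qed

text \<open>Otherwise the product of more than \<open>n\<close> of these primes contains \<open>m\<close> and has norm greater than \<open>m\<^sup>n\<close>.\<close>

lemma card_primes_over_bound:
  obtains n where "\<And>T m. T \<subseteq> {P \<in> (prime_ideals :: 'k::number_field set set). least_positive_integer P = m} \<Longrightarrow>
    finite T \<Longrightarrow> card T \<le> n"
proof -
  obtain n where n: "\<And>(I :: 'k set) m. ideal I \<O> \<Longrightarrow> m > 0 \<Longrightarrow> of_int m \<in> I \<Longrightarrow>
    finite (carrier (\<O> Quot I)) \<and> ideal_norm I \<le> nat m ^ n" by (rule card_quotient_bound) blast
  have "card T \<le> n"
    if T: "T \<subseteq> {P \<in> (prime_ideals :: 'k set set). least_positive_integer P = m}" "finite T" for T m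
  proof (cases "T = {}")
    case False
    define k where "k = (\<lambda>P. if P \<in> T then 1 else 0 :: nat)"
    have supp: "{P. k P \<noteq> 0} = T" by (auto simp: k_def)
    have prm: "T \<subseteq> prime_ideals" using T by auto
    define J where "J = prime_power_product T k"
    have J: "J \<in> nonzero_ideals" unfolding J_def using T(2) prm by (rule prime_power_product_nonzero)
    have exps: "prime_exponents J = k"
      by (rule prime_exponents_eqI) (simp_all only: supp T(2) prm J_def)
    \<comment> \<open>The integer m lies in every member of \<open>T\<close>, hence in the
      intersection \<open>M\<close>. The exponents of the product \<open>J\<close> are at most 1 and
      supported on \<open>T\<close>, so \<open>M\<close> lies in \<open>J\<close> by comparison of
      exponents, and m lies in \<open>J\<close>.\<close>
    define M where "M = carrier \<O> \<inter> \<Inter>T"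
    have "\<forall>P\<in>T. ideal P \<O>" using prm prime_ideals_ideal by blast
    hence M': "ideal M \<O>" unfolding ideal_ring_of_integers_iff M_def
      by (auto simp: ideal_zero ideal_add ideal_mult_left)
    obtain Q where Q: "Q \<in> T" using False by blast
    hence m: "m \<ge> 2" using prime_least_positive_integer_ge_2 T by blast
    have mP: "of_nat m \<in> P" if "P \<in> T" for P
      using least_positive_integer_mem[OF prime_ideals_nonzero] that T by blast
    have "algebraic_int (of_nat m :: 'k)" using algebraic_int_of_int[of "int m"] by simp
    hence mM: "of_nat m \<in> M" using mP by (simp add: M_def)
    have "of_nat m \<noteq> (0::'k)" using m by simp
    hence "M \<in> nonzero_ideals" using M' mM by (auto simp: nonzero_ideals_def)
    moreover have "prime_exponents J P \<le> prime_exponents M P" if P: "P \<in> prime_ideals" for P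
    proof (cases "P \<in> T")
      case True
      hence "M \<subseteq> P" by (auto simp: M_def)
      also have "P = ideal_pow P 1"
        using cring.ideal_prod_commute[OF cring_ring_of_integers ideal_carrier prime_ideals_ideal[OF P]]
          ring.ideal_prod_one[OF ring_ring_of_integers prime_ideals_ideal[OF P]]
        by (simp add: ideal_pow_Suc ideal_pow_0)
      finally have "1 \<le> prime_exponents M P"
        using subset_prime_pow_iff[OF \<open>M \<in> nonzero_ideals\<close> P] by blast
      thus ?thesis by (simp add: exps k_def)
    qed (simp add: exps k_def)
    ultimately have "M \<subseteq> J" by (intro ideal_subset_if_prime_exponents_le[OF _ J])
    hence "of_int (int m) \<in> J" using mM by auto
    hence "ideal_norm J \<le> m ^ n" using n[OF nonzero_ideals_ideal[OF J], of "int m"] m by simp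
    moreover have "m ^ card T \<le> ideal_norm J"
    proof -
      have "m ^ card T = (\<Prod>P\<in>T. m ^ k P)" by (simp add: k_def)
      also have "\<dots> \<le> (\<Prod>P\<in>T. ideal_norm P ^ k P)"
        using least_positive_integer_le_norm[OF prime_ideals_nonzero] T(1)
        by (intro prod_mono power_mono conjI) auto
      also have "\<dots> \<le> ideal_norm J"
        unfolding J_def by (rule ideal_norm_prime_power_product_ge[OF T(2) prm])
      finally show ?thesis .
    qed
    ultimately have "m ^ card T \<le> m ^ n" by linarith
    thus ?thesis using m by (simp add: power_le_imp_le_exp)
  qed auto
  thus ?thesis using that by blast
qed

text \<open>Each norm is at least the least positive integer of the prime, and at most n primes
  share that integer. Grouping the primes by it bounds the sum by n times the sum of all
  m^(-\<alpha>).\<close>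

lemma prime_norm_sum_bound:
  assumes "\<alpha> > 1"
  obtains C where "\<And>\<S>. finite \<S> \<Longrightarrow> \<S> \<subseteq> (prime_ideals :: 'k::number_field set set) \<Longrightarrow>
    (\<Sum>P\<in>\<S>. real (ideal_norm P) powr (- \<alpha>)) \<le> C"
proof -
  obtain n where n: "\<And>T m. T \<subseteq> {P \<in> (prime_ideals :: 'k::number_field set set). least_positive_integer P = m} \<Longrightarrow>
    finite T \<Longrightarrow> card T \<le> n" by (rule card_primes_over_bound) blast
  let ?c = "least_positive_integer :: 'k set \<Rightarrow> nat"
  have summ: "summable (\<lambda>m. real m powr (- \<alpha>))" using assms by (simp add: summable_real_powr_iff)
  have "(\<Sum>P\<in>\<S>. real (ideal_norm P) powr (- \<alpha>)) \<le> real n * suminf (\<lambda>m. real m powr (- \<alpha>))"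
    if \<S>: "finite \<S>" "\<S> \<subseteq> (prime_ideals :: 'k set set)" for \<S>
  proof -
    have "(\<Sum>P\<in>\<S>. real (ideal_norm P) powr (- \<alpha>)) \<le> (\<Sum>P\<in>\<S>. real (?c P) powr (- \<alpha>))"
    proof (rule sum_mono)
      fix P assume "P \<in> \<S>"
      hence P: "P \<in> nonzero_ideals" using \<S>(2) prime_ideals_nonzero by blast
      show "real (ideal_norm P) powr (- \<alpha>) \<le> real (?c P) powr (- \<alpha>)"
        using least_positive_integer_pos[OF P] least_positive_integer_le_norm[OF P] assms
        by (intro powr_mono2') auto
    qed
    also have "\<dots> = (\<Sum>m\<in>?c ` \<S>. \<Sum>P\<in>{P \<in> \<S>. ?c P = m}. real (?c P) powr (- \<alpha>))"
      by (rule sum.image_gen[OF \<S>(1)])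
    also have "\<dots> = (\<Sum>m\<in>?c ` \<S>. real (card {P \<in> \<S>. ?c P = m}) * real m powr (- \<alpha>))"
      by (intro sum.cong) auto
    also have "\<dots> \<le> (\<Sum>m\<in>?c ` \<S>. real n * real m powr (- \<alpha>))"
      using \<S> by (intro sum_mono mult_right_mono of_nat_mono n) auto
    also have "\<dots> = real n * (\<Sum>m\<in>?c ` \<S>. real m powr (- \<alpha>))" by (simp add: sum_distrib_left)
    also have "\<dots> \<le> real n * suminf (\<lambda>m. real m powr (- \<alpha>))"
      using \<S>(1) summ by (intro mult_left_mono sum_le_suminf) auto
    finally show ?thesis .
  qed
  thus ?thesis using that by blast
qed

text \<open>Euler product: every ideal contributes one of the terms of the expanded product.\<close>

lemma ideal_norm_sum_bound:
  assumes \<alpha>: "\<alpha> > 1"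
  obtains C where "\<And>F. finite F \<Longrightarrow> F \<subseteq> (nonzero_ideals :: 'k::number_field set set) \<Longrightarrow>
    (\<Sum>I\<in>F. real (ideal_norm I) powr (- \<alpha>)) \<le> C"
proof -
  obtain C where C: "\<And>\<S>. finite \<S> \<Longrightarrow> \<S> \<subseteq> (prime_ideals :: 'k::number_field set set) \<Longrightarrow>
    (\<Sum>P\<in>\<S>. real (ideal_norm P) powr (- \<alpha>)) \<le> C" by (rule prime_norm_sum_bound[OF \<alpha>]) blast
  have "(\<Sum>I\<in>F. real (ideal_norm I) powr (- \<alpha>)) \<le> exp (2 * C)"
    if F: "finite F" "F \<subseteq> (nonzero_ideals :: 'k set set)" for F
  proof -
    \<comment> \<open>All primes dividing some member of \<open>F\<close>; with \<open>M\<close> as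
      a common bound on the exponents, only a finite part of the Euler product is expanded.\<close>
    define \<S> where "\<S> = (\<Union>I\<in>F. {P. prime_exponents I P \<noteq> 0})"
    have \<S>: "finite \<S>" "\<S> \<subseteq> prime_ideals"
      using F finite_prime_exponents prime_exponents_prime unfolding \<S>_def by blast+
    define M where "M = Max ((\<lambda>(I, P). prime_exponents I P) ` (F \<times> \<S>))"
    have M: "prime_exponents I P \<le> M" if "I \<in> F" "P \<in> \<S>" for I P
      unfolding M_def using that F(1) \<S>(1) by (intro Max_ge) (auto intro!: image_eqI[of _ _ "(I, P)"])
    define q where "q = (\<lambda>P :: 'k set. real (ideal_norm P) powr (- \<alpha>))"
    have q: "0 \<le> q P" "q P \<le> 1/2" if "P \<in> \<S>" for P
    proof -
      have P: "P \<in> prime_ideals" using that \<S> by auto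
      have "ideal_norm P \<ge> 2"
        using prime_least_positive_integer_ge_2[OF P] least_positive_integer_le_norm[OF prime_ideals_nonzero[OF P]]
        by linarith
      hence N: "real (ideal_norm P) \<ge> 2" by linarith
      hence "q P \<le> real (ideal_norm P) powr (-1)" unfolding q_def using \<alpha> by (intro powr_mono) auto
      also have "\<dots> = 1 / real (ideal_norm P)" using N by (simp add: powr_minus_divide)
      also have "\<dots> \<le> 1/2" using N by (intro divide_left_mono) auto
      finally show "q P \<le> 1/2" .
    qed (simp add: q_def)
    have "(\<Sum>I\<in>F. real (ideal_norm I) powr (- \<alpha>)) \<le> (\<Sum>I\<in>F. \<Prod>P\<in>\<S>. q P ^ prime_exponents I P)"
    proof (rule sum_mono)
      fix I assume I: "I \<in> F"
      have pos: "ideal_norm P > 0" if "P \<in> \<S>" for P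
        using that \<S>(2) ideal_norm_pos prime_ideals_nonzero by blast
      have le: "(\<Prod>P\<in>\<S>. ideal_norm P ^ prime_exponents I P) \<le> ideal_norm I"
        using I F(2) by (intro ideal_norm_ge_prime_product) (auto simp: \<S>(1), auto simp: \<S>_def)
      have "(\<Prod>P\<in>\<S>. ideal_norm P ^ prime_exponents I P) > 0" using pos by (intro prod_pos) auto
      hence "real (ideal_norm I) powr (- \<alpha>) \<le> real (\<Prod>P\<in>\<S>. ideal_norm P ^ prime_exponents I P) powr (- \<alpha>)"
        using le \<alpha> by (intro powr_mono2') (auto simp del: of_nat_prod)
      also have "\<dots> = (\<Prod>P\<in>\<S>. (real (ideal_norm P) ^ prime_exponents I P) powr (- \<alpha>))"
        by (simp add: prod_powr_distrib)
      also have "\<dots> = (\<Prod>P\<in>\<S>. q P ^ prime_exponents I P)"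
      proof (rule prod.cong)
        fix P assume "P \<in> \<S>"
        thus "(real (ideal_norm P) ^ prime_exponents I P) powr (- \<alpha>) = q P ^ prime_exponents I P"
          using pos[of P] by (simp add: q_def powr_powr powr_realpow[symmetric] mult.commute)
      qed auto
      finally show "real (ideal_norm I) powr (- \<alpha>) \<le> (\<Prod>P\<in>\<S>. q P ^ prime_exponents I P)" .
    qed
    \<comment> \<open>Unique factorization: exponents of ideals in \<open>F\<close> vanish outside
      \<open>\<S>\<close>, so their restrictions to \<open>\<S>\<close> determine the ideals, and
      the sum runs over distinct exponent tuples.\<close>
    also have "\<dots> = (\<Sum>g\<in>(\<lambda>I. restrict (prime_exponents I) \<S>) ` F. \<Prod>P\<in>\<S>. q P ^ g P)"
    proof (subst sum.reindex)
      show "inj_on (\<lambda>I. restrict (prime_exponents I) \<S>) F"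
      proof (rule inj_onI)
        fix I J assume IJ: "I \<in> F" "J \<in> F" "restrict (prime_exponents I) \<S> = restrict (prime_exponents J) \<S>"
        have "prime_exponents I P = prime_exponents J P" for P
        proof (cases "P \<in> \<S>")
          case True
          thus ?thesis using IJ(3) by (metis restrict_apply')
        next
          case False
          thus ?thesis using IJ(1,2) by (auto simp: \<S>_def)
        qed
        hence "prime_exponents I = prime_exponents J" by blast
        thus "I = J" using ideal_factorization[of I] ideal_factorization[of J] IJ F(2) by (metis subsetD)
      qed
    qed auto
    also have "\<dots> \<le> (\<Sum>g\<in>Pi\<^sub>E \<S> (\<lambda>_. {..M}). \<Prod>P\<in>\<S>. q P ^ g P)"
      using M q \<S>(1) by (intro sum_mono2 prod_nonneg finite_PiE) auto
    also have "\<dots> = (\<Prod>P\<in>\<S>. \<Sum>j\<le>M. q P ^ j)"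
      using \<S>(1) by (intro prod_sum_PiE[symmetric]) auto
    \<comment> \<open>For 0 \<le> q \<le> 1/2 the geometric sum is at most 1/(1 - q) \<le> 1 + 2q
      \<le> exp(2q). This is the origin of the constant exp(2C).\<close>
    also have "\<dots> \<le> (\<Prod>P\<in>\<S>. exp (2 * q P))"
    proof (rule prod_mono, intro conjI)
      fix P assume P: "P \<in> \<S>"
      show "0 \<le> (\<Sum>j\<le>M. q P ^ j)" using q[OF P] by (intro sum_nonneg) auto
      have "(\<Sum>j\<le>M. q P ^ j) = (1 - q P ^ Suc M) / (1 - q P)"
        using q[OF P] by (subst sum_gp0) auto
      also have "\<dots> \<le> 1 / (1 - q P)" using q[OF P] by (intro divide_right_mono) auto
      also have "\<dots> \<le> 1 + 2 * q P"
      proof -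
        have "1 \<le> (1 + 2 * q P) * (1 - q P)"
          using mult_nonneg_nonneg[of "q P" "1 - 2 * q P"] q[OF P] by (simp add: algebra_simps)
        thus ?thesis using q[OF P] by (simp add: divide_le_eq)
      qed
      also have "\<dots> \<le> exp (2 * q P)" by (rule exp_ge_add_one_self)
      finally show "(\<Sum>j\<le>M. q P ^ j) \<le> exp (2 * q P)" .
    qed
    also have "\<dots> = exp (2 * (\<Sum>P\<in>\<S>. q P))" by (simp add: exp_sum[OF \<S>(1)] sum_distrib_left)
    also have "\<dots> \<le> exp (2 * C)" using C[OF \<S>] by (simp add: q_def)
    finally show ?thesis .
  qed
  thus ?thesis using that by blast
qed

section \<open>C*-algebras\<close>

instance cstar_algebra \<subseteq> banach ..

lemma scaleC_zero_left [simp]: "0 *\<^sub>C x = 0" for x :: "'a::cstar_algebra"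
  using scaleC_of_real[of 0 x] by simp

lemma scaleC_zero_right [simp]: "c *\<^sub>C (0::'a::cstar_algebra) = 0"
  using scaleC_add_right[of c 0 "0::'a"] by simp

lemma scaleC_one [simp]: "1 *\<^sub>C x = x" for x :: "'a::cstar_algebra"
  using scaleC_of_real[of 1 x] by simp

lemma scaleC_minus1: "(- 1) *\<^sub>C x = - x" for x :: "'a::cstar_algebra"
  using scaleC_of_real[of "- 1" x] by simp

lemma star_zero [simp]: "star (0::'a::cstar_algebra) = 0"
  using star_add[of 0 "0::'a"] by simp

lemma star_minus: "star (- x) = - star x" for x :: "'a::cstar_algebra"
  using star_add[of x "- x"] by (simp add: eq_neg_iff_add_eq_0 add.commute)

lemma star_diff: "star (x - y) = star x - star y" for x :: "'a::cstar_algebra"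
  using star_add[of x "- y"] by (simp add: star_minus)

lemma norm_star [simp]: "norm (star x) = norm x" for x :: "'a::cstar_algebra"
proof -
  have le: "norm y \<le> norm (star y)" for y :: 'a
  proof (cases "y = 0")
    case False
    have "(norm y)\<^sup>2 \<le> norm (star y) * norm y"
      using norm_mult_ineq[of "star y" y] by (simp add: cstar_identity)
    thus ?thesis using False by (simp add: power2_eq_square)
  qed auto
  from le[of x] le[of "star x"] show ?thesis by (simp add: star_star)
qed

lemma tendsto_star: "(f \<longlongrightarrow> x) F \<Longrightarrow> ((\<lambda>i. star (f i)) \<longlongrightarrow> star x) F"
  for x :: "'a::cstar_algebra"
  by (simp add: tendsto_iff dist_norm flip: star_diff)

lemma tendsto_scaleC: "(f \<longlongrightarrow> x) F \<Longrightarrow> ((\<lambda>i. c *\<^sub>C f i) \<longlongrightarrow> c *\<^sub>C x) F"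
  for x :: "'a::cstar_algebra"
proof -
  assume f: "(f \<longlongrightarrow> x) F"
  have "c *\<^sub>C f i - c *\<^sub>C x = c *\<^sub>C (f i - x)" for i
    using scaleC_add_right[of c "f i - x" x] by (simp add: algebra_simps)
  moreover have "((\<lambda>i. cmod c * norm (f i - x)) \<longlongrightarrow> cmod c * 0) F"
    using f by (intro tendsto_intros) (simp add: tendsto_norm_zero_iff LIM_zero_iff)
  ultimately show ?thesis
    by (subst LIM_zero_iff[symmetric], subst tendsto_norm_zero_iff[symmetric]) (simp add: norm_scaleC)
qed

lemma cstar_subalgebra_generated: "cstar_subalgebra (cstar_generated \<S>)"
  unfolding cstar_generated_def
  by (rule hull_in) (auto simp: cstar_subalgebra_def)

lemma subset_cstar_generated: "\<S> \<subseteq> cstar_generated \<S>"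
  unfolding cstar_generated_def by (rule hull_subset)

lemma cstar_generated_minimal: "\<S> \<subseteq> B \<Longrightarrow> cstar_subalgebra B \<Longrightarrow> cstar_generated \<S> \<subseteq> B"
  unfolding cstar_generated_def by (rule hull_minimal)

context
  fixes B :: "'a::cstar_algebra set"
  assumes B: "cstar_subalgebra B"
begin

lemma cstar_subalgebra_zero: "0 \<in> B"
  and cstar_subalgebra_closed: "closed B"
  and cstar_subalgebra_add: "x \<in> B \<Longrightarrow> y \<in> B \<Longrightarrow> x + y \<in> B"
  and cstar_subalgebra_mult: "x \<in> B \<Longrightarrow> y \<in> B \<Longrightarrow> x * y \<in> B"
  and cstar_subalgebra_scaleC: "x \<in> B \<Longrightarrow> c *\<^sub>C x \<in> B"
  and cstar_subalgebra_star: "x \<in> B \<Longrightarrow> star x \<in> B"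
  using B by (auto simp: cstar_subalgebra_def)

lemma cstar_subalgebra_diff: "x \<in> B \<Longrightarrow> y \<in> B \<Longrightarrow> x - y \<in> B"
  using cstar_subalgebra_add[of x "- y"] cstar_subalgebra_scaleC[of y "- 1"] by (simp add: scaleC_minus1)

lemma cstar_subalgebra_sum: "(\<And>i. i \<in> A \<Longrightarrow> f i \<in> B) \<Longrightarrow> sum f A \<in> B"
  by (induction A rule: infinite_finite_induct) (auto intro: cstar_subalgebra_zero cstar_subalgebra_add)

end

lemma cstar_subalgebra_closure:
  fixes D :: "'a::cstar_algebra set"
  assumes "0 \<in> D" "\<And>x y. x \<in> D \<Longrightarrow> y \<in> D \<Longrightarrow> x + y \<in> D" "\<And>x y. x \<in> D \<Longrightarrow> y \<in> D \<Longrightarrow> x * y \<in> D"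
    "\<And>c x. x \<in> D \<Longrightarrow> c *\<^sub>C x \<in> D" "\<And>x. x \<in> D \<Longrightarrow> star x \<in> D"
  shows "cstar_subalgebra (closure D)"
  unfolding cstar_subalgebra_def
proof (intro conjI ballI allI)
  show "0 \<in> closure D" using assms(1) closure_subset by blast
  fix x y assume "x \<in> closure D" "y \<in> closure D"
  then obtain f g where fg: "\<And>n. f n \<in> D" "f \<longlonglongrightarrow> x" "\<And>n. g n \<in> D" "g \<longlonglongrightarrow> y"
    unfolding closure_sequential by blast
  show "x + y \<in> closure D" unfolding closure_sequential
    using fg assms(2) by (intro exI[of _ "\<lambda>n. f n + g n"]) (auto intro: tendsto_add)
  show "x * y \<in> closure D" unfolding closure_sequential
    using fg assms(3) by (intro exI[of _ "\<lambda>n. f n * g n"]) (auto intro: tendsto_mult)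
next
  fix c x assume "x \<in> closure D"
  then obtain f where fg: "\<And>n. f n \<in> D" "f \<longlonglongrightarrow> x" unfolding closure_sequential by blast
  show "c *\<^sub>C x \<in> closure D" unfolding closure_sequential
    using fg assms(4) by (intro exI[of _ "\<lambda>n. c *\<^sub>C f n"]) (auto intro: tendsto_scaleC)
next
  fix x assume "x \<in> closure D"
  then obtain f where fg: "\<And>n. f n \<in> D" "f \<longlonglongrightarrow> x" unfolding closure_sequential by blast
  show "star x \<in> closure D" unfolding closure_sequential
    using fg assms(5) by (intro exI[of _ "\<lambda>n. star (f n)"]) (auto intro: tendsto_star)
qed auto

section \<open>Characters\<close>

context
  fixes B :: "'a::cstar_algebra set" and \<phi>
  assumes B: "cstar_subalgebra B" and \<phi>: "\<phi> \<in> spectrum B"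
begin

lemma spectrum_add: "x \<in> B \<Longrightarrow> y \<in> B \<Longrightarrow> \<phi> (x + y) = \<phi> x + \<phi> y"
  and spectrum_mult: "x \<in> B \<Longrightarrow> y \<in> B \<Longrightarrow> \<phi> (x * y) = \<phi> x * \<phi> y"
  and spectrum_scaleC: "x \<in> B \<Longrightarrow> \<phi> (c *\<^sub>C x) = c * \<phi> x"
  using \<phi> by (auto simp: spectrum_def)

lemma spectrum_zero: "\<phi> 0 = 0"
  using spectrum_scaleC[OF cstar_subalgebra_zero[OF B], of 0] by simp

lemma spectrum_diff: "x \<in> B \<Longrightarrow> y \<in> B \<Longrightarrow> \<phi> (x - y) = \<phi> x - \<phi> y"
  using spectrum_add[of x "- y"] spectrum_scaleC[of y "- 1"] cstar_subalgebra_scaleC[OF B, of y "- 1"]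
  by (simp add: scaleC_minus1)

lemma spectrum_sum: "(\<And>i. i \<in> A \<Longrightarrow> f i \<in> B) \<Longrightarrow> \<phi> (sum f A) = (\<Sum>i\<in>A. \<phi> (f i))"
proof (induction A rule: infinite_finite_induct)
  case (insert a A)
  thus ?case using spectrum_add[of "f a" "sum f A"] cstar_subalgebra_sum[OF B, of A f] by simp
qed (auto simp: spectrum_zero)

lemma spectrum_one: "1 \<in> B \<Longrightarrow> \<phi> 1 = 1"
proof -
  assume 1: "1 \<in> B"
  obtain x where "x \<in> B" "\<phi> x \<noteq> 0" using \<phi> by (auto simp: spectrum_def)
  thus ?thesis using spectrum_mult[OF 1, of x] by simp
qed

text \<open>If \<open>\<parallel>x\<parallel> < |\<phi>(x)|\<close>, then \<open>y = x / \<phi>(x)\<close> and \<open>z = y + y\<^sup>2 + \<dots>\<close> satisfy \<open>z = y + yz\<close>, whence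
  \<open>\<phi>(z) = 1 + \<phi>(z)\<close>.\<close>

lemma spectrum_norm_le:
  assumes x: "x \<in> B"
  shows "cmod (\<phi> x) \<le> norm x"
proof (rule ccontr)
  assume "\<not> cmod (\<phi> x) \<le> norm x"
  hence *: "norm x < cmod (\<phi> x)" by simp
  hence nz: "\<phi> x \<noteq> 0" using norm_ge_zero[of x] by auto
  define y where "y = inverse (\<phi> x) *\<^sub>C x"
  have "norm y = norm x / cmod (\<phi> x)"
    by (simp add: y_def norm_scaleC norm_inverse divide_inverse mult.commute)
  hence y: "y \<in> B" "\<phi> y = 1" "norm y < 1"
    using x nz * by (simp_all add: y_def cstar_subalgebra_scaleC[OF B] spectrum_scaleC)
  define z where "z = suminf (\<lambda>n. y ^ Suc n)"
  have "summable (\<lambda>n. y ^ n)" using y(3) by (rule complete_algebra_summable_geometric)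
  hence summ: "summable (\<lambda>n. y ^ Suc n)" by (subst summable_Suc_iff)
  have pow: "y ^ Suc n \<in> B" for n
    by (induction n) (use y(1) in \<open>auto intro: cstar_subalgebra_mult[OF B]\<close>)
  have "z \<in> B"
  proof (rule Lim_in_closed_set[OF cstar_subalgebra_closed[OF B] _ sequentially_bot])
    show "(\<lambda>n. \<Sum>i<n. y ^ Suc i) \<longlonglongrightarrow> z" unfolding z_def using summable_LIMSEQ[OF summ] .
    show "\<forall>\<^sub>F n in sequentially. (\<Sum>i<n. y ^ Suc i) \<in> B"
      using pow by (intro always_eventually allI cstar_subalgebra_sum[OF B])
  qed
  have "z = y ^ Suc 0 + suminf (\<lambda>n. y ^ Suc (Suc n))"
    unfolding z_def using suminf_split_head[OF summ] by simp
  also have "suminf (\<lambda>n. y ^ Suc (Suc n)) = y * z"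
    unfolding z_def using suminf_mult[OF summ, of y] by simp
  finally have "z = y + y * z" by simp
  hence "\<phi> z = 1 + \<phi> z"
    using y \<open>z \<in> B\<close> by (metis cstar_subalgebra_mult[OF B] mult_1 spectrum_add spectrum_mult)
  thus False by simp
qed

lemma spectrum_tendsto:
  assumes "\<And>n. f n \<in> B" "x \<in> B" "f \<longlonglongrightarrow> x"
  shows "(\<lambda>n. \<phi> (f n)) \<longlonglongrightarrow> \<phi> x"
proof (rule LIM_zero_cancel, rule Lim_null_comparison)
  show "\<forall>\<^sub>F n in sequentially. cmod (\<phi> (f n) - \<phi> x) \<le> norm (f n - x)"
    using spectrum_norm_le cstar_subalgebra_diff[OF B] spectrum_diff assms by (intro always_eventually allI) metis
  show "(\<lambda>n. norm (f n - x)) \<longlonglongrightarrow> 0" using assms(3) by (simp add: tendsto_norm_zero_iff LIM_zero_iff)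
qed

end

text \<open>Only self-adjoint generators are considered, so that no statement about \<open>\<phi> (star x)\<close> is needed.\<close>

lemma spectrum_eqI:
  fixes \<S> :: "'a::cstar_algebra set"
  assumes \<phi>: "\<phi> \<in> spectrum (cstar_generated \<S>)" and \<psi>: "\<psi> \<in> spectrum (cstar_generated \<S>)"
    and eq: "\<And>x. x \<in> \<S> \<Longrightarrow> \<phi> x = \<psi> x" and sa: "\<And>x. x \<in> \<S> \<Longrightarrow> star x = x"
  shows "\<phi> = \<psi>"
proof -
  let ?B = "cstar_generated \<S>"
  note B = cstar_subalgebra_generated[of \<S>]
  define D where "D = {x \<in> ?B. star x \<in> ?B \<and> \<phi> x = \<psi> x \<and> \<phi> (star x) = \<psi> (star x)}"
  have "cstar_subalgebra D"
    unfolding cstar_subalgebra_def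
  proof (intro conjI ballI allI)
    show "closed D" unfolding closed_sequential_limits
    proof (intro allI impI, elim conjE)
      fix f x assume f: "\<forall>n. f n \<in> D" "f \<longlonglongrightarrow> x"
      hence fB: "f n \<in> ?B" "star (f n) \<in> ?B" for n by (auto simp: D_def)
      have x: "x \<in> ?B" using closed_sequentially[OF cstar_subalgebra_closed[OF B]] fB f by blast
      hence x': "star x \<in> ?B" by (rule cstar_subalgebra_star[OF B])
      have "(\<lambda>n. \<phi> (f n)) \<longlonglongrightarrow> \<phi> x" "(\<lambda>n. \<phi> (f n)) \<longlonglongrightarrow> \<psi> x"
        using spectrum_tendsto[OF B \<phi> fB(1) x f(2)] spectrum_tendsto[OF B \<psi> fB(1) x f(2)] f(1)
        by (auto simp: D_def)
      moreover have "(\<lambda>n. \<phi> (star (f n))) \<longlonglongrightarrow> \<phi> (star x)" "(\<lambda>n. \<phi> (star (f n))) \<longlonglongrightarrow> \<psi> (star x)"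
        using spectrum_tendsto[OF B \<phi> fB(2) x' tendsto_star[OF f(2)]]
          spectrum_tendsto[OF B \<psi> fB(2) x' tendsto_star[OF f(2)]] f(1) by (auto simp: D_def)
      ultimately show "x \<in> D" using x x' LIMSEQ_unique by (auto simp: D_def)
    qed
  qed (auto simp: D_def star_add star_mult star_scaleC star_star cstar_subalgebra_zero[OF B]
      cstar_subalgebra_add[OF B] cstar_subalgebra_mult[OF B] cstar_subalgebra_scaleC[OF B]
      spectrum_zero[OF B \<phi>] spectrum_zero[OF B \<psi>] spectrum_add[OF B \<phi>] spectrum_add[OF B \<psi>]
      spectrum_mult[OF B \<phi>] spectrum_mult[OF B \<psi>] spectrum_scaleC[OF B \<phi>] spectrum_scaleC[OF B \<psi>])
  moreover have "\<S> \<subseteq> D" using subset_cstar_generated[of \<S>] eq sa by (auto simp: D_def)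
  ultimately have "?B \<subseteq> D" by (intro cstar_generated_minimal)
  hence "\<phi> x = \<psi> x" if "x \<in> ?B" for x using that by (auto simp: D_def)
  moreover have "\<phi> \<in> extensional ?B" "\<psi> \<in> extensional ?B" using \<phi> \<psi> by (auto simp: spectrum_def)
  ultimately show ?thesis by (auto intro: extensionalityI)
qed

lemma spectrum_restrict:
  assumes "\<phi> \<in> spectrum B" "x \<in> A" "\<phi> x \<noteq> 0" "A \<subseteq> B" "cstar_subalgebra A"
  shows "restrict \<phi> A \<in> spectrum A"
  using assms unfolding spectrum_def
  by (auto simp: cstar_subalgebra_add cstar_subalgebra_mult cstar_subalgebra_scaleC subset_iff intro!: bexI[of _ x])

section \<open>Evaluation of *-polynomials\<close>

lemma poly_mapping_eq_sum_single: "p = (\<Sum>w\<in>Poly_Mapping.keys p. Poly_Mapping.single w (Poly_Mapping.lookup p w))"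
proof (rule poly_mapping_eqI)
  fix k
  have "(\<Sum>w\<in>Poly_Mapping.keys p. Poly_Mapping.lookup (Poly_Mapping.single w (Poly_Mapping.lookup p w)) k) =
      (\<Sum>w\<in>Poly_Mapping.keys p. if w = k then Poly_Mapping.lookup p w else 0)"
    by (intro sum.cong) (auto simp: lookup_single when_def)
  also have "\<dots> = Poly_Mapping.lookup p k" by (simp add: in_keys_iff)
  finally show "Poly_Mapping.lookup p k =
      Poly_Mapping.lookup (\<Sum>w\<in>Poly_Mapping.keys p. Poly_Mapping.single w (Poly_Mapping.lookup p w)) k"
    by (simp add: lookup_sum)
qed

lemma times_eq_sum_single:
  fixes p q :: "'w::monoid_add \<Rightarrow>\<^sub>0 complex"
  shows "p * q = (\<Sum>v\<in>Poly_Mapping.keys p. \<Sum>w\<in>Poly_Mapping.keys q.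
    Poly_Mapping.single (v + w) (Poly_Mapping.lookup p v * Poly_Mapping.lookup q w))"
  by (subst poly_mapping_eq_sum_single[of p], subst poly_mapping_eq_sum_single[of q])
     (simp add: sum_product mult_single)

text \<open>Linear extension from basis elements, with a variable scalar multiplication
  \<open>sc\<close>. It covers the evaluation in a C*-algebra, the action on vectors, and complex
  values attached to coset projections; additivity of \<open>sc\<close> in the scalar is what these
  have in common.\<close>

definition linear_ext :: "(complex \<Rightarrow> 'b \<Rightarrow> 'b::ab_group_add) \<Rightarrow> ('w \<Rightarrow> 'b) \<Rightarrow> ('w \<Rightarrow>\<^sub>0 complex) \<Rightarrow> 'b"
  where "linear_ext sc h p = (\<Sum>w\<in>Poly_Mapping.keys p. sc (Poly_Mapping.lookup p w) (h w))"

context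
  fixes sc :: "complex \<Rightarrow> 'b \<Rightarrow> 'b::ab_group_add" and h :: "'w \<Rightarrow> 'b"
  assumes sc: "\<And>c d x. sc (c + d) x = sc c x + sc d x"
begin

lemma sc_zero: "sc 0 x = 0"
  using sc[of 0 0 x] by simp

lemma linear_ext_superset:
  "finite A \<Longrightarrow> Poly_Mapping.keys p \<subseteq> A \<Longrightarrow> linear_ext sc h p = (\<Sum>w\<in>A. sc (Poly_Mapping.lookup p w) (h w))"
  unfolding linear_ext_def by (intro sum.mono_neutral_left) (auto simp: in_keys_iff sc_zero)

lemma linear_ext_zero: "linear_ext sc h 0 = 0"
  by (simp add: linear_ext_def)

lemma linear_ext_add: "linear_ext sc h (p + q) = linear_ext sc h p + linear_ext sc h q"
  using linear_ext_superset[of "Poly_Mapping.keys p \<union> Poly_Mapping.keys q" p]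
    linear_ext_superset[of "Poly_Mapping.keys p \<union> Poly_Mapping.keys q" q]
    linear_ext_superset[of "Poly_Mapping.keys p \<union> Poly_Mapping.keys q" "p + q"]
    keys_add[of p q]
  by (simp add: lookup_add sc sum.distrib)

lemma linear_ext_diff: "linear_ext sc h (p - q) = linear_ext sc h p - linear_ext sc h q"
  using linear_ext_add[of "p - q" q] by (simp add: algebra_simps)

lemma linear_ext_sum: "linear_ext sc h (\<Sum>i\<in>A. f i) = (\<Sum>i\<in>A. linear_ext sc h (f i))"
  by (induction A rule: infinite_finite_induct) (auto simp: linear_ext_zero linear_ext_add)

lemma linear_ext_single: "linear_ext sc h (Poly_Mapping.single w c) = sc c (h w)"
  by (simp add: linear_ext_def sc_zero)

end

lemma fstar_single: "fstar (Poly_Mapping.single w c) = Poly_Mapping.single (star_word w) (cnj c)"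
  by (simp add: fstar_def)

lemma fscale_fscale: "fscale c (fscale d p) = fscale (c * d) p"
  by (simp add: fscale_def mult_single flip: mult.assoc)

lemma fscale_one: "fscale 1 p = p"
  by (simp add: fscale_def)

context
  fixes f :: "'g \<Rightarrow> 'a::cstar_algebra"
begin

lemma eval_star_poly_eq_linear_ext: "eval_star_poly f = linear_ext (*\<^sub>C) (eval_word f)"
  by (simp add: fun_eq_iff eval_star_poly_def linear_ext_def)

lemma eval_word_plus: "eval_word f (v + w) = eval_word f v * eval_word f w"
  by (simp add: eval_word_def plus_word_def)

lemma eval_star_poly_diff: "eval_star_poly f (p - q) = eval_star_poly f p - eval_star_poly f q"
  unfolding eval_star_poly_eq_linear_ext by (rule linear_ext_diff) (rule scaleC_add_left)

lemma eval_star_poly_sum: "eval_star_poly f (\<Sum>i\<in>A. p i) = (\<Sum>i\<in>A. eval_star_poly f (p i))"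
  unfolding eval_star_poly_eq_linear_ext by (rule linear_ext_sum) (rule scaleC_add_left)

lemma eval_star_poly_single: "eval_star_poly f (Poly_Mapping.single w c) = c *\<^sub>C eval_word f w"
  unfolding eval_star_poly_eq_linear_ext by (rule linear_ext_single) (rule scaleC_add_left)

lemma sum_mult_scaleC:
  "(\<Sum>i\<in>A. a i *\<^sub>C x i) * (\<Sum>j\<in>B. b j *\<^sub>C y j) = (\<Sum>i\<in>A. \<Sum>j\<in>B. (a i * b j) *\<^sub>C (x i * (y j :: 'a)))"
  by (simp add: sum_product mult_scaleC_left mult_scaleC_right scaleC_scaleC mult.commute)

lemma eval_star_poly_mult: "eval_star_poly f (p * q) = eval_star_poly f p * eval_star_poly f q"
  by (subst times_eq_sum_single)
     (simp add: eval_star_poly_sum eval_star_poly_single eval_word_plus,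
      simp add: eval_star_poly_def sum_mult_scaleC)

lemma eval_star_poly_gen: "eval_star_poly f (gen g) = f g"
  by (simp add: gen_def eval_star_poly_single eval_word_def)

lemma eval_star_poly_one: "eval_star_poly f 1 = 1"
  by (subst single_one[symmetric], subst eval_star_poly_single) (simp add: eval_word_def zero_word_def)

lemma eval_star_poly_fstar_gen: "eval_star_poly f (fstar (gen g)) = star (f g)"
  by (simp add: gen_def fstar_single eval_star_poly_single star_word_def eval_word_def)

end

section \<open>Square-summable vectors of finite support\<close>

text \<open>Operator norms are determined on the dense subspace of vectors of finite support, so the
  C*-seminorm is computed there and all sums stay finite.\<close>

definition finsupp :: "('x \<Rightarrow> complex) \<Rightarrow> bool"
  where "finsupp v \<longleftrightarrow> finite {x. v x \<noteq> 0}"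

definition vnorm :: "('x \<Rightarrow> complex) \<Rightarrow> real"
  where "vnorm v = L2_set (\<lambda>x. cmod (v x)) {x. v x \<noteq> 0}"

text \<open>Indexed by the support of the product, the sum is finite as soon as one of the two
  vectors has finite support.\<close>

definition inner_prod :: "('x \<Rightarrow> complex) \<Rightarrow> ('x \<Rightarrow> complex) \<Rightarrow> complex"
  where "inner_prod v w = (\<Sum>x\<in>{x. v x * cnj (w x) \<noteq> 0}. v x * cnj (w x))"

lemma vnorm_nonneg: "vnorm v \<ge> 0"
  by (simp add: vnorm_def)

lemma vnorm_superset: "finite A \<Longrightarrow> {x. v x \<noteq> 0} \<subseteq> A \<Longrightarrow> vnorm v = L2_set (\<lambda>x. cmod (v x)) A"
  unfolding vnorm_def L2_set_def
  by (intro arg_cong[of _ _ sqrt] sum.mono_neutral_left) auto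

lemma inner_prod_superset: "finite A \<Longrightarrow> {x. v x \<noteq> 0} \<subseteq> A \<Longrightarrow> inner_prod v w = (\<Sum>x\<in>A. v x * cnj (w x))"
  unfolding inner_prod_def by (intro sum.mono_neutral_left) auto

lemma inner_prod_superset_right: "finite A \<Longrightarrow> {x. w x \<noteq> 0} \<subseteq> A \<Longrightarrow> inner_prod v w = (\<Sum>x\<in>A. v x * cnj (w x))"
  unfolding inner_prod_def by (intro sum.mono_neutral_left) auto

lemma finsupp_sum: "finite A \<Longrightarrow> (\<And>i. i \<in> A \<Longrightarrow> finsupp (f i)) \<Longrightarrow> finsupp (\<lambda>x. \<Sum>i\<in>A. c i * f i x)"
  unfolding finsupp_def
  by (rule finite_subset[of _ "\<Union>i\<in>A. {x. f i x \<noteq> 0}"]) (auto elim!: sum.not_neutral_contains_not_neutral)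

lemma finsupp_scale: "finsupp v \<Longrightarrow> finsupp (\<lambda>x. c * v x)"
  unfolding finsupp_def by (rule finite_subset[of _ "{x. v x \<noteq> 0}"]) auto

lemma vnorm_zero: "vnorm (\<lambda>x. 0) = 0"
  by (simp add: vnorm_def)

lemma vnorm_triangle:
  assumes "finsupp v" "finsupp w"
  shows "vnorm (\<lambda>x. v x + w x) \<le> vnorm v + vnorm w"
proof -
  let ?A = "{x. v x \<noteq> 0} \<union> {x. w x \<noteq> 0}"
  have A: "finite ?A" using assms by (simp add: finsupp_def)
  have "vnorm (\<lambda>x. v x + w x) = L2_set (\<lambda>x. cmod (v x + w x)) ?A"
    using A by (intro vnorm_superset) auto
  also have "\<dots> \<le> L2_set (\<lambda>x. cmod (v x) + cmod (w x)) ?A"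
    by (intro L2_set_mono norm_triangle_ineq) auto
  also have "\<dots> \<le> L2_set (\<lambda>x. cmod (v x)) ?A + L2_set (\<lambda>x. cmod (w x)) ?A"
    by (rule L2_set_triangle_ineq)
  also have "\<dots> = vnorm v + vnorm w"
    using A vnorm_superset[of ?A v] vnorm_superset[of ?A w] by simp
  finally show ?thesis .
qed

lemma vnorm_scale: "finsupp v \<Longrightarrow> vnorm (\<lambda>x. c * v x) = cmod c * vnorm v"
  by (subst vnorm_superset[of "{x. v x \<noteq> 0}"])
     (auto simp: finsupp_def vnorm_def norm_mult L2_set_right_distrib)

lemma vnorm_sum_le:
  assumes "finite A" "\<And>i. i \<in> A \<Longrightarrow> finsupp (f i)"
  shows "vnorm (\<lambda>x. \<Sum>i\<in>A. c i * f i x) \<le> (\<Sum>i\<in>A. cmod (c i) * vnorm (f i))"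
  using assms
proof (induction A rule: finite_induct)
  case (insert a A)
  have "vnorm (\<lambda>x. \<Sum>i\<in>insert a A. c i * f i x) = vnorm (\<lambda>x. c a * f a x + (\<Sum>i\<in>A. c i * f i x))"
    using insert.hyps by simp
  also have "\<dots> \<le> vnorm (\<lambda>x. c a * f a x) + vnorm (\<lambda>x. \<Sum>i\<in>A. c i * f i x)"
    using insert by (intro vnorm_triangle finsupp_scale finsupp_sum) auto
  also have "\<dots> \<le> cmod (c a) * vnorm (f a) + (\<Sum>i\<in>A. cmod (c i) * vnorm (f i))"
    using insert by (intro add_mono) (auto simp: vnorm_scale)
  finally show ?case using insert.hyps by simp
qed (simp add: vnorm_zero)

lemma inner_prod_self: "finsupp v \<Longrightarrow> inner_prod v v = complex_of_real ((vnorm v)\<^sup>2)"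
  by (subst inner_prod_superset[of "{x. v x \<noteq> 0}"])
     (auto simp: finsupp_def vnorm_def L2_set_def sum_nonneg complex_norm_square[symmetric] simp flip: of_real_power)

lemma inner_prod_Cauchy_Schwarz:
  assumes "finsupp v" "finsupp w"
  shows "cmod (inner_prod v w) \<le> vnorm v * vnorm w"
proof -
  let ?A = "{x. v x \<noteq> 0} \<union> {x. w x \<noteq> 0}"
  have A: "finite ?A" using assms by (simp add: finsupp_def)
  have "cmod (inner_prod v w) = cmod (\<Sum>x\<in>?A. v x * cnj (w x))"
    using inner_prod_superset[of ?A v w] A by simp
  also have "\<dots> \<le> (\<Sum>x\<in>?A. \<bar>cmod (v x)\<bar> * \<bar>cmod (w x)\<bar>)"
    by (rule order.trans[OF norm_sum]) (simp add: norm_mult)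
  also have "\<dots> \<le> L2_set (\<lambda>x. cmod (v x)) ?A * L2_set (\<lambda>x. cmod (w x)) ?A"
    by (rule L2_set_mult_ineq)
  also have "\<dots> = vnorm v * vnorm w"
    using A vnorm_superset[of ?A v] vnorm_superset[of ?A w] by simp
  finally show ?thesis .
qed

lemma inner_prod_sum_left:
  assumes "finsupp w"
  shows "inner_prod (\<lambda>x. \<Sum>i\<in>A. c i * f i x) w = (\<Sum>i\<in>A. c i * inner_prod (f i) w)"
proof -
  have fin: "finite {x. w x \<noteq> 0}" using assms by (simp add: finsupp_def)
  show ?thesis
    unfolding inner_prod_superset_right[OF fin order.refl]
    by (simp add: sum_distrib_right sum_distrib_left mult.assoc) (rule sum.swap)
qed

lemma inner_prod_sum_right:
  assumes "finsupp v"
  shows "inner_prod v (\<lambda>x. \<Sum>i\<in>A. c i * f i x) = (\<Sum>i\<in>A. cnj (c i) * inner_prod v (f i))"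
proof -
  have fin: "finite {x. v x \<noteq> 0}" using assms by (simp add: finsupp_def)
  show ?thesis
    unfolding inner_prod_superset[OF fin order.refl]
    by (simp add: sum_distrib_left mult_ac) (rule sum.swap)
qed

section \<open>The C*-seminorm of a representation by partial bijections\<close>

text \<open>Each symbol acts by a partial bijection of \<open>'x\<close>, given together with its inverse, and so on the
  vectors of finite support; the empty word acts as the projection to a set \<open>D\<close> of basis vectors.\<close>

locale partial_bijections =
  fixes fwd bwd :: "'g \<Rightarrow> 'x \<Rightarrow> 'x option" and D :: "'x set"
  assumes fwd_bwd: "fwd g x = Some y \<longleftrightarrow> bwd g y = Some x"
    and fwd_mem: "fwd g x = Some y \<Longrightarrow> x \<in> D \<and> y \<in> D"
begin

text \<open>The action on functions is by composition with the inverse: the value of g v at y is v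
  at the preimage of y. Hence an unstarred letter uses \<open>bwd\<close> and a starred one uses
  \<open>fwd\<close>.\<close>

definition pull :: "'g \<times> bool \<Rightarrow> 'x \<Rightarrow> 'x option"
  where "pull l = (case l of (g, b) \<Rightarrow> if b then fwd g else bwd g)"

fun list_op :: "('g \<times> bool) list \<Rightarrow> ('x \<Rightarrow> complex) \<Rightarrow> 'x \<Rightarrow> complex" where
  "list_op [] v y = (if y \<in> D then v y else 0)"
| "list_op (l # ls) v y = (case pull l y of None \<Rightarrow> 0 | Some x \<Rightarrow> list_op ls v x)"

lemma pull_flip: "pull (g, \<not> b) y = Some x \<longleftrightarrow> pull (g, b) x = Some y"
  using fwd_bwd by (auto simp: pull_def)

lemma pull_inj: "pull l y = Some x \<Longrightarrow> pull l y' = Some x \<Longrightarrow> y = y'"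
  using pull_flip[of "fst l" "snd l" x] by (metis option.inject pull_flip prod.collapse)

lemma pull_mem: "pull l y = Some x \<Longrightarrow> x \<in> D \<and> y \<in> D"
  using fwd_mem fwd_bwd by (auto simp: pull_def split: prod.splits if_splits)

definition project :: "('x \<Rightarrow> complex) \<Rightarrow> 'x \<Rightarrow> complex"
  where "project v y = (if y \<in> D then v y else 0)"

definition letter_op :: "'g \<times> bool \<Rightarrow> ('x \<Rightarrow> complex) \<Rightarrow> 'x \<Rightarrow> complex"
  where "letter_op l v y = (case pull l y of None \<Rightarrow> 0 | Some x \<Rightarrow> v x)"

lemma list_op_simps: "list_op [] = project" "list_op (l # ls) v = letter_op l (list_op ls v)"
  by (auto simp: fun_eq_iff project_def letter_op_def)

lemma letter_op_support:
  "{y. letter_op l v y \<noteq> 0} \<subseteq> {y. \<exists>x. pull l y = Some x \<and> v x \<noteq> 0}"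
  by (auto simp: letter_op_def split: option.splits)

lemma inj_on_pull: "inj_on (\<lambda>y. the (pull l y)) {y. \<exists>x. pull l y = Some x \<and> v x \<noteq> 0}"
  using pull_inj by (fastforce intro: inj_onI)

lemma finsupp_letter_op: "finsupp v \<Longrightarrow> finsupp (letter_op l v)"
  unfolding finsupp_def
  by (rule finite_subset[OF letter_op_support], rule finite_imageD[OF _ inj_on_pull],
      rule finite_subset[of _ "{x. v x \<noteq> 0}"]) auto

lemma vnorm_letter_op:
  assumes "finsupp v"
  shows "vnorm (letter_op l v) \<le> vnorm v"
proof -
  let ?A = "{y. letter_op l v y \<noteq> 0}"
  have "(\<Sum>y\<in>?A. (cmod (letter_op l v y))\<^sup>2) = (\<Sum>y\<in>?A. (cmod (v (the (pull l y))))\<^sup>2)"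
    by (intro sum.cong) (auto simp: letter_op_def split: option.splits)
  also have "\<dots> = (\<Sum>x\<in>(\<lambda>y. the (pull l y)) ` ?A. (cmod (v x))\<^sup>2)"
    using inj_on_subset[OF inj_on_pull letter_op_support] by (simp add: sum.reindex)
  also have "\<dots> \<le> (\<Sum>x\<in>{x. v x \<noteq> 0}. (cmod (v x))\<^sup>2)"
    using assms letter_op_support[of l v] by (intro sum_mono2) (fastforce simp: finsupp_def)+
  finally show ?thesis by (simp add: vnorm_def L2_set_def)
qed

text \<open>The adjoint of a partial bijection of basis vectors is its inverse; the two sums are
  matched by reindexing along \<open>pull\<close>.\<close>

lemma inner_prod_letter_op: "inner_prod (letter_op (g, b) v) w = inner_prod v (letter_op (g, \<not> b) w)"
proof -
  let ?A = "{y. letter_op (g, b) v y * cnj (w y) \<noteq> 0}" and ?B = "{x. v x * cnj (letter_op (g, \<not> b) w x) \<noteq> 0}"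
  have A: "\<exists>x. pull (g, b) y = Some x \<and> pull (g, \<not> b) x = Some y \<and> v x \<noteq> 0 \<and> w y \<noteq> 0" if "y \<in> ?A" for y
    using that pull_flip[of g b] by (auto simp: letter_op_def split: option.splits)
  have B: "\<exists>y. pull (g, b) y = Some x \<and> pull (g, \<not> b) x = Some y \<and> v x \<noteq> 0 \<and> w y \<noteq> 0" if "x \<in> ?B" for x
    using that pull_flip[of g b] by (auto simp: letter_op_def split: option.splits)
  show ?thesis unfolding inner_prod_def
  proof (rule sum.reindex_bij_witness[of _ "\<lambda>x. the (pull (g, \<not> b) x)" "\<lambda>y. the (pull (g, b) y)"])
    fix y assume "y \<in> ?A"
    from A[OF this] obtain x where x: "pull (g, b) y = Some x" "pull (g, \<not> b) x = Some y" "v x \<noteq> 0" "w y \<noteq> 0"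
      by blast
    thus "the (pull (g, \<not> b) (the (pull (g, b) y))) = y" "the (pull (g, b) y) \<in> ?B"
      "v (the (pull (g, b) y)) * cnj (letter_op (g, \<not> b) w (the (pull (g, b) y))) = letter_op (g, b) v y * cnj (w y)"
      by (simp_all add: letter_op_def)
  next
    fix x assume "x \<in> ?B"
    from B[OF this] obtain y where y: "pull (g, b) y = Some x" "pull (g, \<not> b) x = Some y" "v x \<noteq> 0" "w y \<noteq> 0"
      by blast
    thus "the (pull (g, b) (the (pull (g, \<not> b) x))) = x" "the (pull (g, \<not> b) x) \<in> ?A"
      by (simp_all add: letter_op_def)
  qed
qed

lemma finsupp_project: "finsupp v \<Longrightarrow> finsupp (project v)"
  unfolding finsupp_def by (rule finite_subset[of _ "{x. v x \<noteq> 0}"]) (auto simp: project_def)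

lemma vnorm_project: "finsupp v \<Longrightarrow> vnorm (project v) \<le> vnorm v"
  by (subst (1 2) vnorm_superset[of "{x. v x \<noteq> 0}"])
     (auto simp: finsupp_def project_def intro!: L2_set_mono)

lemma inner_prod_project: "inner_prod (project v) w = inner_prod v (project w)"
  unfolding inner_prod_def by (rule sum.cong) (auto simp: project_def split: if_splits)

lemma letter_op_project: "letter_op l (project v) = letter_op l v"
  using pull_mem by (auto simp: fun_eq_iff letter_op_def project_def split: option.splits)

lemma project_letter_op: "project (letter_op l v) = letter_op l v"
  using pull_mem by (auto simp: fun_eq_iff letter_op_def project_def split: option.splits)

lemma project_list_op: "project (list_op ls v) = list_op ls v"
  by (cases ls) (auto simp: list_op_simps project_letter_op, simp add: project_def fun_eq_iff)

text \<open>The projection in which the first word ends is absorbed, since every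
  \<open>list_op\<close> takes its values in vectors supported on \<open>D\<close>.\<close>

lemma list_op_append: "list_op (xs @ ys) v = list_op xs (list_op ys v)"
  by (induction xs) (auto simp: list_op_simps project_list_op)

lemma inner_prod_list_op:
  "inner_prod (list_op ls v) w = inner_prod v (list_op (rev (map (\<lambda>(g, b). (g, \<not> b)) ls)) w)"
proof (induction ls arbitrary: v w)
  case (Cons l ls)
  obtain g b where l: "l = (g, b)" by fastforce
  have "inner_prod (list_op (l # ls) v) w = inner_prod (list_op ls v) (letter_op (g, \<not> b) w)"
    by (simp add: list_op_simps l inner_prod_letter_op)
  also have "letter_op (g, \<not> b) w = list_op [(g, \<not> b)] w"
    by (simp add: list_op_simps letter_op_project)
  also have "inner_prod (list_op ls v) (list_op [(g, \<not> b)] w) =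
      inner_prod v (list_op (rev (map (\<lambda>(g, b). (g, \<not> b)) ls)) (list_op [(g, \<not> b)] w))"
    by (rule Cons.IH)
  also have "\<dots> = inner_prod v (list_op (rev (map (\<lambda>(g, b). (g, \<not> b)) (l # ls))) w)"
    by (simp add: l list_op_append del: list_op.simps)
  finally show ?case .
qed (simp add: list_op_simps inner_prod_project)

lemma list_op_sum:
  "list_op ls (\<lambda>x. \<Sum>i\<in>A. c i * f i x) = (\<lambda>y. \<Sum>i\<in>A. c i * list_op ls (f i) y)"
  by (induction ls) (auto simp: fun_eq_iff split: option.splits)

lemma finsupp_list_op: "finsupp v \<Longrightarrow> finsupp (list_op ls v)"
  by (induction ls) (auto simp: list_op_simps finsupp_project finsupp_letter_op)

lemma vnorm_list_op: "finsupp v \<Longrightarrow> vnorm (list_op ls v) \<le> vnorm v"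
proof (induction ls)
  case (Cons l ls)
  thus ?case using vnorm_letter_op[OF finsupp_list_op, of v l ls] by (simp add: list_op_simps)
qed (simp add: list_op_simps vnorm_project)

definition poly_op :: "'g star_poly \<Rightarrow> ('x \<Rightarrow> complex) \<Rightarrow> 'x \<Rightarrow> complex"
  where "poly_op p v = (\<lambda>y. \<Sum>w\<in>Poly_Mapping.keys p. Poly_Mapping.lookup p w * list_op (letters w) v y)"

lemma poly_op_eq_linear_ext: "poly_op p v y = linear_ext (*) (\<lambda>w. list_op (letters w) v y) p"
  by (simp add: poly_op_def linear_ext_def)

lemma poly_op_add: "poly_op (p + q) v = (\<lambda>y. poly_op p v y + poly_op q v y)"
  unfolding fun_eq_iff poly_op_eq_linear_ext by (intro allI linear_ext_add) (rule distrib_right)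

lemma poly_op_diff: "poly_op (p - q) v = (\<lambda>y. poly_op p v y - poly_op q v y)"
  unfolding fun_eq_iff poly_op_eq_linear_ext by (intro allI linear_ext_diff) (rule distrib_right)

lemma poly_op_sum: "poly_op (\<Sum>i\<in>A. f i) v = (\<lambda>y. \<Sum>i\<in>A. poly_op (f i) v y)"
  unfolding fun_eq_iff poly_op_eq_linear_ext by (intro allI linear_ext_sum) (rule distrib_right)

lemma poly_op_single: "poly_op (Poly_Mapping.single w c) v = (\<lambda>y. c * list_op (letters w) v y)"
  unfolding fun_eq_iff poly_op_eq_linear_ext by (intro allI linear_ext_single) (rule distrib_right)

lemma poly_op_mult: "poly_op (p * q) v = poly_op p (poly_op q v)"
proof
  fix y
  have "poly_op (p * q) v y = (\<Sum>u\<in>Poly_Mapping.keys p. \<Sum>w\<in>Poly_Mapping.keys q.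
      Poly_Mapping.lookup p u * Poly_Mapping.lookup q w * list_op (letters u) (list_op (letters w) v) y)"
    by (subst times_eq_sum_single) (simp add: poly_op_sum poly_op_single plus_word_def list_op_append)
  also have "\<dots> = poly_op p (poly_op q v) y"
    by (simp add: poly_op_def list_op_sum sum_distrib_left mult.assoc)
  finally show "poly_op (p * q) v y = poly_op p (poly_op q v) y" .
qed

lemma poly_op_fscale: "poly_op (fscale c p) v = (\<lambda>y. c * poly_op p v y)"
proof -
  have "poly_op p v = project (poly_op p v)"
    using project_list_op by (auto simp: fun_eq_iff project_def poly_op_def intro!: sum.neutral) metis
  thus ?thesis
    unfolding fscale_def poly_op_mult poly_op_single
    by (simp add: zero_word_def list_op_simps(1))
qed

lemma finsupp_poly_op: "finsupp v \<Longrightarrow> finsupp (poly_op p v)"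
  unfolding poly_op_def by (intro finsupp_sum finsupp_list_op) auto

lemma inner_prod_poly_op:
  assumes "finsupp v" "finsupp w"
  shows "inner_prod (poly_op p v) w = inner_prod v (poly_op (fstar p) w)"
proof -
  have "inner_prod (poly_op p v) w =
      (\<Sum>u\<in>Poly_Mapping.keys p. Poly_Mapping.lookup p u * inner_prod v (list_op (letters (star_word u)) w))"
    by (simp add: poly_op_def inner_prod_sum_left[OF assms(2)] inner_prod_list_op star_word_def)
  also have "\<dots> = inner_prod v (\<lambda>y. \<Sum>u\<in>Poly_Mapping.keys p. cnj (Poly_Mapping.lookup p u) * list_op (letters (star_word u)) w y)"
    by (simp add: inner_prod_sum_right[OF assms(1)])
  also have "(\<lambda>y. \<Sum>u\<in>Poly_Mapping.keys p. cnj (Poly_Mapping.lookup p u) * list_op (letters (star_word u)) w y) =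
      poly_op (fstar p) w"
    by (simp add: fstar_def poly_op_sum poly_op_single)
  finally show ?thesis .
qed

section \<open>The operator seminorm and the C*-identity\<close>

definition op_bounds :: "'g star_poly \<Rightarrow> real set"
  where "op_bounds p = {C. C \<ge> 0 \<and> (\<forall>v. finsupp v \<longrightarrow> vnorm (poly_op p v) \<le> C * vnorm v)}"

definition op_norm :: "'g star_poly \<Rightarrow> real"
  where "op_norm p = Inf (op_bounds p)"

lemma op_bounds_nonempty: "op_bounds p \<noteq> {}"
proof -
  have "vnorm (poly_op p v) \<le> (\<Sum>w\<in>Poly_Mapping.keys p. cmod (Poly_Mapping.lookup p w)) * vnorm v"
    if v: "finsupp v" for v
  proof -
    have "vnorm (poly_op p v) \<le>
        (\<Sum>w\<in>Poly_Mapping.keys p. cmod (Poly_Mapping.lookup p w) * vnorm (list_op (letters w) v))"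
      unfolding poly_op_def by (intro vnorm_sum_le finsupp_list_op v) auto
    also have "\<dots> \<le> (\<Sum>w\<in>Poly_Mapping.keys p. cmod (Poly_Mapping.lookup p w) * vnorm v)"
      by (intro sum_mono mult_left_mono vnorm_list_op v) auto
    finally show ?thesis by (simp add: sum_distrib_right)
  qed
  hence "(\<Sum>w\<in>Poly_Mapping.keys p. cmod (Poly_Mapping.lookup p w)) \<in> op_bounds p"
    by (auto simp: op_bounds_def sum_nonneg)
  thus ?thesis by blast
qed

lemma op_norm_nonneg: "op_norm p \<ge> 0"
  unfolding op_norm_def using op_bounds_nonempty by (intro cInf_greatest) (auto simp: op_bounds_def)

lemma op_norm_leI: "C \<ge> 0 \<Longrightarrow> (\<And>v. finsupp v \<Longrightarrow> vnorm (poly_op p v) \<le> C * vnorm v) \<Longrightarrow> op_norm p \<le> C"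
  unfolding op_norm_def by (intro cInf_lower bdd_belowI[of _ 0]) (auto simp: op_bounds_def)

lemma vnorm_poly_op:
  assumes "finsupp v"
  shows "vnorm (poly_op p v) \<le> op_norm p * vnorm v"
proof (cases "vnorm v = 0")
  case True
  obtain C where "C \<in> op_bounds p" using op_bounds_nonempty by blast
  thus ?thesis using assms True by (force simp: op_bounds_def)
next
  case False
  hence pos: "vnorm v > 0" using vnorm_nonneg[of v] by linarith
  have "vnorm (poly_op p v) / vnorm v \<le> op_norm p"
    unfolding op_norm_def using op_bounds_nonempty
    by (intro cInf_greatest) (use assms pos in \<open>auto simp: op_bounds_def divide_le_eq\<close>)
  thus ?thesis using pos by (simp add: divide_le_eq)
qed

lemma op_norm_add: "op_norm (p + q) \<le> op_norm p + op_norm q"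
proof (rule op_norm_leI)
  fix v :: "'x \<Rightarrow> complex" assume v: "finsupp v"
  have "vnorm (poly_op (p + q) v) \<le> vnorm (poly_op p v) + vnorm (poly_op q v)"
    unfolding poly_op_add by (intro vnorm_triangle finsupp_poly_op v)
  thus "vnorm (poly_op (p + q) v) \<le> (op_norm p + op_norm q) * vnorm v"
    using vnorm_poly_op[OF v, of p] vnorm_poly_op[OF v, of q] by (simp add: distrib_right)
qed (simp add: op_norm_nonneg)

lemma op_norm_mult: "op_norm (p * q) \<le> op_norm p * op_norm q"
proof (rule op_norm_leI)
  fix v :: "'x \<Rightarrow> complex" assume v: "finsupp v"
  have "vnorm (poly_op (p * q) v) \<le> op_norm p * vnorm (poly_op q v)"
    unfolding poly_op_mult by (intro vnorm_poly_op finsupp_poly_op v)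
  also have "\<dots> \<le> op_norm p * (op_norm q * vnorm v)"
    by (intro mult_left_mono vnorm_poly_op v op_norm_nonneg)
  finally show "vnorm (poly_op (p * q) v) \<le> op_norm p * op_norm q * vnorm v" by (simp add: mult.assoc)
qed (simp add: op_norm_nonneg)

lemma op_norm_fscale: "op_norm (fscale c p) = cmod c * op_norm p"
proof -
  have le: "op_norm (fscale c p) \<le> cmod c * op_norm p" for c p
  proof (rule op_norm_leI)
    fix v :: "'x \<Rightarrow> complex" assume v: "finsupp v"
    show "vnorm (poly_op (fscale c p) v) \<le> cmod c * op_norm p * vnorm v"
      unfolding poly_op_fscale using mult_left_mono[OF vnorm_poly_op[OF v, of p], of "cmod c"]
      by (simp add: vnorm_scale[OF finsupp_poly_op[OF v]] mult.assoc)
  qed (simp add: op_norm_nonneg)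
  show ?thesis
  proof (cases "c = 0")
    case True
    thus ?thesis using le[of 0 p] op_norm_nonneg[of "fscale 0 p"] by simp
  next
    case False
    have "op_norm p = op_norm (fscale (inverse c) (fscale c p))"
      using False by (simp add: fscale_fscale fscale_one)
    also have "\<dots> \<le> cmod (inverse c) * op_norm (fscale c p)" by (rule le)
    finally have "op_norm p \<le> op_norm (fscale c p) / cmod c"
      by (simp add: norm_inverse divide_inverse mult.commute)
    hence "cmod c * op_norm p \<le> op_norm (fscale c p)"
      using False by (simp add: le_divide_eq mult.commute)
    thus ?thesis using le[of c p] by linarith
  qed
qed

text \<open>For w the image of v under the adjoint, the square of the norm of w is the inner product
  of p w with v. By Cauchy-Schwarz it is at most the product of the seminorm of p and the norms of w
  and v, and one factor is cancelled.\<close>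

lemma op_norm_fstar_le: "op_norm (fstar p) \<le> op_norm p"
proof (rule op_norm_leI)
  fix v :: "'x \<Rightarrow> complex" assume v: "finsupp v"
  define w where "w = poly_op (fstar p) v"
  have w: "finsupp w" unfolding w_def by (rule finsupp_poly_op[OF v])
  have "(vnorm w)\<^sup>2 = cmod (inner_prod w w)" by (simp add: inner_prod_self[OF w] norm_power vnorm_nonneg)
  also have "inner_prod w w = inner_prod (poly_op p w) v"
    using inner_prod_poly_op[OF w v, of p] by (simp add: w_def)
  also have "cmod \<dots> \<le> vnorm (poly_op p w) * vnorm v"
    by (rule inner_prod_Cauchy_Schwarz[OF finsupp_poly_op[OF w] v])
  also have "\<dots> \<le> op_norm p * vnorm w * vnorm v"
    by (intro mult_right_mono vnorm_poly_op w vnorm_nonneg)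
  finally have "vnorm w * vnorm w \<le> (op_norm p * vnorm v) * vnorm w"
    by (simp add: power2_eq_square mult_ac)
  thus "vnorm w \<le> op_norm p * vnorm v"
    using vnorm_nonneg[of w] op_norm_nonneg[of p] vnorm_nonneg[of v]
    by (cases "vnorm w = 0") (auto simp: mult_le_cancel_right)
qed (rule op_norm_nonneg)

text \<open>One inequality is submultiplicativity together with the bound on the adjoint. For the
  other, the square of the norm of p v is the inner product of v with the image of v under
  \<open>fstar p * p\<close>, and Cauchy-Schwarz applies.\<close>

lemma op_norm_cstar_identity: "op_norm (fstar p * p) = (op_norm p)\<^sup>2"
proof (rule antisym)
  have "op_norm (fstar p * p) \<le> op_norm (fstar p) * op_norm p" by (rule op_norm_mult)
  also have "\<dots> \<le> op_norm p * op_norm p" by (intro mult_right_mono op_norm_fstar_le op_norm_nonneg)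
  finally show "op_norm (fstar p * p) \<le> (op_norm p)\<^sup>2" by (simp add: power2_eq_square)
next
  have "op_norm p \<le> sqrt (op_norm (fstar p * p))"
  proof (rule op_norm_leI)
    fix v :: "'x \<Rightarrow> complex" assume v: "finsupp v"
    define w where "w = poly_op p v"
    have w: "finsupp w" unfolding w_def by (rule finsupp_poly_op[OF v])
    have "(vnorm w)\<^sup>2 = cmod (inner_prod w w)" by (simp add: inner_prod_self[OF w] norm_power vnorm_nonneg)
    also have "inner_prod w w = inner_prod v (poly_op (fstar p * p) v)"
      using inner_prod_poly_op[OF v w, of p] by (simp add: w_def poly_op_mult)
    also have "cmod \<dots> \<le> vnorm v * vnorm (poly_op (fstar p * p) v)"
      by (rule inner_prod_Cauchy_Schwarz[OF v finsupp_poly_op[OF v]])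
    also have "\<dots> \<le> vnorm v * (op_norm (fstar p * p) * vnorm v)"
      by (intro mult_left_mono vnorm_poly_op v vnorm_nonneg)
    also have "\<dots> = (sqrt (op_norm (fstar p * p)) * vnorm v)\<^sup>2"
      by (simp add: power_mult_distrib op_norm_nonneg) (simp add: power2_eq_square)
    finally show "vnorm w \<le> sqrt (op_norm (fstar p * p)) * vnorm v"
      by (rule power2_le_imp_le) (simp add: op_norm_nonneg vnorm_nonneg)
  qed (simp add: op_norm_nonneg)
  hence "(op_norm p)\<^sup>2 \<le> (sqrt (op_norm (fstar p * p)))\<^sup>2" by (intro power_mono op_norm_nonneg)
  thus "(op_norm p)\<^sup>2 \<le> op_norm (fstar p * p)" by (simp add: op_norm_nonneg)
qed

lemma cstar_seminorm_on_op_norm: "cstar_seminorm_on F op_norm"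
  by (auto simp: cstar_seminorm_on_def op_norm_nonneg op_norm_cstar_identity op_norm_add op_norm_mult op_norm_fscale)

lemma op_norm_eq_zero: "(\<And>v. poly_op p v = (\<lambda>_. 0)) \<Longrightarrow> op_norm p = 0"
  using op_norm_leI[of 0 p] op_norm_nonneg[of p] by (simp add: vnorm_zero)

lemma poly_op_gen: "poly_op (gen g) v = letter_op (g, False) v"
  by (simp add: gen_def poly_op_single list_op_simps letter_op_project)

lemma poly_op_fstar_gen: "poly_op (fstar (gen g)) v = letter_op (g, True) v"
  by (simp add: gen_def fstar_single star_word_def poly_op_single list_op_simps letter_op_project)

lemma poly_op_one: "poly_op 1 v = project v"
  by (subst single_one[symmetric], subst poly_op_single) (simp add: zero_word_def list_op_simps(1))

end

section \<open>Coset projections\<close>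

lemma points_iff: "(I, X) \<in> points \<longleftrightarrow>
    I \<in> nonzero_ideals \<and> (\<exists>x. algebraic_int x \<and> X = (+) x ` (I :: 'k::number_field set))"
  by (auto simp: points_def carrier_Quot)

lemma points_obtain:
  assumes "(I, X) \<in> points"
  obtains x where "I \<in> nonzero_ideals" "algebraic_int x" "X = (+) x ` (I :: 'k::number_field set)"
  using assms by (auto simp: points_iff)

lemma points_coset_eq:
  assumes "(I, X) \<in> points" "x \<in> X"
  shows "algebraic_int x" "X = (+) x ` (I :: 'k::number_field set)"
proof -
  obtain y where y: "I \<in> nonzero_ideals" "algebraic_int y" "X = (+) y ` I" using points_obtain[OF assms(1)] .
  note I = nonzero_ideals_ideal[OF y(1)]
  show "X = (+) x ` I" using translate_eqI[OF I] assms(2) y(3) by blast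
  show "algebraic_int x" using assms(2) y ideal_algebraic_int[OF I] by (auto intro!: algebraic_int_add)
qed

lemma points_coset_nonempty: "(I, X) \<in> points \<Longrightarrow> X \<noteq> {}"
  using ideal_zero[OF nonzero_ideals_ideal] by (auto simp: points_iff)

lemma points_coset_subset: "(I, X) \<in> points \<Longrightarrow> X \<subseteq> carrier \<O>"
  using points_coset_eq(1) by auto

text \<open>Both ideals have the same translate by any element of the coset. This allows characters
  to be attached to the set \<open>X\<close> alone, without recording its ideal.\<close>

lemma points_determined:
  assumes "(I, X) \<in> points" "(J, X) \<in> (points :: ('k::number_field set \<times> 'k set) set)"
  shows "I = J"
proof -
  obtain x where "x \<in> X" using points_coset_nonempty[OF assms(1)] by blast
  hence "(+) x ` I = (+) x ` J" using points_coset_eq(2) assms by blast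
  thus ?thesis by (simp add: inj_image_eq_iff)
qed

lemma points_Int:
  assumes X: "(I, X) \<in> points" and Y: "(J, Y) \<in> (points :: ('k::number_field set \<times> 'k set) set)" and "X \<inter> Y \<noteq> {}"
  shows "(I \<inter> J, X \<inter> Y) \<in> points"
proof -
  obtain z where z: "z \<in> X" "z \<in> Y" using assms(3) by blast
  have "X \<inter> Y = (+) z ` (I \<inter> J)"
    using points_coset_eq(2)[OF X z(1)] points_coset_eq(2)[OF Y z(2)] by (simp add: image_Int)
  thus ?thesis using X Y points_coset_eq(1)[OF X z(1)] by (auto simp: points_iff nonzero_ideals_Int)
qed

lemma points_carrier: "(carrier \<O>, carrier \<O>) \<in> (points :: ('k::number_field set \<times> 'k set) set)"
  by (auto simp: points_iff nonzero_ideals_carrier intro!: exI[of _ 0])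

text \<open>What is kept of the universal algebra from here on. The first assumptions are relations
  between the generators \<open>u\<close> and \<open>e\<close> that occur in coset projections. The
  last one is the trace of the representation: \<open>Y\<close> is a joint eigenvector with
  eigenvalues \<open>of_bool (Y \<subseteq> X)\<close>, so these eigenvalues are dominated by the
  norm.\<close>

locale toeplitz_relations =
  fixes u :: "'k::number_field \<Rightarrow> 'a::cstar_algebra" and e :: "'k set \<Rightarrow> 'a"
  assumes u_isometry: "algebraic_int x \<Longrightarrow> star (u x) * u x = 1"
    and u_add: "algebraic_int x \<Longrightarrow> algebraic_int y \<Longrightarrow> u x * u y = u (x + y)"
    and e_star: "I \<in> nonzero_ideals \<Longrightarrow> star (e I) = e I"
    and e_Int: "I \<in> nonzero_ideals \<Longrightarrow> J \<in> nonzero_ideals \<Longrightarrow> e (I \<inter> J) = e I * e J"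
    and e_carrier: "e (carrier \<O>) = 1"
    and u_e_commute: "I \<in> nonzero_ideals \<Longrightarrow> x \<in> I \<Longrightarrow> u x * e I = e I * u x"
    and e_u_e: "I \<in> nonzero_ideals \<Longrightarrow> algebraic_int x \<Longrightarrow> x \<notin> I \<Longrightarrow> e I * u x * e I = 0"
    and norm_lower: "finite F \<Longrightarrow> F \<subseteq> points \<Longrightarrow> Y \<subseteq> carrier \<O> \<Longrightarrow> Y \<noteq> {} \<Longrightarrow>
      cmod (\<Sum>(I, X)\<in>F. c (I, X) * of_bool (Y \<subseteq> X)) \<le> norm (\<Sum>(I, X)\<in>F. c (I, X) *\<^sub>C ecos u e I X)"

section \<open>The representation on the subsets of the ring of integers\<close>

text \<open>The basis vectors that are cosets of ideals span the regular representation on the Hilbert space with basis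
  \<open>\<Squnion>I. R / I\<close>. Allowing all non-empty subsets of \<open>R\<close> avoids recording the ideal of a coset.\<close>

definition basis_sets :: "'k::number_field set set"
  where "basis_sets = {Y. Y \<subseteq> carrier \<O> \<and> Y \<noteq> {}}"

definition translate :: "'a::plus \<Rightarrow> 'a set \<Rightarrow> 'a set"
  where "translate x Y = (+) x ` Y"

definition dilate :: "'a::times \<Rightarrow> 'a set \<Rightarrow> 'a set"
  where "dilate a Y = (*) a ` Y"

lemma translate_translate: "translate x (translate y Y) = translate (x + y) (Y :: 'a::ab_group_add set)"
  by (simp add: translate_def image_image add.assoc)

lemma translate_zero: "translate 0 Y = (Y :: 'a::ab_group_add set)"
  by (simp add: translate_def)

lemma dilate_dilate: "dilate x (dilate y Y) = dilate (x * y) (Y :: 'a::comm_ring_1 set)"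
  by (simp add: dilate_def image_image mult.assoc)

lemma dilate_one: "dilate 1 Y = (Y :: 'a::comm_ring_1 set)"
  by (simp add: dilate_def)

lemma dilate_translate: "dilate a (translate x Y) = translate (a * x) (dilate a (Y :: 'a::comm_ring_1 set))"
  by (simp add: dilate_def translate_def image_image distrib_left)

lemma translate_subset_iff: "translate x Y \<subseteq> Z \<longleftrightarrow> Y \<subseteq> translate (- x) (Z :: 'a::ab_group_add set)"
proof
  assume "translate x Y \<subseteq> Z"
  hence "translate (- x) (translate x Y) \<subseteq> translate (- x) Z" unfolding translate_def by (rule image_mono)
  thus "Y \<subseteq> translate (- x) Z" by (simp add: translate_translate translate_zero)
next
  assume "Y \<subseteq> translate (- x) Z"
  hence "translate x Y \<subseteq> translate x (translate (- x) Z)" unfolding translate_def by (rule image_mono)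
  thus "translate x Y \<subseteq> Z" by (simp add: translate_translate translate_zero)
qed

lemma dilate_inverse_subset_iff:
  assumes "a \<noteq> 0"
  shows "dilate (inverse a) Y \<subseteq> Z \<longleftrightarrow> Y \<subseteq> dilate a (Z :: 'a::field set)"
proof
  assume "dilate (inverse a) Y \<subseteq> Z"
  hence "dilate a (dilate (inverse a) Y) \<subseteq> dilate a Z" unfolding dilate_def by (rule image_mono)
  thus "Y \<subseteq> dilate a Z" using assms by (simp add: dilate_dilate dilate_one)
next
  assume "Y \<subseteq> dilate a Z"
  hence "dilate (inverse a) Y \<subseteq> dilate (inverse a) (dilate a Z)" unfolding dilate_def by (rule image_mono)
  thus "dilate (inverse a) Y \<subseteq> Z" using assms by (simp add: dilate_dilate dilate_one)
qed

text \<open>The result \<open>None\<close> means that the basis vector is sent to 0. The symbol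
  \<open>S a\<close> acts by an isometry whose range consists of the sets divisible by
  \<open>a\<close> in R; accordingly its inverse asks that the quotient be a basis set.\<close>

fun gen_map :: "'k::number_field toeplitz_gen \<Rightarrow> 'k set \<Rightarrow> 'k set option" where
  "gen_map (U x) Y = (if algebraic_int x \<and> Y \<in> basis_sets then Some (translate x Y) else None)"
| "gen_map (S a) Y = (if algebraic_int a \<and> a \<noteq> 0 \<and> Y \<in> basis_sets then Some (dilate a Y) else None)"
| "gen_map (E I) Y = (if Y \<in> basis_sets \<and> Y \<subseteq> I then Some Y else None)"

fun gen_map_inv :: "'k::number_field toeplitz_gen \<Rightarrow> 'k set \<Rightarrow> 'k set option" where
  "gen_map_inv (U x) Y = (if algebraic_int x \<and> Y \<in> basis_sets then Some (translate (- x) Y) else None)"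
| "gen_map_inv (S a) Y = (if algebraic_int a \<and> a \<noteq> 0 \<and> dilate (inverse a) Y \<in> basis_sets
    then Some (dilate (inverse a) Y) else None)"
| "gen_map_inv (E I) Y = (if Y \<in> basis_sets \<and> Y \<subseteq> I then Some Y else None)"

lemma basis_sets_translate_aux: "algebraic_int x \<Longrightarrow> Y \<in> basis_sets \<Longrightarrow> translate x Y \<in> basis_sets"
  by (auto simp: basis_sets_def translate_def intro!: algebraic_int_add)

lemma basis_sets_translate: "algebraic_int x \<Longrightarrow> translate x Y \<in> basis_sets \<longleftrightarrow> Y \<in> basis_sets"
  using basis_sets_translate_aux[of x Y] basis_sets_translate_aux[of "- x" "translate x Y"]
  by (auto simp: translate_translate translate_zero)

lemma basis_sets_dilate: "algebraic_int a \<Longrightarrow> Y \<in> basis_sets \<Longrightarrow> dilate a Y \<in> basis_sets"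
  by (auto simp: basis_sets_def dilate_def intro!: algebraic_int_mult)

lemma basis_sets_dilate_inverse:
  assumes "algebraic_int a" "a \<noteq> 0" "dilate (inverse a) Y \<in> basis_sets"
  shows "Y \<in> basis_sets"
  using basis_sets_dilate[OF assms(1,3)] assms(2) by (simp add: dilate_dilate dilate_one)

interpretation rep: partial_bijections gen_map gen_map_inv "basis_sets :: 'k::number_field set set"
proof
  fix g and X Y :: "'k set"
  show "gen_map g X = Some Y \<longleftrightarrow> gen_map_inv g Y = Some X"
    by (cases g)
       (auto simp: basis_sets_translate basis_sets_dilate translate_translate translate_zero dilate_dilate dilate_one)
  show "gen_map g X = Some Y \<Longrightarrow> X \<in> basis_sets \<and> Y \<in> basis_sets"
    by (cases g) (auto simp: basis_sets_translate basis_sets_dilate split: if_splits)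
qed

lemma letter_op_U: "algebraic_int x \<Longrightarrow> rep.letter_op (U x, False) v Y = (if Y \<in> basis_sets then v (translate (- x) Y) else 0)"
  and letter_op_U_star: "algebraic_int x \<Longrightarrow> rep.letter_op (U x, True) v Y = (if Y \<in> basis_sets then v (translate x Y) else 0)"
  and letter_op_S: "algebraic_int a \<Longrightarrow> a \<noteq> 0 \<Longrightarrow> rep.letter_op (S a, False) v Y =
    (if dilate (inverse a) Y \<in> basis_sets then v (dilate (inverse a) Y) else 0)"
  and letter_op_S_star: "algebraic_int a \<Longrightarrow> a \<noteq> 0 \<Longrightarrow> rep.letter_op (S a, True) v Y =
    (if Y \<in> basis_sets then v (dilate a Y) else 0)"
  and letter_op_E: "rep.letter_op (E I, b) v Y = (if Y \<in> basis_sets \<and> Y \<subseteq> I then v Y else 0)"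
  by (auto simp: rep.letter_op_def rep.pull_def)

lemmas rep_simps = rep.poly_op_diff rep.poly_op_mult rep.poly_op_gen rep.poly_op_fstar_gen rep.poly_op_one rep.project_def
  letter_op_U letter_op_U_star letter_op_S letter_op_S_star letter_op_E
  translate_translate translate_zero dilate_dilate dilate_one dilate_translate basis_sets_translate basis_sets_dilate

lemma rep_relators_Ta:
  fixes v :: "'k::number_field set \<Rightarrow> complex"
  assumes "r \<in> relators_Ta"
  shows "rep.poly_op r v = (\<lambda>_. 0)"
proof
  fix Y :: "'k set"
  from assms consider
      (U_unitary) x where "r = gen (U x) * fstar (gen (U x)) - 1 \<or> r = fstar (gen (U x)) * gen (U x) - 1" "algebraic_int x"
    | (U_add) x y where "r = gen (U x) * gen (U y) - gen (U (x + y))" "algebraic_int x" "algebraic_int y"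
    | (S_isometry) a where "r = fstar (gen (S a)) * gen (S a) - 1" "algebraic_int a" "a \<noteq> 0"
    | (S_mult) a b where "r = gen (S a) * gen (S b) - gen (S (a * b))" "algebraic_int a" "a \<noteq> 0" "algebraic_int b" "b \<noteq> 0"
    | (S_U) a x where "r = gen (S a) * gen (U x) - gen (U (a * x)) * gen (S a)" "algebraic_int a" "a \<noteq> 0" "algebraic_int x"
    by (auto simp: relators_Ta_def)
  thus "rep.poly_op r v Y = 0"
  proof cases
    case U_unitary
    thus ?thesis by (auto simp: rep_simps)
  next
    case U_add
    thus ?thesis by (simp add: rep_simps algebraic_int_add add.commute)
  next
    case S_isometry
    thus ?thesis by (simp add: rep_simps)
  next
    case S_mult
    \<comment> \<open>If Y divided by a b consists of algebraic integers, then so does Y divided by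
      a. Hence dividing in two steps has the same domain as dividing by the product.\<close>
    thus ?thesis
      using basis_sets_dilate_inverse[OF S_mult(4,5), of "dilate (inverse a) Y"]
      by (auto simp: rep_simps algebraic_int_mult mult.commute)
  next
    case S_U
    thus ?thesis
      using basis_sets_dilate_inverse[OF S_U(2,3), of Y]
      by (auto simp: rep_simps algebraic_int_mult simp flip: mult.assoc)
  qed
qed

lemma rep_relators_Tb:
  fixes v :: "'k::number_field set \<Rightarrow> complex"
  assumes "r \<in> relators_Tb"
  shows "rep.poly_op r v = (\<lambda>_. 0)"
proof
  fix Y :: "'k set"
  have "Y \<in> basis_sets \<Longrightarrow> Y \<subseteq> carrier \<O>" by (simp add: basis_sets_def)
  with assms show "rep.poly_op r v Y = 0"
    unfolding relators_Tb_def
    by (elim UnE CollectE exE conjE) (auto simp: rep_simps)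
qed

text \<open>A basis set \<open>Y\<close> survives the left-hand operator if its quotient by a is a
  basis set inside \<open>I\<close>, and this means Y \<subseteq> a I. As \<open>I\<close> lies in
  R, the integrality of the quotient follows from its containment in \<open>I\<close>.\<close>

lemma rep_relators_Tc:
  fixes v :: "'k::number_field set \<Rightarrow> complex"
  assumes "r \<in> relators_Tc"
  shows "rep.poly_op r v = (\<lambda>_. 0)"
proof
  fix Y :: "'k set"
  from assms obtain a I where r: "r = gen (S a) * gen (E I) * fstar (gen (S a)) - gen (E (dilate a I))"
    and a: "algebraic_int a" "a \<noteq> 0" and I: "I \<in> nonzero_ideals"
    unfolding relators_Tc_def dilate_def by auto
  have IO: "I \<subseteq> carrier \<O>" using ideal_algebraic_int[OF nonzero_ideals_ideal[OF I]] by auto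
  have "dilate (inverse a) Y \<in> basis_sets" if "Y \<in> basis_sets" "dilate (inverse a) Y \<subseteq> I"
  proof -
    have "dilate (inverse a) Y \<noteq> {}" using that(1) by (simp add: basis_sets_def dilate_def)
    thus ?thesis using that(2) IO unfolding basis_sets_def by blast
  qed
  hence "dilate (inverse a) Y \<in> basis_sets \<and> dilate (inverse a) Y \<subseteq> I \<longleftrightarrow> Y \<in> basis_sets \<and> Y \<subseteq> dilate a I"
    using basis_sets_dilate_inverse[OF a] dilate_inverse_subset_iff[OF a(2), of Y I] by blast
  thus "rep.poly_op r v Y = 0"
    using a by (auto simp: r rep_simps)
qed

lemma rep_relators_Td:
  fixes v :: "'k::number_field set \<Rightarrow> complex"
  assumes "r \<in> relators_Td"
  shows "rep.poly_op r v = (\<lambda>_. 0)"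
proof
  fix Y :: "'k set"
  from assms consider
      (commute) x I where "r = gen (U x) * gen (E I) - gen (E I) * gen (U x)" "I \<in> nonzero_ideals" "x \<in> I"
    | (zero) x I where "r = gen (E I) * gen (U x) * gen (E I)" "I \<in> nonzero_ideals" "algebraic_int x" "x \<notin> I"
    by (auto simp: relators_Td_def)
  thus "rep.poly_op r v Y = 0"
  proof cases
    case commute
    note I = nonzero_ideals_ideal[OF commute(2)]
    have "translate x I = I"
      using translate_eq_iff[OF I, of x 0] commute(3) by (simp add: translate_def)
    moreover have "algebraic_int x" using ideal_algebraic_int[OF I commute(3)] .
    ultimately show ?thesis by (simp add: commute(1) rep_simps translate_subset_iff)
  next
    case zero
    note I = nonzero_ideals_ideal[OF zero(2)]
    \<comment> \<open>Non-emptiness of basis sets matters here: a common element of I and x + I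
      would put x into I.\<close>
    have "False" if Y: "Y \<in> basis_sets" "Y \<subseteq> I" "Y \<subseteq> translate x I"
    proof -
      obtain y where y: "y \<in> I" "y \<in> translate x I" using Y by (auto simp: basis_sets_def)
      then obtain i where "i \<in> I" "y = x + i" by (auto simp: translate_def)
      thus False using ideal_diff[OF I y(1), of i] zero(4) by simp
    qed
    thus ?thesis using zero(3) by (auto simp: zero(1) rep_simps translate_subset_iff)
  qed
qed

lemma rep_coset_projection:
  assumes "(I, X) \<in> points" "x \<in> X"
  shows "rep.list_op [(U x, False), (E I, False), (U (- x), False)] v Y = (if Y \<in> basis_sets \<and> Y \<subseteq> X then v Y else 0)"
proof -
  have "algebraic_int x" "X = translate x I" using points_coset_eq[OF assms] by (simp_all add: translate_def)
  thus ?thesis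
    by (simp add: rep.list_op_simps rep.letter_op_project rep_simps translate_subset_iff)
qed

lemma toeplitz_relations:
  fixes u s :: "'k::number_field \<Rightarrow> 'a::cstar_algebra" and e :: "'k set \<Rightarrow> 'a"
  assumes "is_toeplitz_algebra u s e"
  shows "toeplitz_relations u e"
proof
  define f where "f = case_toeplitz_gen u s e"
  define Rel where "Rel = (relators_Ta \<union> relators_Tb \<union> relators_Tc \<union> relators_Td :: 'k toeplitz_gen star_poly set)"
  have f_simps: "f (U x) = u x" "f (E I) = e I" for x I by (simp_all add: f_def)
  have univ: "universal_cstar_algebra toeplitz_gens Rel f"
    using assms by (simp add: is_toeplitz_algebra_def f_def Rel_def)
  hence rel: "eval_star_poly f r = 0" if "r \<in> Rel" for r
    using that by (simp add: universal_cstar_algebra_def)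
  note eval = eval_star_poly_diff eval_star_poly_mult eval_star_poly_gen eval_star_poly_fstar_gen eval_star_poly_one f_simps
  fix x y :: 'k and I J :: "'k set"
  show "star (u x) * u x = 1" if "algebraic_int x"
  proof -
    have "fstar (gen (U x)) * gen (U x) - 1 \<in> Rel" using that by (auto simp: Rel_def relators_Ta_def)
    from rel[OF this] show ?thesis by (simp add: eval)
  qed
  show "u x * u y = u (x + y)" if "algebraic_int x" "algebraic_int y"
  proof -
    have "gen (U x) * gen (U y) - gen (U (x + y)) \<in> {gen (U x) * gen (U y) - gen (U (x + y)) | x y. x \<in> carrier \<O> \<and> y \<in> carrier \<O>}"
      using that by (intro CollectI exI[of _ x] exI[of _ y]) auto
    hence "gen (U x) * gen (U y) - gen (U (x + y)) \<in> Rel"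
      by (simp only: Rel_def relators_Ta_def Un_iff simp_thms)
    from rel[OF this] show ?thesis by (simp add: eval)
  qed
  show "star (e I) = e I" if "I \<in> nonzero_ideals"
  proof -
    have "fstar (gen (E I)) - gen (E I) \<in> Rel" using that by (auto simp: Rel_def relators_Tb_def)
    from rel[OF this] show ?thesis by (simp add: eval)
  qed
  show "e (I \<inter> J) = e I * e J" if "I \<in> nonzero_ideals" "J \<in> nonzero_ideals"
  proof -
    have "gen (E (I \<inter> J)) - gen (E I) * gen (E J) \<in> {gen (E (I \<inter> J)) - gen (E I) * gen (E J) | I J. I \<in> nonzero_ideals \<and> J \<in> nonzero_ideals}"
      using that by (intro CollectI exI[of _ I] exI[of _ J]) auto
    hence "gen (E (I \<inter> J)) - gen (E I) * gen (E J) \<in> Rel"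
      by (simp only: Rel_def relators_Tb_def Un_iff simp_thms)
    from rel[OF this] show ?thesis by (simp add: eval)
  qed
  show "e (carrier \<O>) = 1"
  proof -
    have "gen (E (carrier \<O>)) - 1 \<in> Rel" by (auto simp: Rel_def relators_Tb_def)
    from rel[OF this] show ?thesis by (simp add: eval)
  qed
  show "u x * e I = e I * u x" if "I \<in> nonzero_ideals" "x \<in> I"
  proof -
    have "gen (U x) * gen (E I) - gen (E I) * gen (U x) \<in> {gen (U x) * gen (E I) - gen (E I) * gen (U x) | x I. I \<in> nonzero_ideals \<and> x \<in> I}"
      using that by (intro CollectI exI[of _ x] exI[of _ I]) auto
    hence "gen (U x) * gen (E I) - gen (E I) * gen (U x) \<in> Rel"
      by (simp only: Rel_def relators_Td_def Un_iff simp_thms)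
    from rel[OF this] show ?thesis by (simp add: eval)
  qed
  show "e I * u x * e I = 0" if "I \<in> nonzero_ideals" "algebraic_int x" "x \<notin> I"
  proof -
    have "gen (E I) * gen (U x) * gen (E I) \<in> {gen (E I) * gen (U x) * gen (E I) | x I. I \<in> nonzero_ideals \<and> x \<in> carrier \<O> - I}"
      using that by (intro CollectI exI[of _ x] exI[of _ I]) auto
    hence "gen (E I) * gen (U x) * gen (E I) \<in> Rel"
      by (simp only: Rel_def relators_Td_def Un_iff simp_thms)
    from rel[OF this] show ?thesis by (simp add: eval)
  qed
next
  fix F :: "('k set \<times> 'k set) set" and Y :: "'k set" and c :: "'k set \<times> 'k set \<Rightarrow> complex"
  assume F: "finite F" "F \<subseteq> points" and Y: "Y \<subseteq> carrier \<O>" "Y \<noteq> {}"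
  define f where "f = case_toeplitz_gen u s e"
  define Rel where "Rel = (relators_Ta \<union> relators_Tb \<union> relators_Tc \<union> relators_Td :: 'k toeplitz_gen star_poly set)"
  have univ: "universal_cstar_algebra toeplitz_gens Rel f"
    using assms by (simp add: is_toeplitz_algebra_def f_def Rel_def)
  \<comment> \<open>The same choice of representative as in \<open>conj_coset\<close>, so that the
    words \<open>w\<close> evaluate literally to the coset projections.\<close>
  define x where "x = (\<lambda>X :: 'k set. SOME y. y \<in> X)"
  have x: "x X \<in> X" if "(I, X) \<in> points" for I X
    unfolding x_def using points_coset_nonempty[OF that] by (simp add: some_in_eq)
  define w where "w = (\<lambda>(I, X). Word [(U (x X), False), (E I, False), (U (- x X), False)])"
  define p where "p = (\<Sum>i\<in>F. Poly_Mapping.single (w i) (c i))"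
  have mem: "p \<in> free_star_algebra toeplitz_gens"
    unfolding p_def using F
  proof (induction F rule: finite_induct)
    case (insert i F)
    obtain I X where i: "i = (I, X)" by fastforce
    have IX: "(I, X) \<in> points" using insert.prems i by simp
    have "I \<in> nonzero_ideals" "algebraic_int (x X)"
      using IX points_coset_eq(1)[OF IX x[OF IX]] by (auto simp: points_iff)
    hence "fst ` set (letters (w i)) \<subseteq> toeplitz_gens" by (auto simp: w_def i toeplitz_gens_def)
    moreover have "Poly_Mapping.keys (Poly_Mapping.single (w i) (c i) + (\<Sum>i\<in>F. Poly_Mapping.single (w i) (c i))) \<subseteq>
        {w i} \<union> Poly_Mapping.keys (\<Sum>i\<in>F. Poly_Mapping.single (w i) (c i))"
      by (rule order.trans[OF keys_add]) (auto split: if_splits)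
    moreover have "\<forall>w'\<in>Poly_Mapping.keys (\<Sum>i\<in>F. Poly_Mapping.single (w i) (c i)). fst ` set (letters w') \<subseteq> toeplitz_gens"
      using insert.IH insert.prems by (simp add: free_star_algebra_def)
    ultimately show ?case
      unfolding free_star_algebra_def mem_Collect_eq sum.insert[OF insert.hyps] by blast
  qed (simp add: free_star_algebra_def)
  \<comment> \<open>Universality, applied to the seminorm of the representation, which vanishes on
    all relators.\<close>
  have "rep.op_norm p \<le> norm (eval_star_poly f p)"
  proof -
    have "\<forall>r\<in>Rel. rep.op_norm r = 0"
      using rep_relators_Ta rep_relators_Tb rep_relators_Tc rep_relators_Td
      by (auto simp: Rel_def intro!: rep.op_norm_eq_zero)
    thus ?thesis using univ rep.cstar_seminorm_on_op_norm mem unfolding universal_cstar_algebra_def by blast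
  qed
  also have "eval_star_poly f p = (\<Sum>(I, X)\<in>F. c (I, X) *\<^sub>C ecos u e I X)"
    unfolding p_def eval_star_poly_sum eval_star_poly_single
    by (intro sum.cong) (auto simp: w_def x_def eval_word_def f_def ecos_def conj_coset_def Let_def mult.assoc)
  finally have upper: "rep.op_norm p \<le> norm (\<Sum>(I, X)\<in>F. c (I, X) *\<^sub>C ecos u e I X)" .
  \<comment> \<open>The unit basis vector at \<open>Y\<close>. It is an eigenvector of
    \<open>p\<close> with eigenvalue \<open>z\<close>, whose modulus is therefore at most the
    operator seminorm.\<close>
  define v where "v = (\<lambda>Z. if Z = Y then 1 else 0 :: complex)"
  define z where "z = (\<Sum>(I, X)\<in>F. c (I, X) * of_bool (Y \<subseteq> X))"
  have supp: "{Z. v Z \<noteq> 0} = {Y}" by (auto simp: v_def)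
  hence v: "finsupp v" "vnorm v = 1" by (simp_all add: finsupp_def vnorm_def v_def)
  have Yb: "Y \<in> basis_sets" using Y by (simp add: basis_sets_def)
  have "rep.poly_op p v Z = z * v Z" for Z
  proof -
    have "rep.poly_op p v Z = (\<Sum>i\<in>F. c i * rep.list_op (letters (w i)) v Z)"
      by (simp add: p_def rep.poly_op_sum rep.poly_op_single)
    also have "\<dots> = (\<Sum>i\<in>F. (case i of (I, X) \<Rightarrow> c (I, X) * of_bool (Y \<subseteq> X)) * v Z)"
    proof (rule sum.cong)
      fix i assume "i \<in> F"
      then obtain I X where i: "i = (I, X)" "(I, X) \<in> points" using F(2) by (cases i) auto
      show "c i * rep.list_op (letters (w i)) v Z = (case i of (I, X) \<Rightarrow> c (I, X) * of_bool (Y \<subseteq> X)) * v Z"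
        using rep_coset_projection[OF i(2) x[OF i(2)], of v Z] Yb by (simp add: i(1) w_def v_def del: rep.list_op.simps)
    qed auto
    finally show ?thesis by (simp add: z_def sum_distrib_right)
  qed
  hence "rep.poly_op p v = (\<lambda>Z. z * v Z)" by blast
  hence "cmod z \<le> rep.op_norm p" using rep.vnorm_poly_op[OF v(1), of p] v by (simp add: vnorm_scale)
  with upper show "cmod (\<Sum>(I, X)\<in>F. c (I, X) * of_bool (Y \<subseteq> X)) \<le> norm (\<Sum>(I, X)\<in>F. c (I, X) *\<^sub>C ecos u e I X)"
    by (simp add: z_def)
qed

section \<open>Calculus of coset projections\<close>

context toeplitz_relations
begin

lemma u_zero: "u 0 = 1"
proof -
  have "star (u 0) * (u 0 * u 0) = star (u 0) * u 0" using u_add[of 0 0] by simp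
  thus ?thesis using u_isometry[of 0] by (simp flip: mult.assoc)
qed

lemma u_minus: "algebraic_int x \<Longrightarrow> u x * u (- x) = 1" "algebraic_int x \<Longrightarrow> u (- x) * u x = 1"
  using u_add[of x "- x"] u_add[of "- x" x] u_zero by auto

lemma star_u: "algebraic_int x \<Longrightarrow> star (u x) = u (- x)"
  using u_isometry[of x] u_minus(1)[of x] by (metis mult.assoc mult_1_left mult_1_right)

text \<open>Two representatives differ by an i in \<open>I\<close>, and \<open>u i\<close> commutes
  with \<open>e I\<close>, so that it cancels against \<open>u (- i)\<close>.\<close>

lemma ecos_eq:
  assumes IX: "(I, X) \<in> points" and x: "x \<in> X"
  shows "ecos u e I X = u x * e I * u (- x)"
proof -
  define r where "r = (SOME y. y \<in> X)"
  have r: "r \<in> X" unfolding r_def using x by (rule someI)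
  have I: "I \<in> nonzero_ideals" using IX by (simp add: points_iff)
  define i where "i = r - x"
  have i: "i \<in> I" using r points_coset_eq(2)[OF IX x] by (auto simp: i_def)
  have alg: "algebraic_int x" "algebraic_int i"
    using points_coset_eq(1)[OF IX x] ideal_algebraic_int[OF nonzero_ideals_ideal[OF I] i] by auto
  have u_split: "u (x + i) = u x * u i" "u (- i + - x) = u (- i) * u (- x)"
    using alg by (simp_all only: u_add algebraic_int_minus_iff)
  have "ecos u e I X = u (x + i) * e I * u (- i + - x)"
    by (simp add: ecos_def conj_coset_def Let_def i_def flip: r_def)
  also have "\<dots> = u x * (u i * e I) * u (- i) * u (- x)"
    by (simp only: u_split mult.assoc)
  also have "u i * e I = e I * u i" by (rule u_e_commute[OF I i])
  also have "u x * (e I * u i) * u (- i) * u (- x) = u x * e I * (u i * u (- i)) * u (- x)"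
    by (simp add: mult.assoc)
  finally show ?thesis using u_minus(1)[OF alg(2)] by simp
qed

lemma ecos_star:
  assumes "(I, X) \<in> points"
  shows "star (ecos u e I X) = ecos u e I X"
proof -
  obtain x where x: "x \<in> X" using points_coset_nonempty[OF assms] by blast
  have "algebraic_int x" "I \<in> nonzero_ideals" using points_coset_eq(1)[OF assms x] assms by (auto simp: points_iff)
  thus ?thesis using star_u[of x] star_u[of "- x"]
    by (simp add: ecos_eq[OF assms x] star_mult e_star mult.assoc)
qed

lemma ecos_mult_Int:
  assumes IX: "(I, X) \<in> points" and JY: "(J, Y) \<in> points" and "X \<inter> Y \<noteq> {}"
  shows "ecos u e I X * ecos u e J Y = ecos u e (I \<inter> J) (X \<inter> Y)"
proof -
  obtain z where z: "z \<in> X" "z \<in> Y" using assms(3) by blast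
  have IJ: "I \<in> nonzero_ideals" "J \<in> nonzero_ideals" using IX JY by (auto simp: points_iff)
  have "ecos u e I X * ecos u e J Y = u z * e I * (u (- z) * u z) * e J * u (- z)"
    by (simp add: ecos_eq[OF IX z(1)] ecos_eq[OF JY z(2)] mult.assoc)
  also have "\<dots> = u z * e (I \<inter> J) * u (- z)"
    using u_minus(2)[OF points_coset_eq(1)[OF IX z(1)]] by (simp add: e_Int[OF IJ] mult.assoc)
  finally show ?thesis using ecos_eq[OF points_Int[OF IX JY assms(3)]] z by simp
qed

text \<open>Cosets x + I and y + J are disjoint only if y - x lies outside L = I + J. Since
  \<open>e I\<close> and \<open>e J\<close> absorb \<open>e L\<close>, the factor
  \<open>e L * u (y - x) * e L\<close> appears in the middle of the product, and it is zero.\<close>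

lemma ecos_mult_disjoint:
  assumes IX: "(I, X) \<in> points" and JY: "(J, Y) \<in> points" and "X \<inter> Y = {}"
  shows "ecos u e I X * ecos u e J Y = 0"
proof -
  obtain x y where xy: "x \<in> X" "y \<in> Y" using points_coset_nonempty[OF IX] points_coset_nonempty[OF JY] by blast
  have IJ: "I \<in> nonzero_ideals" "J \<in> nonzero_ideals" using IX JY by (auto simp: points_iff)
  note I = nonzero_ideals_ideal[OF IJ(1)] and J = nonzero_ideals_ideal[OF IJ(2)]
  have alg: "algebraic_int x" "algebraic_int y" using points_coset_eq(1) IX JY xy by blast+
  define L where "L = I <+>\<^bsub>\<O>\<^esub> J"
  have sub: "I \<subseteq> L" "J \<subseteq> L" unfolding L_def by (rule subset_set_add[OF I J])+
  have L: "L \<in> nonzero_ideals" using nonzero_ideals_superset[OF IJ(1) ideal_set_add[OF I J]] sub by (simp add: L_def)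
  have "y - x \<notin> L"
  proof
    assume "y - x \<in> L"
    then obtain i j where ij: "i \<in> I" "j \<in> J" "y - x = i + j" by (auto simp: L_def set_add_ring_of_integers)
    have "x + i \<in> X" using ij(1) points_coset_eq(2)[OF IX xy(1)] by auto
    moreover have "x + i = y + - j" using ij(3) by (simp add: algebra_simps)
    moreover have "y + - j \<in> Y" using ideal_uminus[OF J ij(2)] points_coset_eq(2)[OF JY xy(2)] by blast
    ultimately show False using assms(3) by auto
  qed
  moreover have "algebraic_int (y - x)" using alg by blast
  ultimately have zero: "e L * u (y - x) * e L = 0" by (intro e_u_e[OF L])
  have eI: "e I = e I * e L" using e_Int[OF IJ(1) L] sub by (simp add: Int_absorb2)
  have eJ: "e J = e L * e J" using e_Int[OF L IJ(2)] sub by (simp add: Int_absorb1)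
  have "ecos u e I X * ecos u e J Y = u x * e I * (u (- x) * u y) * e J * u (- y)"
    by (simp add: ecos_eq[OF IX xy(1)] ecos_eq[OF JY xy(2)] mult.assoc)
  also have "u (- x) * u y = u (y - x)" using u_add[of "- x" y] alg by simp
  also have "u x * e I * u (y - x) * e J * u (- y) = u x * e I * (e L * u (y - x) * e L) * e J * u (- y)"
    by (subst eI, subst eJ) (simp add: mult.assoc)
  finally show ?thesis by (simp add: zero)
qed

lemma ecos_idem: "(I, X) \<in> points \<Longrightarrow> ecos u e I X * ecos u e I X = ecos u e I X"
  using ecos_mult_Int[of I X I X] points_coset_nonempty[of I X] by simp

lemma ecos_mult_subset:
  assumes IX: "(I, X) \<in> points" and JY: "(J, Y) \<in> points" and "X \<subseteq> Y"
  shows "ecos u e I X * ecos u e J Y = ecos u e I X"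
proof -
  have XY: "X \<inter> Y = X" using assms(3) by blast
  hence ne: "X \<inter> Y \<noteq> {}" using points_coset_nonempty[OF IX] by simp
  have "I \<inter> J = I" using points_determined[of "I \<inter> J" X I] points_Int[OF IX JY ne] IX XY by simp
  thus ?thesis using ecos_mult_Int[OF IX JY ne] XY by simp
qed

lemma ecos_carrier: "ecos u e (carrier \<O>) (carrier \<O>) = 1"
  using ecos_eq[OF points_carrier, of 0] by (simp add: e_carrier u_zero)

lemma ecos_self:
  assumes "I \<in> nonzero_ideals"
  shows "(I, I) \<in> points" "ecos u e I I = e I"
proof -
  show II: "(I, I) \<in> points" unfolding points_iff using assms by (intro conjI exI[of _ 0]) auto
  show "ecos u e I I = e I"
    using ecos_eq[OF II ideal_zero[OF nonzero_ideals_ideal[OF assms]]] by (simp add: u_zero)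
qed

lemma ecos_conj:
  assumes "(I, X) \<in> points" "algebraic_int x"
  shows "u x * ecos u e I X * u (- x) = ecos u e I ((+) x ` X)" "(I, (+) x ` X) \<in> points"
proof -
  obtain z where z: "z \<in> X" using points_coset_nonempty[OF assms(1)] by blast
  note zX = points_coset_eq[OF assms(1) z]
  have eq: "(+) x ` X = (+) (x + z) ` I" by (subst zX(2)) (simp add: image_image add.assoc)
  show mem: "(I, (+) x ` X) \<in> points"
    using assms zX(1) unfolding eq by (auto simp: points_iff intro!: exI[of _ "x + z"])
  have "- (x + z) = - z + - x" by simp
  hence u_split: "u (x + z) = u x * u z" "u (- (x + z)) = u (- z) * u (- x)"
    using assms zX(1) by (simp_all only: u_add algebraic_int_minus_iff)
  have "ecos u e I ((+) x ` X) = u (x + z) * e I * u (- (x + z))"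
    by (rule ecos_eq[OF mem]) (use z in simp)
  also have "\<dots> = u x * (u z * e I * u (- z)) * u (- x)"
    by (simp only: u_split mult.assoc)
  finally show "u x * ecos u e I X * u (- x) = ecos u e I ((+) x ` X)" by (simp add: ecos_eq[OF assms(1) z])
qed

section \<open>The character attached to a subset of the ring of integers\<close>

abbreviation \<DD> :: "'a set"
  where "\<DD> \<equiv> Dbar u e"

lemma ecos_in_Dbar: "(I, X) \<in> points \<Longrightarrow> ecos u e I X \<in> \<DD>"
  unfolding Dbar_def by (rule subsetD[OF subset_cstar_generated]) blast

lemma cstar_subalgebra_Dbar: "cstar_subalgebra \<DD>"
  unfolding Dbar_def by (rule cstar_subalgebra_generated)

lemma one_in_Dbar: "1 \<in> \<DD>"
  using ecos_in_Dbar[OF points_carrier] by (simp add: ecos_carrier)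

text \<open>The graph of the character on the linear span of the coset projections.\<close>

inductive coset_comb :: "'k set \<Rightarrow> 'a \<Rightarrow> complex \<Rightarrow> bool" for Y where
  zero: "coset_comb Y 0 0"
| add: "(I, X) \<in> points \<Longrightarrow> coset_comb Y a z \<Longrightarrow> coset_comb Y (c *\<^sub>C ecos u e I X + a) (c * of_bool (Y \<subseteq> X) + z)"

lemma coset_comb_plus: "coset_comb Y a z \<Longrightarrow> coset_comb Y b w \<Longrightarrow> coset_comb Y (a + b) (z + w)"
proof (induction rule: coset_comb.induct)
  case (add I X a z c)
  from coset_comb.add[OF add.hyps(1) add.IH[OF add.prems], of c] show ?case by (simp only: add.assoc)
qed simp

lemma coset_comb_scale: "coset_comb Y a z \<Longrightarrow> coset_comb Y (c *\<^sub>C a) (c * z)"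
proof (induction rule: coset_comb.induct)
  case (add I X a z d)
  from coset_comb.add[OF add.hyps(1) add.IH, of "c * d"] show ?case
    by (simp only: scaleC_add_right scaleC_scaleC distrib_left mult.assoc)
qed (simp add: coset_comb.zero)

lemma coset_comb_ecos: "(I, X) \<in> points \<Longrightarrow> coset_comb Y (ecos u e I X) (of_bool (Y \<subseteq> X))"
  using coset_comb.add[OF _ coset_comb.zero, of I X Y 1] by simp

lemma coset_comb_star: "coset_comb Y a z \<Longrightarrow> coset_comb Y (star a) (cnj z)"
proof (induction rule: coset_comb.induct)
  case (add I X a z c)
  have "cnj (c * of_bool (Y \<subseteq> X) + z) = cnj c * of_bool (Y \<subseteq> X) + cnj z" by simp
  thus ?case using coset_comb.add[OF add.hyps(1) add.IH, of "cnj c"]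
    by (simp only: star_add star_scaleC ecos_star[OF add.hyps(1)])
qed (simp add: coset_comb.zero)

lemma coset_comb_mult:
  assumes Y: "Y \<noteq> {}" and "coset_comb Y a z" "coset_comb Y b w"
  shows "coset_comb Y (a * b) (z * w)"
  using assms(2)
proof (induction rule: coset_comb.induct)
  case (add I X a z c)
  have "coset_comb Y (ecos u e I X * b) (of_bool (Y \<subseteq> X) * w)"
    using assms(3)
  proof (induction rule: coset_comb.induct)
    case (add J Z b w d)
    have "coset_comb Y (ecos u e I X * ecos u e J Z) (of_bool (Y \<subseteq> X) * of_bool (Y \<subseteq> Z))"
    proof (cases "X \<inter> Z = {}")
      case True
      hence "\<not> (Y \<subseteq> X \<and> Y \<subseteq> Z)" using Y by blast
      hence "of_bool (Y \<subseteq> X) * of_bool (Y \<subseteq> Z) = (0 :: complex)" by auto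
      thus ?thesis using ecos_mult_disjoint[OF \<open>(I, X) \<in> points\<close> add.hyps(1) True] by (simp add: coset_comb.zero)
    next
      case False
      have "of_bool (Y \<subseteq> X) * of_bool (Y \<subseteq> Z) = (of_bool (Y \<subseteq> X \<inter> Z) :: complex)" by auto
      thus ?thesis
        using ecos_mult_Int[OF \<open>(I, X) \<in> points\<close> add.hyps(1) False]
          coset_comb_ecos[OF points_Int[OF \<open>(I, X) \<in> points\<close> add.hyps(1) False]] by simp
    qed
    from coset_comb_plus[OF coset_comb_scale[OF this] add.IH, of d]
    show ?case by (simp add: distrib_left mult_scaleC_right mult.left_commute)
  qed (simp add: coset_comb.zero)
  from coset_comb_plus[OF coset_comb_scale[OF this] add.IH, of c]
  show ?case by (simp add: distrib_right mult_scaleC_left mult.assoc)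
qed (simp add: coset_comb.zero)

text \<open>A combination may list the same projection several times, whereas
  \<open>norm_lower\<close> sums over a set of points. Encoding the combination as a finitely
  supported function on points collects equal terms.\<close>

lemma coset_comb_norm_le:
  assumes Y: "Y \<subseteq> carrier \<O>" "Y \<noteq> {}" and "coset_comb Y a z"
  shows "cmod z \<le> norm a"
proof -
  define A where "A = linear_ext (*\<^sub>C) (\<lambda>(I, X). ecos u e I X)"
  define Z where "Z = linear_ext (*) (\<lambda>(I :: 'k set, X). of_bool (Y \<subseteq> X) :: complex)"
  note A_simps = linear_ext_add[of "(*\<^sub>C)", OF scaleC_add_left] linear_ext_single[of "(*\<^sub>C)", OF scaleC_add_left]
    linear_ext_zero[of "(*\<^sub>C)", OF scaleC_add_left]
  note Z_simps = linear_ext_add[of "(*)", OF distrib_right] linear_ext_single[of "(*)", OF distrib_right]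
    linear_ext_zero[of "(*)", OF distrib_right]
  have "\<exists>q. Poly_Mapping.keys q \<subseteq> points \<and> a = A q \<and> z = Z q"
    using assms(3)
  proof (induction rule: coset_comb.induct)
    case zero
    show ?case by (intro exI[of _ 0]) (simp add: A_def Z_def A_simps Z_simps)
  next
    case (add I X a z c)
    then obtain q where q: "Poly_Mapping.keys q \<subseteq> points" "a = A q" "z = Z q" by blast
    have "Poly_Mapping.keys (Poly_Mapping.single (I, X) c + q) \<subseteq> points"
      using keys_add[of "Poly_Mapping.single (I, X) c" q] q(1) add.hyps(1) by (auto split: if_splits)
    thus ?case
      by (intro exI[of _ "Poly_Mapping.single (I, X) c + q"]) (simp add: q A_def Z_def A_simps Z_simps)
  qed
  then obtain q where q: "Poly_Mapping.keys q \<subseteq> points" "a = A q" "z = Z q" by blast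
  have "z = (\<Sum>(I, X)\<in>Poly_Mapping.keys q. Poly_Mapping.lookup q (I, X) * of_bool (Y \<subseteq> X))"
    unfolding q(3) Z_def linear_ext_def by (intro sum.cong) auto
  moreover have "a = (\<Sum>(I, X)\<in>Poly_Mapping.keys q. Poly_Mapping.lookup q (I, X) *\<^sub>C ecos u e I X)"
    unfolding q(2) A_def linear_ext_def by (intro sum.cong) auto
  ultimately show ?thesis using norm_lower[OF finite_keys q(1) Y] by simp
qed

definition coset_graph :: "'k set \<Rightarrow> 'a \<Rightarrow> complex \<Rightarrow> bool"
  where "coset_graph Y a z \<longleftrightarrow> (\<exists>f g. (\<forall>n :: nat. coset_comb Y (f n) (g n)) \<and> f \<longlonglongrightarrow> a \<and> g \<longlonglongrightarrow> z)"

lemma coset_comb_graph: "coset_comb Y a z \<Longrightarrow> coset_graph Y a z"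
  unfolding coset_graph_def by (intro exI[of _ "\<lambda>_. a"] exI[of _ "\<lambda>_. z"]) auto

context
  fixes Y :: "'k set"
  assumes Y: "Y \<subseteq> carrier \<O>" "Y \<noteq> {}"
begin

lemma coset_graph_plus: "coset_graph Y a z \<Longrightarrow> coset_graph Y b w \<Longrightarrow> coset_graph Y (a + b) (z + w)"
  unfolding coset_graph_def
proof (elim exE conjE)
  fix f g f' g' assume "\<forall>n. coset_comb Y (f n) (g n)" "\<forall>n. coset_comb Y (f' n) (g' n)" "f \<longlonglongrightarrow> a" "g \<longlonglongrightarrow> z" "f' \<longlonglongrightarrow> b" "g' \<longlonglongrightarrow> w"
  thus "\<exists>f g. (\<forall>n. coset_comb Y (f n) (g n)) \<and> f \<longlonglongrightarrow> a + b \<and> g \<longlonglongrightarrow> z + w"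
    by (intro exI[of _ "\<lambda>n. f n + f' n"] exI[of _ "\<lambda>n. g n + g' n"]) (auto intro: coset_comb_plus tendsto_add)
qed

lemma coset_graph_mult: "coset_graph Y a z \<Longrightarrow> coset_graph Y b w \<Longrightarrow> coset_graph Y (a * b) (z * w)"
  unfolding coset_graph_def
proof (elim exE conjE)
  fix f g f' g' assume "\<forall>n. coset_comb Y (f n) (g n)" "\<forall>n. coset_comb Y (f' n) (g' n)" "f \<longlonglongrightarrow> a" "g \<longlonglongrightarrow> z" "f' \<longlonglongrightarrow> b" "g' \<longlonglongrightarrow> w"
  thus "\<exists>f g. (\<forall>n. coset_comb Y (f n) (g n)) \<and> f \<longlonglongrightarrow> a * b \<and> g \<longlonglongrightarrow> z * w"
    by (intro exI[of _ "\<lambda>n. f n * f' n"] exI[of _ "\<lambda>n. g n * g' n"]) (auto intro: coset_comb_mult[OF Y(2)] tendsto_mult)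
qed

lemma coset_graph_scale: "coset_graph Y a z \<Longrightarrow> coset_graph Y (c *\<^sub>C a) (c * z)"
  unfolding coset_graph_def
proof (elim exE conjE)
  fix f g assume "\<forall>n. coset_comb Y (f n) (g n)" "f \<longlonglongrightarrow> a" "g \<longlonglongrightarrow> z"
  thus "\<exists>f g. (\<forall>n. coset_comb Y (f n) (g n)) \<and> f \<longlonglongrightarrow> c *\<^sub>C a \<and> g \<longlonglongrightarrow> c * z"
    by (intro exI[of _ "\<lambda>n. c *\<^sub>C f n"] exI[of _ "\<lambda>n. c * g n"])
       (auto intro: coset_comb_scale tendsto_scaleC tendsto_mult)
qed

lemma coset_graph_norm_le: "coset_graph Y a z \<Longrightarrow> cmod z \<le> norm a"
  unfolding coset_graph_def using coset_comb_norm_le[OF Y]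
  by (elim exE conjE, intro LIMSEQ_le[OF tendsto_norm tendsto_norm]) auto

text \<open>The closed graph is linear and satisfies the norm bound, so over 0 it contains only 0.
  This is the well-definedness of the character.\<close>

lemma coset_graph_unique:
  assumes "coset_graph Y a z" "coset_graph Y a w"
  shows "z = w"
proof -
  have "coset_graph Y (a + (- 1) *\<^sub>C a) (z + (- 1) * w)"
    using coset_graph_plus[OF assms(1) coset_graph_scale[OF assms(2)]] .
  hence "cmod (z - w) \<le> norm (a - a)" using coset_graph_norm_le by (fastforce simp: scaleC_minus1)
  thus ?thesis by simp
qed

text \<open>Linear combinations of coset projections form a *-algebra, because products of
  projections are projections of intersections or 0. Its closure contains the generated algebra.
  Along an approximating sequence the values are Cauchy by the norm bound for differences.\<close>

lemma coset_graph_total: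
  assumes "a \<in> \<DD>"
  shows "\<exists>z. coset_graph Y a z"
proof -
  define D where "D = {a. \<exists>z. coset_comb Y a z}"
  have "cstar_subalgebra (closure D)"
    by (rule cstar_subalgebra_closure)
       (auto simp: D_def intro: coset_comb.zero coset_comb_plus coset_comb_mult[OF Y(2)] coset_comb_scale coset_comb_star)
  moreover have "{ecos u e I X | I X. (I, X) \<in> points} \<subseteq> closure D"
  proof clarify
    fix I X :: "'k set" assume "(I, X) \<in> points"
    hence "ecos u e I X \<in> D" unfolding D_def using coset_comb_ecos by blast
    thus "ecos u e I X \<in> closure D" using closure_subset by blast
  qed
  ultimately have "\<DD> \<subseteq> closure D" unfolding Dbar_def by (intro cstar_generated_minimal)
  hence "a \<in> closure D" using assms by blast
  then obtain f where "\<forall>n. f n \<in> D" and f: "f \<longlonglongrightarrow> a" unfolding closure_sequential by blast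
  then obtain g where g: "\<And>n. coset_comb Y (f n) (g n)" unfolding D_def mem_Collect_eq by metis
  have dist_le: "dist (g m) (g n) \<le> dist (f m) (f n)" for m n
  proof -
    have "coset_comb Y (f m + (- 1) *\<^sub>C f n) (g m + (- 1) * g n)"
      by (intro coset_comb_plus coset_comb_scale g)
    from coset_comb_norm_le[OF Y this] show ?thesis by (simp add: scaleC_minus1 dist_norm)
  qed
  have "Cauchy f" using f by (rule LIMSEQ_imp_Cauchy)
  hence "Cauchy g" unfolding Cauchy_def using dist_le by (meson le_less_trans)
  then obtain z where "g \<longlonglongrightarrow> z" using Cauchy_convergent_iff convergent_def by blast
  thus ?thesis unfolding coset_graph_def using f g by blast
qed

end

text \<open>Evaluation at the joint eigenvector \<open>Y\<close>. The value is taken from the closed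
  graph, and the restriction makes the function extensional, as \<open>spectrum\<close>
  demands.\<close>

definition coset_character :: "'k set \<Rightarrow> 'a \<Rightarrow> complex"
  where "coset_character Y = restrict (\<lambda>a. THE z. coset_graph Y a z) \<DD>"

context
  fixes Y :: "'k set"
  assumes Y: "Y \<subseteq> carrier \<O>" "Y \<noteq> {}"
begin

lemma coset_character_eqI: "a \<in> \<DD> \<Longrightarrow> coset_graph Y a z \<Longrightarrow> coset_character Y a = z"
  unfolding coset_character_def using coset_graph_unique[OF Y] by (auto intro: the_equality)

lemma coset_graph_character: "a \<in> \<DD> \<Longrightarrow> coset_graph Y a (coset_character Y a)"
  using coset_graph_total[OF Y] coset_character_eqI by metis

lemma coset_character_ecos: "(I, X) \<in> points \<Longrightarrow> coset_character Y (ecos u e I X) = of_bool (Y \<subseteq> X)"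
  by (intro coset_character_eqI ecos_in_Dbar coset_comb_graph coset_comb_ecos)

lemma coset_character_one: "coset_character Y 1 = 1"
  using coset_character_ecos[OF points_carrier] Y by (simp add: ecos_carrier)

lemma coset_character_spectrum: "coset_character Y \<in> spectrum \<DD>"
  unfolding spectrum_def
proof (intro CollectI conjI ballI allI)
  note D = cstar_subalgebra_Dbar
  show "coset_character Y \<in> extensional \<DD>" by (simp add: coset_character_def)
  fix a b assume ab: "a \<in> \<DD>" "b \<in> \<DD>"
  show "coset_character Y (a + b) = coset_character Y a + coset_character Y b"
    using ab by (intro coset_character_eqI cstar_subalgebra_add[OF D] coset_graph_plus[OF Y] coset_graph_character)
  show "coset_character Y (a * b) = coset_character Y a * coset_character Y b"
    using ab by (intro coset_character_eqI cstar_subalgebra_mult[OF D] coset_graph_mult[OF Y] coset_graph_character)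
next
  fix c a assume "a \<in> \<DD>"
  thus "coset_character Y (c *\<^sub>C a) = c * coset_character Y a"
    by (intro coset_character_eqI cstar_subalgebra_scaleC[OF cstar_subalgebra_Dbar] coset_graph_scale[OF Y] coset_graph_character)
next
  show "\<exists>x\<in>\<DD>. coset_character Y x \<noteq> 0" using one_in_Dbar coset_character_one by (intro bexI[of _ 1]) auto
qed

end

lemma spectrum_idempotent:
  assumes "cstar_subalgebra B" "\<phi> \<in> spectrum B" "p \<in> B" "p * p = p"
  shows "\<phi> p \<in> {0, 1}"
  using spectrum_mult[OF assms(1,2,3,3)] assms(4) by auto

lemma spectrum_ecos: "\<phi> \<in> spectrum \<DD> \<Longrightarrow> (I, X) \<in> points \<Longrightarrow> \<phi> (ecos u e I X) \<in> {0, 1}"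
  by (rule spectrum_idempotent[OF cstar_subalgebra_Dbar]) (auto simp: ecos_in_Dbar ecos_idem)

section \<open>The tensor factor at one prime\<close>

lemma prime_pow_points:
  "P \<in> prime_ideals \<Longrightarrow> (ideal_pow P n, X) \<in> points \<longleftrightarrow> X \<in> carrier (\<O> Quot ideal_pow P n)"
  by (simp add: points_def ideal_pow_nonzero prime_ideals_nonzero)

definition local_projections :: "'k set \<Rightarrow> 'a set"
  where "local_projections P = {ecos u e (ideal_pow P n) X | n X. (ideal_pow P n, X) \<in> points}"

lemma Dbar_at_eq: "P \<in> prime_ideals \<Longrightarrow> Dbar_at u e P = cstar_generated (local_projections P)"
  by (simp add: Dbar_at_def local_projections_def prime_pow_points)

context
  fixes P :: "'k set"
  assumes P: "P \<in> prime_ideals"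
begin

lemma cstar_subalgebra_Dbar_at: "cstar_subalgebra (Dbar_at u e P)"
  unfolding Dbar_at_def by (rule cstar_subalgebra_generated)

lemma ecos_in_Dbar_at: "(ideal_pow P n, X) \<in> points \<Longrightarrow> ecos u e (ideal_pow P n) X \<in> Dbar_at u e P"
  unfolding Dbar_at_eq[OF P] local_projections_def by (rule subsetD[OF subset_cstar_generated]) blast

lemma Dbar_at_subset: "Dbar_at u e P \<subseteq> \<DD>"
  unfolding Dbar_at_eq[OF P]
  by (rule cstar_generated_minimal[OF _ cstar_subalgebra_Dbar]) (auto simp: local_projections_def ecos_in_Dbar)

lemma one_in_Dbar_at: "1 \<in> Dbar_at u e P"
  using ecos_in_Dbar_at[of 0 "carrier \<O>"] points_carrier by (simp add: ideal_pow_0 ecos_carrier)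

lemma Dbar_at_spectrum_eqI:
  assumes "\<phi> \<in> spectrum (Dbar_at u e P)" "\<psi> \<in> spectrum (Dbar_at u e P)"
    "\<And>n X. (ideal_pow P n, X) \<in> points \<Longrightarrow> \<phi> (ecos u e (ideal_pow P n) X) = \<psi> (ecos u e (ideal_pow P n) X)"
  shows "\<phi> = \<psi>"
  using assms(1,2) unfolding Dbar_at_eq[OF P]
  by (rule spectrum_eqI) (auto simp: local_projections_def ecos_star assms(3))

lemma coset_character_Dbar_at:
  assumes "Y \<subseteq> carrier \<O>" "Y \<noteq> {}"
  shows "restrict (coset_character Y) (Dbar_at u e P) \<in> spectrum (Dbar_at u e P)"
  by (rule spectrum_restrict[OF coset_character_spectrum[OF assms] one_in_Dbar_at _ Dbar_at_subset cstar_subalgebra_Dbar_at])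
     (simp add: coset_character_one[OF assms])

text \<open>Multiplying by \<open>e (ideal_pow P n)\<close> retains from the sum of all coset
  projections at level n only the trivial coset, and from the sum at level n + 1 the cosets inside
  P^n. Conjugation moves everything into \<open>X\<close>. So \<open>delta\<close> removes from the
  projection of \<open>X\<close> the next finer cosets that \<open>X\<close> contains.\<close>

lemma delta_eq:
  assumes X: "(ideal_pow P n, X) \<in> points"
  shows "delta u e P n X = ecos u e (ideal_pow P n) X -
    (\<Sum>W\<in>{W. (ideal_pow P (Suc n), W) \<in> points \<and> W \<subseteq> X}. ecos u e (ideal_pow P (Suc n)) W)"
proof -
  let ?J = "ideal_pow P n" and ?K = "ideal_pow P (Suc n)"
  have J: "?J \<in> nonzero_ideals" and K: "?K \<in> nonzero_ideals"
    using P by (simp_all add: ideal_pow_nonzero prime_ideals_nonzero)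
  have KJ: "?K \<subseteq> ?J" using ideal_pow_antimono[OF prime_ideals_ideal[OF P], of n "Suc n"] by simp
  define x where "x = (SOME y. y \<in> X)"
  have x: "x \<in> X" unfolding x_def using points_coset_nonempty[OF X] by (simp add: some_in_eq)
  note xX = points_coset_eq[OF X x]
  have prod_J: "e ?J * fsum u e ?J = e ?J"
  proof -
    have "e ?J * fsum u e ?J = (\<Sum>Z\<in>carrier (\<O> Quot ?J). ecos u e ?J ?J * ecos u e ?J Z)"
      by (simp add: fsum_def sum_distrib_left ecos_self(2)[OF J])
    also have "\<dots> = (\<Sum>Z\<in>carrier (\<O> Quot ?J). if Z = ?J then e ?J else 0)"
    proof (rule sum.cong)
      fix Z assume "Z \<in> carrier (\<O> Quot ?J)"
      hence Z: "(?J, Z) \<in> points" by (simp add: prime_pow_points[OF P])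
      show "ecos u e ?J ?J * ecos u e ?J Z = (if Z = ?J then e ?J else 0)"
      proof (cases "Z = ?J")
        case True
        thus ?thesis using ecos_idem[OF ecos_self(1)[OF J]] ecos_self(2)[OF J] by simp
      next
        case False
        have "?J \<inter> Z = {}"
        proof (rule ccontr)
          assume "?J \<inter> Z \<noteq> {}"
          then obtain z where "z \<in> ?J" "z \<in> Z" by blast
          thus False using False points_coset_eq(2)[OF Z] points_coset_eq(2)[OF ecos_self(1)[OF J]] by metis
        qed
        thus ?thesis using ecos_mult_disjoint[OF ecos_self(1)[OF J] Z] False by simp
      qed
    qed simp
    also have "\<dots> = e ?J"
      using finite_quotient[OF J] ecos_self(1)[OF J] by (simp add: prime_pow_points[OF P])
    finally show ?thesis .
  qed
  have prod_K: "e ?J * fsum u e ?K = (\<Sum>Z\<in>{Z. (?K, Z) \<in> points \<and> Z \<subseteq> ?J}. ecos u e ?K Z)"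
  proof -
    have "e ?J * fsum u e ?K = (\<Sum>Z\<in>carrier (\<O> Quot ?K). ecos u e ?J ?J * ecos u e ?K Z)"
      by (simp add: fsum_def sum_distrib_left ecos_self(2)[OF J])
    also have "\<dots> = (\<Sum>Z\<in>carrier (\<O> Quot ?K). if Z \<subseteq> ?J then ecos u e ?K Z else 0)"
    proof (rule sum.cong)
      fix Z assume "Z \<in> carrier (\<O> Quot ?K)"
      hence Z: "(?K, Z) \<in> points" by (simp add: prime_pow_points[OF P])
      note JJ = ecos_self(1)[OF J]
      show "ecos u e ?J ?J * ecos u e ?K Z = (if Z \<subseteq> ?J then ecos u e ?K Z else 0)"
      proof (cases "Z \<subseteq> ?J")
        case True
        hence int: "?J \<inter> Z = Z" "?J \<inter> ?K = ?K" using KJ by auto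
        hence "?J \<inter> Z \<noteq> {}" using points_coset_nonempty[OF Z] by simp
        from ecos_mult_Int[OF JJ Z this] show ?thesis using True int by simp
      next
        case False
        have "?J \<inter> Z = {}"
        proof (rule ccontr)
          assume "?J \<inter> Z \<noteq> {}"
          then obtain z where z: "z \<in> ?J" "z \<in> Z" by blast
          have "Z = (+) z ` ?K" "?J = (+) z ` ?J"
            using points_coset_eq(2)[OF Z z(2)] points_coset_eq(2)[OF JJ z(1)] .
          thus False using False KJ by blast
        qed
        thus ?thesis using ecos_mult_disjoint[OF JJ Z] False by simp
      qed
    qed simp
    also have "\<dots> = (\<Sum>Z\<in>{Z. (?K, Z) \<in> points \<and> Z \<subseteq> ?J}. ecos u e ?K Z)"
      using finite_quotient[OF K]
      by (simp add: sum.inter_filter[symmetric] prime_pow_points[OF P])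
    finally show ?thesis .
  qed
  \<comment> \<open>Translation by the representative x matches the finer cosets inside P^n with
    those inside \<open>X\<close>; translation by -x is the inverse.\<close>
  have bij: "bij_betw ((`) ((+) x)) {Z. (?K, Z) \<in> points \<and> Z \<subseteq> ?J} {W. (?K, W) \<in> points \<and> W \<subseteq> X}"
  proof (rule bij_betwI[where g = "(`) ((+) (- x))"])
    show "(`) ((+) x) \<in> {Z. (?K, Z) \<in> points \<and> Z \<subseteq> ?J} \<rightarrow> {W. (?K, W) \<in> points \<and> W \<subseteq> X}"
      using ecos_conj(2)[OF _ xX(1)] xX(2) by blast
    show "(`) ((+) (- x)) \<in> {W. (?K, W) \<in> points \<and> W \<subseteq> X} \<rightarrow> {Z. (?K, Z) \<in> points \<and> Z \<subseteq> ?J}"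
    proof (intro funcsetI CollectI conjI; elim CollectE conjE)
      fix W assume W: "(?K, W) \<in> points" "W \<subseteq> X"
      show "(?K, (+) (- x) ` W) \<in> points" using ecos_conj(2)[OF W(1), of "- x"] xX(1) by simp
      have "(+) (- x) ` W \<subseteq> (+) (- x) ` ((+) x ` ?J)" using W(2) xX(2) by blast
      thus "(+) (- x) ` W \<subseteq> ?J" by (simp add: image_image)
    qed
  qed (simp_all add: image_image)
  have "delta u e P n X = u x * (e ?J * (fsum u e ?J - fsum u e ?K)) * u (- x)"
    by (simp add: delta_def conj_coset_def Let_def eps_def flip: x_def)
  also have "\<dots> = u x * e ?J * u (- x) - u x * (\<Sum>Z\<in>{Z. (?K, Z) \<in> points \<and> Z \<subseteq> ?J}. ecos u e ?K Z) * u (- x)"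
    by (simp only: right_diff_distrib left_diff_distrib prod_J prod_K)
  also have "u x * e ?J * u (- x) = ecos u e ?J X" by (rule ecos_eq[OF X x, symmetric])
  also have "u x * (\<Sum>Z\<in>{Z. (?K, Z) \<in> points \<and> Z \<subseteq> ?J}. ecos u e ?K Z) * u (- x) =
      (\<Sum>Z\<in>{Z. (?K, Z) \<in> points \<and> Z \<subseteq> ?J}. ecos u e ?K ((+) x ` Z))"
    by (simp add: sum_distrib_left sum_distrib_right ecos_conj(1)[OF _ xX(1)])
  also have "\<dots> = (\<Sum>W\<in>{W. (?K, W) \<in> points \<and> W \<subseteq> X}. ecos u e ?K W)"
    by (rule sum.reindex_bij_betw[OF bij])
  finally show ?thesis .
qed

lemma finite_points_at: "finite {W. (ideal_pow P n, W) \<in> points \<and> Q W}"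
  using finite_quotient[OF ideal_pow_nonzero[OF prime_ideals_nonzero[OF P]], of n]
  by (simp add: prime_pow_points[OF P])

lemma delta_in_Dbar_at: "(ideal_pow P n, X) \<in> points \<Longrightarrow> delta u e P n X \<in> Dbar_at u e P"
  unfolding delta_eq
  by (intro cstar_subalgebra_diff[OF cstar_subalgebra_Dbar_at] cstar_subalgebra_sum[OF cstar_subalgebra_Dbar_at]
      ecos_in_Dbar_at) auto

text \<open>All values on coset projections are 0 or 1, so value 1 on \<open>delta\<close> forces
  value 1 on \<open>X\<close> and 0 on every coset of the next power inside \<open>X\<close>. Any
  coset of a power of \<open>P\<close> contains \<open>X\<close>, is disjoint from \<open>X\<close>,
  or lies in one of these finer cosets, which fixes its value.\<close>

lemma spectrum_delta_ecos:
  assumes X: "(ideal_pow P n, X) \<in> points" and \<phi>: "\<phi> \<in> spectrum (Dbar_at u e P)" and "\<phi> (delta u e P n X) = 1"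
    and Y: "(ideal_pow P m, Y) \<in> points"
  shows "\<phi> (ecos u e (ideal_pow P m) Y) = of_bool (X \<subseteq> Y)"
proof -
  note B = cstar_subalgebra_Dbar_at
  note P' = prime_ideals_ideal[OF P]
  let ?A = "{W. (ideal_pow P (Suc n), W) \<in> points \<and> W \<subseteq> X}"
  let ?b = "\<lambda>W. \<phi> (ecos u e (ideal_pow P (Suc n)) W)"
  have idem: "\<phi> (ecos u e (ideal_pow P k) Z) \<in> {0, 1}" if "(ideal_pow P k, Z) \<in> points" for k Z
    using spectrum_idempotent[OF B \<phi> ecos_in_Dbar_at ecos_idem] that by blast
  have "\<phi> (delta u e P n X) = \<phi> (ecos u e (ideal_pow P n) X) - (\<Sum>W\<in>?A. ?b W)"
    unfolding delta_eq[OF X] using X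
    by (subst spectrum_diff[OF B \<phi>])
       (auto intro!: ecos_in_Dbar_at cstar_subalgebra_sum[OF B] spectrum_sum[OF B \<phi>])
  hence eq: "\<phi> (ecos u e (ideal_pow P n) X) = 1 + (\<Sum>W\<in>?A. ?b W)" using assms(3) by (simp add: diff_eq_eq)
  \<comment> \<open>By \<open>eq\<close> the value at \<open>X\<close>, which is at most 1, is 1
    plus a sum of terms 0 or 1. Comparing real parts makes every term vanish.\<close>
  have re: "Re (?b W) \<ge> 0" "Im (?b W) = 0" if "W \<in> ?A" for W using idem[of "Suc n" W] that by auto
  have "Re (\<phi> (ecos u e (ideal_pow P n) X)) \<le> 1" using idem[OF X] by auto
  hence "(\<Sum>W\<in>?A. Re (?b W)) \<le> 0" using eq by simp
  hence "(\<Sum>W\<in>?A. Re (?b W)) = 0" by (intro antisym sum_nonneg re(1))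
  hence "Re (?b W) = 0" if "W \<in> ?A" for W
    using sum_nonneg_eq_0_iff[OF finite_points_at, of "Suc n" "\<lambda>W. W \<subseteq> X" "\<lambda>W. Re (?b W)"] re(1) that by blast
  hence b0: "?b W = 0" if "W \<in> ?A" for W using re(2)[OF that] that by (simp add: complex_eq_iff)
  hence X1: "\<phi> (ecos u e (ideal_pow P n) X) = 1" using eq by simp
  show ?thesis
  proof (cases "X \<subseteq> Y")
    case True
    have "\<phi> (ecos u e (ideal_pow P n) X) * \<phi> (ecos u e (ideal_pow P m) Y) = \<phi> (ecos u e (ideal_pow P n) X)"
      using spectrum_mult[OF B \<phi> ecos_in_Dbar_at[OF X] ecos_in_Dbar_at[OF Y]] ecos_mult_subset[OF X Y True] by simp
    thus ?thesis using X1 True by simp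
  next
    case False
    show ?thesis
    proof (cases "X \<inter> Y = {}")
      case True
      have "\<phi> (ecos u e (ideal_pow P n) X) * \<phi> (ecos u e (ideal_pow P m) Y) = 0"
        using spectrum_mult[OF B \<phi> ecos_in_Dbar_at[OF X] ecos_in_Dbar_at[OF Y]] ecos_mult_disjoint[OF X Y True]
          spectrum_zero[OF B \<phi>] by simp
      thus ?thesis using X1 False by simp
    next
      case nonempty: False
      then obtain z where z: "z \<in> X" "z \<in> Y" by blast
      note zX = points_coset_eq[OF X z(1)] and zY = points_coset_eq[OF Y z(2)]
      \<comment> \<open>Cosets of powers of the same prime that meet at z are nested. As
        \<open>Y\<close> does not contain \<open>X\<close>, it belongs to a higher power and lies in
        the coset \<open>W\<close> of the (n+1)-st power around z.\<close>
      have "\<not> m \<le> n"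
      proof
        assume "m \<le> n"
        hence "(+) z ` ideal_pow P n \<subseteq> (+) z ` ideal_pow P m" using ideal_pow_antimono[OF P'] by blast
        thus False using False zX zY by simp
      qed
      hence sub: "ideal_pow P m \<subseteq> ideal_pow P (Suc n)" "ideal_pow P (Suc n) \<subseteq> ideal_pow P n"
        using ideal_pow_antimono[OF P'] by auto
      define W where "W = (+) z ` ideal_pow P (Suc n)"
      have W: "(ideal_pow P (Suc n), W) \<in> points"
        unfolding W_def points_iff using zX(1) ideal_pow_nonzero[OF prime_ideals_nonzero[OF P]] by blast
      have "W \<subseteq> X" "Y \<subseteq> W" using sub zX(2) zY(2) unfolding W_def by blast+
      have "\<phi> (ecos u e (ideal_pow P m) Y) * ?b W = \<phi> (ecos u e (ideal_pow P m) Y)"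
        using spectrum_mult[OF B \<phi> ecos_in_Dbar_at[OF Y] ecos_in_Dbar_at[OF W]] ecos_mult_subset[OF Y W \<open>Y \<subseteq> W\<close>] by simp
      moreover have "?b W = 0" using b0 W \<open>W \<subseteq> X\<close> by blast
      ultimately show ?thesis using False by simp
    qed
  qed
qed

text \<open>Consecutive powers of \<open>P\<close> differ, so no coset of the next power inside
  \<open>X\<close> is all of \<open>X\<close>, and the subtracted terms vanish.\<close>

lemma coset_character_delta:
  assumes X: "(ideal_pow P n, X) \<in> points"
  shows "coset_character X (delta u e P n X) = 1"
proof -
  note ne = points_coset_subset[OF X] points_coset_nonempty[OF X]
  note \<phi> = coset_character_spectrum[OF ne] and B = cstar_subalgebra_Dbar
  let ?A = "{W. (ideal_pow P (Suc n), W) \<in> points \<and> W \<subseteq> X}"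
  have "\<not> X \<subseteq> W" if "W \<in> ?A" for W
  proof
    assume "X \<subseteq> W"
    hence W: "W = X" "(ideal_pow P (Suc n), X) \<in> points" using that by auto
    hence "ideal_pow P (Suc n) = ideal_pow P n" using points_determined X by blast
    thus False using prime_pow_strict[OF P, of n] by simp
  qed
  hence "coset_character X (ecos u e (ideal_pow P (Suc n)) W) = 0" if "W \<in> ?A" for W
    using coset_character_ecos[OF ne] that by auto
  moreover have "coset_character X (delta u e P n X) = coset_character X (ecos u e (ideal_pow P n) X) -
      (\<Sum>W\<in>?A. coset_character X (ecos u e (ideal_pow P (Suc n)) W))"
    unfolding delta_eq[OF X] using X
    by (subst spectrum_diff[OF B \<phi>])
       (auto intro!: ecos_in_Dbar cstar_subalgebra_sum[OF B] spectrum_sum[OF B \<phi>])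
  ultimately show ?thesis using coset_character_ecos[OF ne X] by simp
qed

text \<open>Resolves the definite description: the eigenvalue character has value 1 on
  \<open>delta\<close>, and such a character is determined on the generators of the local
  algebra.\<close>

lemma eta_at_eq:
  assumes X: "(ideal_pow P n, X) \<in> points"
  shows "eta_at u e P n X = restrict (coset_character X) (Dbar_at u e P)"
  unfolding eta_at_def
proof (rule the_equality)
  note ne = points_coset_subset[OF X] points_coset_nonempty[OF X]
  have spec: "restrict (coset_character X) (Dbar_at u e P) \<in> spectrum (Dbar_at u e P)"
    by (rule coset_character_Dbar_at[OF ne])
  thus "restrict (coset_character X) (Dbar_at u e P) \<in> spectrum (Dbar_at u e P) \<and>
      restrict (coset_character X) (Dbar_at u e P) (delta u e P n X) = 1"
    using delta_in_Dbar_at[OF X] coset_character_delta[OF X] by simp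
  fix \<phi> assume \<phi>: "\<phi> \<in> spectrum (Dbar_at u e P) \<and> \<phi> (delta u e P n X) = 1"
  show "\<phi> = restrict (coset_character X) (Dbar_at u e P)"
  proof (rule Dbar_at_spectrum_eqI[OF conjunct1[OF \<phi>] spec])
    fix m Y assume Y: "(ideal_pow P m, Y) \<in> points"
    show "\<phi> (ecos u e (ideal_pow P m) Y) = restrict (coset_character X) (Dbar_at u e P) (ecos u e (ideal_pow P m) Y)"
      using spectrum_delta_ecos[OF X conjunct1[OF \<phi>] conjunct2[OF \<phi>] Y] coset_character_ecos[OF ne Y] ecos_in_Dbar_at[OF Y]
      by simp
  qed
qed

end

section \<open>The characters \<open>\<eta>\<close>\<close>

lemma Dbar_spectrum_eqI:
  assumes "\<phi> \<in> spectrum \<DD>" "\<psi> \<in> spectrum \<DD>"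
    "\<And>I X. (I, X) \<in> points \<Longrightarrow> \<phi> (ecos u e I X) = \<psi> (ecos u e I X)"
  shows "\<phi> = \<psi>"
  using assms(1,2) unfolding Dbar_def by (rule spectrum_eqI) (auto simp: ecos_star assms(3))

text \<open>Every coset is a finite intersection of cosets of powers of distinct primes.\<close>

lemma Dbar_spectrum_eq_if_prime_powers:
  assumes \<phi>: "\<phi> \<in> spectrum \<DD>" and \<psi>: "\<psi> \<in> spectrum \<DD>"
    and eq: "\<And>(P :: 'k set) n X. P \<in> prime_ideals \<Longrightarrow> (ideal_pow P n, X) \<in> points \<Longrightarrow>
      \<phi> (ecos u e (ideal_pow P n) X) = \<psi> (ecos u e (ideal_pow P n) X)"
  shows "\<phi> = \<psi>"
proof (rule Dbar_spectrum_eqI[OF \<phi> \<psi>])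
  note B = cstar_subalgebra_Dbar
  fix J Y :: "'k set" assume JY: "(J, Y) \<in> points"
  obtain y where y: "J \<in> nonzero_ideals" "algebraic_int y" "Y = (+) y ` J" using points_obtain[OF JY] .
  let ?k = "prime_exponents J"
  \<comment> \<open>Induction over finite sets of primes, with partial intersections of prime
    powers. The fixed representative y lies in all cosets involved, so they meet and their
    projections multiply to the projection of the intersection.\<close>
  have "(carrier \<O> \<inter> (\<Inter>P\<in>T. ideal_pow P (?k P)), (+) y ` (carrier \<O> \<inter> (\<Inter>P\<in>T. ideal_pow P (?k P)))) \<in> points \<and>
     \<phi> (ecos u e (carrier \<O> \<inter> (\<Inter>P\<in>T. ideal_pow P (?k P))) ((+) y ` (carrier \<O> \<inter> (\<Inter>P\<in>T. ideal_pow P (?k P))))) =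
     \<psi> (ecos u e (carrier \<O> \<inter> (\<Inter>P\<in>T. ideal_pow P (?k P))) ((+) y ` (carrier \<O> \<inter> (\<Inter>P\<in>T. ideal_pow P (?k P)))))"
    if "finite T" "T \<subseteq> prime_ideals" for T :: "'k set set"
    using that
  proof (induction T rule: finite_induct)
    case empty
    have mem: "(carrier \<O>, (+) y ` carrier \<O>) \<in> points"
      using y(2) nonzero_ideals_carrier by (auto simp: points_iff)
    have "y \<in> (+) y ` carrier \<O>" by (auto simp: image_iff intro!: bexI[of _ 0])
    hence "ecos u e (carrier \<O>) ((+) y ` carrier \<O>) = 1"
      using ecos_eq[OF mem, of y] u_minus(1)[OF y(2)] by (simp add: e_carrier)
    thus ?case using mem by (simp add: spectrum_one[OF B \<phi> one_in_Dbar] spectrum_one[OF B \<psi> one_in_Dbar])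
  next
    case (insert P T)
    define M where "M = carrier \<O> \<inter> (\<Inter>P\<in>T. ideal_pow P (?k P))"
    define Q where "Q = ideal_pow P (?k P)"
    have P: "P \<in> prime_ideals" using insert.prems by simp
    have M: "(M, (+) y ` M) \<in> points" "\<phi> (ecos u e M ((+) y ` M)) = \<psi> (ecos u e M ((+) y ` M))"
      using insert.IH insert.prems by (auto simp: M_def)
    have Q: "(Q, (+) y ` Q) \<in> points"
      using y(2) ideal_pow_nonzero[OF prime_ideals_nonzero[OF P]] by (auto simp: points_iff Q_def)
    have Qeq: "\<phi> (ecos u e Q ((+) y ` Q)) = \<psi> (ecos u e Q ((+) y ` Q))"
      using eq[OF P] Q by (simp add: Q_def)
    have int: "(+) y ` Q \<inter> (+) y ` M = (+) y ` (Q \<inter> M)" by (simp add: image_Int)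
    have "0 \<in> Q" "0 \<in> M" using Q M(1) by (auto simp: points_iff intro!: ideal_zero nonzero_ideals_ideal)
    hence ne: "(+) y ` Q \<inter> (+) y ` M \<noteq> {}" unfolding int by blast
    have "ecos u e Q ((+) y ` Q) * ecos u e M ((+) y ` M) = ecos u e (Q \<inter> M) ((+) y ` (Q \<inter> M))"
      using ecos_mult_Int[OF Q M(1) ne] by (simp only: int)
    moreover have "carrier \<O> \<inter> (\<Inter>P\<in>insert P T. ideal_pow P (?k P)) = Q \<inter> M" by (auto simp: Q_def M_def)
    moreover have "(Q \<inter> M, (+) y ` (Q \<inter> M)) \<in> points" using points_Int[OF Q M(1) ne] by (simp only: int)
    ultimately show ?case
      using spectrum_mult[OF B \<phi> ecos_in_Dbar[OF Q] ecos_in_Dbar[OF M(1)]]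
        spectrum_mult[OF B \<psi> ecos_in_Dbar[OF Q] ecos_in_Dbar[OF M(1)]] M(2) Qeq by simp
  qed
  from this[OF finite_prime_exponents[OF y(1)] prime_exponents_prime[OF y(1)]]
  show "\<phi> (ecos u e J Y) = \<psi> (ecos u e J Y)"
    by (simp only: ideal_eq_Inter_prime_powers[OF y(1), symmetric] y(3))
qed

lemma spectrum_prod_list:
  assumes "cstar_subalgebra B" "\<phi> \<in> spectrum B" "1 \<in> B" "set xs \<subseteq> B"
  shows "prod_list xs \<in> B \<and> \<phi> (prod_list xs) = prod_list (map \<phi> xs)"
  using assms(4)
  by (induction xs)
     (auto simp: assms(3) spectrum_one[OF assms(1-3)] spectrum_mult[OF assms(1,2)] cstar_subalgebra_mult[OF assms(1)])

text \<open>The power P^k with k the exponent of \<open>P\<close> in \<open>I\<close> is the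
  smallest power of \<open>P\<close> containing \<open>I\<close>. Hence a coset of a power of
  \<open>P\<close> contains \<open>X\<close> if and only if it contains the image X + P^k, and every
  local factor of \<open>eta\<close> is the restriction of one character of the whole algebra. That
  character is multiplicative, so it satisfies the tensor condition; conversely the condition fixes
  the values on projections of prime power cosets, which determine a character.\<close>

lemma eta_eq:
  assumes IX: "(I, X) \<in> points"
  shows "eta u e I X = coset_character X"
proof -
  note ne = points_coset_subset[OF IX] points_coset_nonempty[OF IX]
  note B = cstar_subalgebra_Dbar and \<chi> = coset_character_spectrum[OF ne]
  obtain x where x: "I \<in> nonzero_ideals" "algebraic_int x" "X = (+) x ` I" using points_obtain[OF IX] .
  define k where "k = prime_exponents I"
  define Z where "Z = (\<lambda>P. X <+>\<^bsub>\<O>\<^esub> ideal_pow P (k P))"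
  have I_sub: "I \<subseteq> ideal_pow P m \<longleftrightarrow> m \<le> k P" if "P \<in> prime_ideals" for P m
    using subset_prime_pow_iff[OF x(1) that] by (simp add: k_def)
  have pow: "ideal (ideal_pow P m) \<O>" if "P \<in> prime_ideals" for P :: "'k set" and m
    using ideal_ideal_pow prime_ideals_ideal that by blast
  have Z_eq: "Z P = (+) x ` ideal_pow P (k P)" if P: "P \<in> prime_ideals" for P
  proof -
    have sub: "I \<subseteq> ideal_pow P (k P)" using I_sub[OF P] by simp
    have "(x + i) + j \<in> (+) x ` ideal_pow P (k P)" if "i \<in> I" "j \<in> ideal_pow P (k P)" for i j
      using that sub ideal_add[OF pow[OF P], of i "k P" j] by (auto simp: add.assoc)
    moreover have "\<exists>a b. x + j = a + b \<and> a \<in> X \<and> b \<in> ideal_pow P (k P)" if "j \<in> ideal_pow P (k P)" for j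
      using that ideal_zero[OF nonzero_ideals_ideal[OF x(1)]] unfolding x(3)
      by (intro exI[of _ x] exI[of _ j]) (auto simp: image_iff intro!: bexI[of _ 0])
    ultimately show ?thesis unfolding Z_def set_add_ring_of_integers x(3) by auto
  qed
  have Z_points: "(ideal_pow P (k P), Z P) \<in> points" if P: "P \<in> prime_ideals" for P
    using Z_eq[OF P] x(2) ideal_pow_nonzero[OF prime_ideals_nonzero[OF P]] by (auto simp: points_iff)
  define \<Phi> where "\<Phi> = (\<lambda>P. eta_at u e P (k P) (Z P))"
  have \<Phi>: "\<Phi> P = restrict (coset_character X) (Dbar_at u e P)" if P: "P \<in> prime_ideals" for P
  proof -
    note neZ = points_coset_subset[OF Z_points[OF P]] points_coset_nonempty[OF Z_points[OF P]]
    have "\<Phi> P = restrict (coset_character (Z P)) (Dbar_at u e P)"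
      unfolding \<Phi>_def by (rule eta_at_eq[OF P Z_points[OF P]])
    also have "\<dots> = restrict (coset_character X) (Dbar_at u e P)"
    proof (rule Dbar_at_spectrum_eqI[OF P coset_character_Dbar_at[OF P neZ] coset_character_Dbar_at[OF P ne]])
      fix m Y assume Y: "(ideal_pow P m, Y) \<in> points"
      have "Z P \<subseteq> Y \<longleftrightarrow> X \<subseteq> Y"
      proof
        assume "Z P \<subseteq> Y"
        moreover have "X \<subseteq> Z P" unfolding Z_eq[OF P] x(3) using I_sub[OF P] by (intro image_mono) simp
        ultimately show "X \<subseteq> Y" by simp
      next
        assume XY: "X \<subseteq> Y"
        have "x \<in> X" unfolding x(3) using ideal_zero[OF nonzero_ideals_ideal[OF x(1)]] by (auto simp: image_iff intro!: bexI[of _ 0])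
        hence Y_eq: "Y = (+) x ` ideal_pow P m" using points_coset_eq(2)[OF Y] XY by blast
        hence "I \<subseteq> ideal_pow P m" using XY unfolding x(3) by (auto simp: subset_iff image_iff)
        hence "ideal_pow P (k P) \<subseteq> ideal_pow P m"
          using I_sub[OF P] ideal_pow_antimono[OF prime_ideals_ideal[OF P]] by blast
        thus "Z P \<subseteq> Y" unfolding Z_eq[OF P] Y_eq by (rule image_mono)
      qed
      thus "restrict (coset_character (Z P)) (Dbar_at u e P) (ecos u e (ideal_pow P m) Y) =
          restrict (coset_character X) (Dbar_at u e P) (ecos u e (ideal_pow P m) Y)"
        by (simp add: ecos_in_Dbar_at[OF P Y] coset_character_ecos[OF neZ Y] coset_character_ecos[OF ne Y])
    qed
    finally show ?thesis .
  qed
  have "tensor_character u e \<Phi> = coset_character X"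
    unfolding tensor_character_def
  proof (rule the_equality, intro conjI allI impI)
    show "coset_character X \<in> spectrum \<DD>" by (rule \<chi>)
    fix Ps :: "'k set list" and a :: "'k set \<Rightarrow> 'a"
    assume Ps: "distinct Ps \<and> set Ps \<subseteq> prime_ideals \<and> (\<forall>P\<in>set Ps. a P \<in> Dbar_at u e P)"
    hence "set (map a Ps) \<subseteq> \<DD>" using Dbar_at_subset by auto
    hence "coset_character X (prod_list (map a Ps)) = prod_list (map (\<lambda>P. coset_character X (a P)) Ps)"
      using spectrum_prod_list[OF B \<chi> one_in_Dbar] by (simp add: o_def)
    also have "\<dots> = (\<Prod>P\<in>set Ps. coset_character X (a P))"
      using Ps by (simp add: prod.distinct_set_conv_list)
    also have "\<dots> = (\<Prod>P\<in>set Ps. \<Phi> P (a P))"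
      using Ps \<Phi> by (intro prod.cong) auto
    finally show "coset_character X (prod_list (map a Ps)) = (\<Prod>P\<in>set Ps. \<Phi> P (a P))" .
  next
    fix \<psi>
    assume \<psi>: "\<psi> \<in> spectrum \<DD> \<and> (\<forall>Ps a. distinct Ps \<and> set Ps \<subseteq> prime_ideals \<and> (\<forall>P\<in>set Ps. a P \<in> Dbar_at u e P) \<longrightarrow>
        \<psi> (prod_list (map a Ps)) = (\<Prod>P\<in>set Ps. \<Phi> P (a P)))"
    show "\<psi> = coset_character X"
    proof (rule Dbar_spectrum_eq_if_prime_powers[OF conjunct1[OF \<psi>] \<chi>])
      fix P Y :: "'k set" and n assume P: "P \<in> prime_ideals" and Y: "(ideal_pow P n, Y) \<in> points"
      \<comment> \<open>An elementary tensor with the single factor at \<open>P\<close> recovers the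
        local character.\<close>
      have "\<psi> (prod_list (map (\<lambda>_. ecos u e (ideal_pow P n) Y) [P])) =
          (\<Prod>P'\<in>set [P]. \<Phi> P' (ecos u e (ideal_pow P n) Y))"
        using P ecos_in_Dbar_at[OF P Y] by (intro conjunct2[OF \<psi>, rule_format]) auto
      thus "\<psi> (ecos u e (ideal_pow P n) Y) = coset_character X (ecos u e (ideal_pow P n) Y)"
        using \<Phi>[OF P] ecos_in_Dbar_at[OF P Y] by simp
    qed
  qed
  thus ?thesis unfolding eta_def \<Phi>_def Z_def k_def by (simp add: Let_def)
qed

end

section \<open>Compactness of the Gelfand spectrum\<close>

context
  fixes B :: "'a::cstar_algebra set"
  assumes B: "cstar_subalgebra B" and one: "1 \<in> B"
begin

lemma topspace_gelfand: "topspace (gelfand_topology B) = spectrum B"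
  by (auto simp: gelfand_topology_def spectrum_def PiE_UNIV_domain extensional_def PiE_def)

text \<open>Not vanishing identically is not visibly a closed condition, but for multiplicative
  functionals on a unital algebra it amounts to value 1 at the unit. The spectrum becomes an
  intersection of zero sets of continuous functions.\<close>

lemma closedin_spectrum: "closedin (product_topology (\<lambda>_. euclidean) B) (spectrum B)"
proof -
  let ?T = "product_topology (\<lambda>_. euclidean) B :: ('a \<Rightarrow> complex) topology"
  define \<F> where "\<F> = {\<lambda>\<phi> :: 'a \<Rightarrow> complex. \<phi> (x + y) - (\<phi> x + \<phi> y) | x y. x \<in> B \<and> y \<in> B} \<union>
    {\<lambda>\<phi>. \<phi> (x * y) - \<phi> x * \<phi> y | x y. x \<in> B \<and> y \<in> B} \<union>
    {\<lambda>\<phi>. \<phi> (c *\<^sub>C x) - c * \<phi> x | c x. x \<in> B} \<union> {\<lambda>\<phi>. \<phi> 1 - 1}"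
  have proj: "continuous_map ?T euclidean (\<lambda>\<phi>. \<phi> x)" if "x \<in> B" for x
    using continuous_map_product_projection[of x B "\<lambda>_. euclidean"] that by simp
  have mult: "continuous_map ?T euclidean (\<lambda>\<phi>. f \<phi> * g \<phi>)"
    if "continuous_map ?T euclidean f" "continuous_map ?T euclidean g" for f g :: "('a \<Rightarrow> complex) \<Rightarrow> complex"
  proof -
    have "continuous_map ?T euclidean (\<lambda>\<phi>. (f \<phi>, g \<phi>))"
      using continuous_map_pairedI[OF that] by simp
    moreover have "continuous_map euclidean euclidean (\<lambda>(a :: complex, b). a * b)"
      by (auto simp: case_prod_beta intro!: continuous_intros)
    ultimately have "continuous_map ?T euclidean ((\<lambda>(a, b). a * b) \<circ> (\<lambda>\<phi>. (f \<phi>, g \<phi>)))"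
      by (rule continuous_map_compose)
    thus ?thesis by (simp add: o_def)
  qed
  have cont: "continuous_map ?T euclidean f" if "f \<in> \<F>" for f
    using that unfolding \<F>_def
    by (auto intro!: continuous_map_diff continuous_map_add mult proj cstar_subalgebra_add[OF B]
        cstar_subalgebra_mult[OF B] cstar_subalgebra_scaleC[OF B] one)
  have "closedin ?T (\<Inter>f\<in>\<F>. {\<phi> \<in> topspace ?T. f \<phi> \<in> {0}})"
  proof (rule closedin_Inter)
    show "(\<lambda>f. {\<phi> \<in> topspace ?T. f \<phi> \<in> {0}}) ` \<F> \<noteq> {}" by (auto simp: \<F>_def)
    fix C assume "C \<in> (\<lambda>f. {\<phi> \<in> topspace ?T. f \<phi> \<in> {0}}) ` \<F>"
    then obtain f where f: "f \<in> \<F>" "C = {\<phi> \<in> topspace ?T. f \<phi> \<in> {0}}" by blast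
    show "closedin ?T C"
      unfolding f(2) by (rule closedin_continuous_map_preimage[OF cont[OF f(1)]]) simp
  qed
  also have "(\<Inter>f\<in>\<F>. {\<phi> \<in> topspace ?T. f \<phi> \<in> {0}}) = spectrum B"
  proof (intro equalityI subsetI)
    fix \<phi> assume \<phi>: "\<phi> \<in> spectrum B"
    have "f \<phi> = 0" if "f \<in> \<F>" for f
      using that unfolding \<F>_def
      by (auto simp: spectrum_add[OF B \<phi>] spectrum_mult[OF B \<phi>] spectrum_scaleC[OF B \<phi>] spectrum_one[OF B \<phi> one])
    moreover have "\<phi> \<in> topspace ?T" using \<phi> by (simp add: spectrum_def PiE_def)
    ultimately show "\<phi> \<in> (\<Inter>f\<in>\<F>. {\<phi> \<in> topspace ?T. f \<phi> \<in> {0}})" by blast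
  next
    fix \<phi> assume *: "\<phi> \<in> (\<Inter>f\<in>\<F>. {\<phi> \<in> topspace ?T. f \<phi> \<in> {0}})"
    hence zero: "f \<phi> = 0" if "f \<in> \<F>" for f using that by blast
    have "(\<lambda>\<phi>. \<phi> 1 - 1) \<in> \<F>" by (simp add: \<F>_def)
    hence ext: "\<phi> \<in> extensional B" using * by (auto simp: PiE_def)
    have "\<phi> (x + y) - (\<phi> x + \<phi> y) = 0" if "x \<in> B" "y \<in> B" for x y
      using zero[of "\<lambda>\<phi>. \<phi> (x + y) - (\<phi> x + \<phi> y)"] that unfolding \<F>_def by blast
    moreover have "\<phi> (x * y) - \<phi> x * \<phi> y = 0" if "x \<in> B" "y \<in> B" for x y
      using zero[of "\<lambda>\<phi>. \<phi> (x * y) - \<phi> x * \<phi> y"] that unfolding \<F>_def by blast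
    moreover have "\<phi> (c *\<^sub>C x) - c * \<phi> x = 0" if "x \<in> B" for c x
      using zero[of "\<lambda>\<phi>. \<phi> (c *\<^sub>C x) - c * \<phi> x"] that unfolding \<F>_def by blast
    moreover have "\<phi> 1 - 1 = 0" using zero[of "\<lambda>\<phi>. \<phi> 1 - 1"] unfolding \<F>_def by blast
    ultimately show "\<phi> \<in> spectrum B" using ext one by (auto simp: spectrum_def intro!: bexI[of _ 1])
  qed
  finally show ?thesis .
qed

text \<open>Characters are contractive, so the spectrum is a closed subset of a product of closed
  discs, which is compact by Tychonoff's theorem.\<close>

lemma compact_space_gelfand: "compact_space (gelfand_topology B)"
proof -
  let ?T = "product_topology (\<lambda>_. euclidean) B :: ('a \<Rightarrow> complex) topology"
  have "compactin ?T (PiE B (\<lambda>x. cball 0 (norm x)))" by (simp add: compactin_PiE)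
  with closedin_spectrum have "compactin ?T (spectrum B \<inter> PiE B (\<lambda>x. cball 0 (norm x)))"
    by (rule closed_Int_compactin)
  also have "spectrum B \<inter> PiE B (\<lambda>x. cball 0 (norm x)) = spectrum B"
  proof -
    have "\<phi> \<in> PiE B (\<lambda>x. cball 0 (norm x))" if "\<phi> \<in> spectrum B" for \<phi>
      using spectrum_norm_le[OF B that] that by (simp add: PiE_def Pi_def spectrum_def)
    thus ?thesis by blast
  qed
  finally show ?thesis unfolding gelfand_topology_def by (rule compact_space_subtopology)
qed

lemma openin_gelfand_eval:
  assumes "x \<in> B" "open V"
  shows "openin (gelfand_topology B) {\<phi> \<in> spectrum B. \<phi> x \<in> V}"
proof -
  have "continuous_map (gelfand_topology B) euclidean (\<lambda>\<phi>. \<phi> x)"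
    unfolding gelfand_topology_def
    using continuous_map_product_projection[of x B "\<lambda>_. euclidean :: complex topology"] assms(1)
    by (simp add: continuous_map_from_subtopology)
  from openin_continuous_map_preimage[OF this, of V] show ?thesis
    using assms(2) by (simp add: topspace_gelfand)
qed

end

section \<open>The metric\<close>

context toeplitz_relations
begin

lemma sum_spectrum_ecos_le:
  assumes \<phi>: "\<phi> \<in> spectrum \<DD>" and T: "finite T" "\<And>X. X \<in> T \<Longrightarrow> (I, X) \<in> points"
  shows "(\<Sum>X\<in>T. cmod (\<phi> (ecos u e I X))) \<le> 1"
proof (cases "\<exists>X\<in>T. \<phi> (ecos u e I X) \<noteq> 0")
  case True
  then obtain X0 where X0: "X0 \<in> T" "\<phi> (ecos u e I X0) \<noteq> 0" by blast
  note B = cstar_subalgebra_Dbar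
  have "\<phi> (ecos u e I X) = 0" if X: "X \<in> T" "X \<noteq> X0" for X
  proof -
    have "X \<inter> X0 = {}"
    proof (rule ccontr)
      assume "X \<inter> X0 \<noteq> {}"
      then obtain z where "z \<in> X" "z \<in> X0" by blast
      thus False using points_coset_eq(2)[OF T(2)[OF X(1)]] points_coset_eq(2)[OF T(2)[OF X0(1)]] X(2) by metis
    qed
    hence "\<phi> (ecos u e I X) * \<phi> (ecos u e I X0) = 0"
      using ecos_mult_disjoint[OF T(2)[OF X(1)] T(2)[OF X0(1)]] spectrum_zero[OF B \<phi>]
        spectrum_mult[OF B \<phi> ecos_in_Dbar[OF T(2)[OF X(1)]] ecos_in_Dbar[OF T(2)[OF X0(1)]]] by simp
    thus ?thesis using X0(2) by simp
  qed
  hence "(\<Sum>X\<in>T. cmod (\<phi> (ecos u e I X))) = (\<Sum>X\<in>{X0}. cmod (\<phi> (ecos u e I X)))"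
    using T(1) X0(1) by (intro sum.mono_neutral_right) auto
  thus ?thesis using spectrum_ecos[OF \<phi> T(2)[OF X0(1)]] by auto
qed auto

lemma metric_term_nonneg: "0 \<le> metric_term u e \<alpha> \<phi> \<psi> i"
  by (simp add: metric_term_def split: prod.splits)

text \<open>The factor 2 accounts for one coset of each ideal for each of the two
  characters.\<close>

lemma sum_metric_term_le:
  assumes \<phi>: "\<phi> \<in> spectrum \<DD>" and \<psi>: "\<psi> \<in> spectrum \<DD>" and F: "finite F" "F \<subseteq> points"
  shows "sum (metric_term u e \<alpha> \<phi> \<psi>) F \<le> 2 * (\<Sum>I\<in>fst ` F. real (ideal_norm I) powr (- \<alpha>))"
proof -
  have F_eq: "F = (SIGMA I:fst ` F. F `` {I})" by force
  have fin: "finite (F `` {I})" for I using F(1) by (rule finite_Image)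
  have "sum (metric_term u e \<alpha> \<phi> \<psi>) F = (\<Sum>I\<in>fst ` F. \<Sum>X\<in>F `` {I}. metric_term u e \<alpha> \<phi> \<psi> (I, X))"
    by (subst (1) F_eq, subst sum.Sigma) (use F(1) fin in auto)
  also have "\<dots> \<le> (\<Sum>I\<in>fst ` F. real (ideal_norm I) powr (- \<alpha>) * 2)"
  proof (rule sum_mono)
    fix I
    have pts: "(I, X) \<in> points" if "X \<in> F `` {I}" for X using that F(2) by auto
    have "(\<Sum>X\<in>F `` {I}. cmod (\<phi> (ecos u e I X) - \<psi> (ecos u e I X))) \<le>
        (\<Sum>X\<in>F `` {I}. cmod (\<phi> (ecos u e I X)) + cmod (\<psi> (ecos u e I X)))"
      by (intro sum_mono norm_triangle_ineq4)
    also have "\<dots> \<le> 2"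
      using sum_spectrum_ecos_le[OF \<phi> fin[of I] pts] sum_spectrum_ecos_le[OF \<psi> fin[of I] pts]
      by (simp add: sum.distrib)
    finally show "(\<Sum>X\<in>F `` {I}. metric_term u e \<alpha> \<phi> \<psi> (I, X)) \<le> real (ideal_norm I) powr (- \<alpha>) * 2"
      by (simp add: metric_term_def mult_left_mono flip: sum_distrib_left)
  qed
  finally show ?thesis by (simp add: sum_distrib_left mult.commute)
qed

lemma metric_term_summable:
  assumes "\<alpha> > 1" and \<phi>: "\<phi> \<in> spectrum \<DD>" and \<psi>: "\<psi> \<in> spectrum \<DD>"
  shows "metric_term u e \<alpha> \<phi> \<psi> summable_on points"
proof (rule nonneg_bdd_above_summable_on)
  obtain C where C: "\<And>F. finite F \<Longrightarrow> F \<subseteq> (nonzero_ideals :: 'k set set) \<Longrightarrow>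
    (\<Sum>I\<in>F. real (ideal_norm I) powr (- \<alpha>)) \<le> C" by (rule ideal_norm_sum_bound[OF assms(1)]) blast
  show "bdd_above (sum (metric_term u e \<alpha> \<phi> \<psi>) ` {F. F \<subseteq> points \<and> finite F})"
  proof (rule bdd_aboveI2, clarify)
    fix F :: "('k set \<times> 'k set) set" assume F: "F \<subseteq> points" "finite F"
    have "fst ` F \<subseteq> nonzero_ideals" using F(1) by (auto simp: points_def)
    thus "sum (metric_term u e \<alpha> \<phi> \<psi>) F \<le> 2 * C"
      using sum_metric_term_le[OF \<phi> \<psi> F(2,1), of \<alpha>] C[of "fst ` F"] F(2) by simp
  qed
qed (rule metric_term_nonneg)

text \<open>Definiteness holds because all weights are positive: at distance 0 two characters agree
  on all coset projections, and these generate the algebra.\<close>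

lemma Metric_space_d_alpha:
  assumes \<alpha>: "\<alpha> > 1"
  shows "Metric_space (spectrum \<DD>) (d_alpha u e \<alpha>)"
proof
  note summ = metric_term_summable[OF \<alpha>]
  fix \<phi> \<psi> \<theta> :: "'a \<Rightarrow> complex"
  show "0 \<le> d_alpha u e \<alpha> \<phi> \<psi>" unfolding d_alpha_def by (intro infsum_nonneg metric_term_nonneg)
  have "metric_term u e \<alpha> \<phi> \<psi> = metric_term u e \<alpha> \<psi> \<phi>"
    by (simp add: metric_term_def norm_minus_commute)
  thus "d_alpha u e \<alpha> \<phi> \<psi> = d_alpha u e \<alpha> \<psi> \<phi>" by (simp add: d_alpha_def)
  assume \<phi>: "\<phi> \<in> spectrum \<DD>" and \<psi>: "\<psi> \<in> spectrum \<DD>"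
  show "d_alpha u e \<alpha> \<phi> \<psi> = 0 \<longleftrightarrow> \<phi> = \<psi>"
  proof
    assume "d_alpha u e \<alpha> \<phi> \<psi> = 0"
    hence zero: "metric_term u e \<alpha> \<phi> \<psi> i = 0" if "i \<in> points" for i
      unfolding d_alpha_def using nonneg_infsum_le_0D[OF _ summ[OF \<phi> \<psi>] metric_term_nonneg that] by simp
    show "\<phi> = \<psi>"
    proof (rule Dbar_spectrum_eqI[OF \<phi> \<psi>])
      fix I X :: "'k set" assume IX: "(I, X) \<in> points"
      have "ideal_norm I > 0" using IX by (intro ideal_norm_pos) (simp add: points_iff)
      thus "\<phi> (ecos u e I X) = \<psi> (ecos u e I X)" using zero[OF IX] by (simp add: metric_term_def)
    qed
  next
    assume "\<phi> = \<psi>"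
    moreover have "metric_term u e \<alpha> \<psi> \<psi> = (\<lambda>_. 0)" by (auto simp: metric_term_def)
    ultimately show "d_alpha u e \<alpha> \<phi> \<psi> = 0" by (simp add: d_alpha_def)
  qed
  assume \<theta>: "\<theta> \<in> spectrum \<DD>"
  have "metric_term u e \<alpha> \<phi> \<theta> i \<le> metric_term u e \<alpha> \<phi> \<psi> i + metric_term u e \<alpha> \<psi> \<theta> i" for i
  proof -
    obtain I X where i: "i = (I, X)" by fastforce
    have "cmod (\<phi> (ecos u e I X) - \<theta> (ecos u e I X)) \<le>
        cmod (\<phi> (ecos u e I X) - \<psi> (ecos u e I X)) + cmod (\<psi> (ecos u e I X) - \<theta> (ecos u e I X))"
      using norm_triangle_ineq[of "\<phi> (ecos u e I X) - \<psi> (ecos u e I X)" "\<psi> (ecos u e I X) - \<theta> (ecos u e I X)"] by simp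
    thus ?thesis by (simp add: i metric_term_def mult_left_mono flip: distrib_left)
  qed
  hence "d_alpha u e \<alpha> \<phi> \<theta> \<le> infsum (\<lambda>i. metric_term u e \<alpha> \<phi> \<psi> i + metric_term u e \<alpha> \<psi> \<theta> i) points"
    unfolding d_alpha_def by (intro infsum_mono summable_on_add summ \<phi> \<psi> \<theta>)
  also have "\<dots> = d_alpha u e \<alpha> \<phi> \<psi> + d_alpha u e \<alpha> \<psi> \<theta>"
    unfolding d_alpha_def by (intro infsum_add summ \<phi> \<psi> \<theta>)
  finally show "d_alpha u e \<alpha> \<phi> \<theta> \<le> d_alpha u e \<alpha> \<phi> \<psi> + d_alpha u e \<alpha> \<psi> \<theta>" .
qed

text \<open>The metric is controlled by finitely many ideals, since the tails of the zeta series are small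
  uniformly in the characters.\<close>

lemma d_alpha_le_if_agree:
  assumes \<alpha>: "\<alpha> > 1" and \<epsilon>: "\<epsilon> > 0"
  obtains \<I> where "finite \<I>" "\<I> \<subseteq> nonzero_ideals"
    "\<And>\<phi> \<psi>. \<phi> \<in> spectrum \<DD> \<Longrightarrow> \<psi> \<in> spectrum \<DD> \<Longrightarrow>
      (\<And>I X. I \<in> \<I> \<Longrightarrow> (I, X) \<in> points \<Longrightarrow> \<phi> (ecos u e I X) = \<psi> (ecos u e I X)) \<Longrightarrow> d_alpha u e \<alpha> \<phi> \<psi> \<le> \<epsilon>"
proof -
  define w where "w = (\<lambda>I :: 'k set. real (ideal_norm I) powr (- \<alpha>))"
  obtain C where C: "\<And>F. finite F \<Longrightarrow> F \<subseteq> (nonzero_ideals :: 'k set set) \<Longrightarrow> sum w F \<le> C"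
    unfolding w_def by (rule ideal_norm_sum_bound[OF \<alpha>]) blast
  \<comment> \<open>A finite set \<open>\<I>\<close> of ideals whose weight comes within
    \<epsilon>/2 of the supremum leaves weight at most \<epsilon>/2 to every finite set of other
    ideals. With the factor 2 of the metric estimate this gives \<epsilon>.\<close>
  let ?A = "sum w ` {F. finite F \<and> F \<subseteq> nonzero_ideals}"
  have bdd: "bdd_above ?A" using C by (intro bdd_aboveI2) auto
  have "Sup ?A - \<epsilon> / 2 < Sup ?A" using \<epsilon> by simp
  moreover have "?A \<noteq> {}" by blast
  ultimately have "\<exists>a\<in>?A. Sup ?A - \<epsilon> / 2 < a" using less_cSup_iff[OF _ bdd] by blast
  then obtain \<I> where \<I>: "finite \<I>" "\<I> \<subseteq> nonzero_ideals" "Sup ?A - \<epsilon> / 2 < sum w \<I>"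
    by blast
  have tail: "sum w F \<le> \<epsilon> / 2" if F: "finite F" "F \<subseteq> nonzero_ideals - \<I>" for F
  proof -
    have "sum w \<I> + sum w F = sum w (\<I> \<union> F)" using F \<I>(1) by (intro sum.union_disjoint[symmetric]) auto
    also have "\<dots> \<le> Sup ?A" by (rule cSup_upper[OF imageI bdd]) (use F \<I>(1,2) in blast)
    finally show ?thesis using \<I>(3) by simp
  qed
  show ?thesis
  proof (rule that[OF \<I>(1,2)])
    fix \<phi> \<psi> assume \<phi>: "\<phi> \<in> spectrum \<DD>" and \<psi>: "\<psi> \<in> spectrum \<DD>"
      and agree: "\<And>I X. I \<in> \<I> \<Longrightarrow> (I, X) \<in> points \<Longrightarrow> \<phi> (ecos u e I X) = \<psi> (ecos u e I X)"
    show "d_alpha u e \<alpha> \<phi> \<psi> \<le> \<epsilon>"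
      unfolding d_alpha_def
    proof (rule infsum_le_finite_sums[OF metric_term_summable[OF \<alpha> \<phi> \<psi>]])
      fix F :: "('k set \<times> 'k set) set" assume F: "finite F" "F \<subseteq> points"
      define F' where "F' = {i \<in> F. fst i \<notin> \<I>}"
      have F': "finite F'" "F' \<subseteq> points" "fst ` F' \<subseteq> nonzero_ideals - \<I>"
        using F by (auto simp: F'_def points_def)
      have "sum (metric_term u e \<alpha> \<phi> \<psi>) F = sum (metric_term u e \<alpha> \<phi> \<psi>) F'"
        using F agree by (intro sum.mono_neutral_right) (auto simp: F'_def metric_term_def)
      also have "\<dots> \<le> 2 * sum w (fst ` F')"
        unfolding w_def by (rule sum_metric_term_le[OF \<phi> \<psi> F'(1,2)])
      also have "\<dots> \<le> \<epsilon>" using tail[of "fst ` F'"] F' by simp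
      finally show "sum (metric_term u e \<alpha> \<phi> \<psi>) F \<le> \<epsilon>" .
    qed
  qed
qed

lemma finite_points_over:
  assumes "finite \<I>" "\<I> \<subseteq> nonzero_ideals"
  shows "finite {(I, X) \<in> points. I \<in> (\<I> :: 'k set set)}"
proof (rule finite_subset)
  show "{(I, X) \<in> points. I \<in> \<I>} \<subseteq> (SIGMA I:\<I>. carrier (\<O> Quot I))"
    by (auto simp: points_def)
  show "finite (SIGMA I:\<I>. carrier (\<O> Quot I))"
    using assms finite_quotient by (intro finite_SigmaI) auto
qed

text \<open>The cosets on which a character takes the value 1 form a filter base.\<close>

lemma spectrum_common_coset:
  assumes \<phi>: "\<phi> \<in> spectrum \<DD>" and "finite C" "C \<subseteq> {(I, X) \<in> points. \<phi> (ecos u e I X) = 1}"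
  shows "\<exists>J Y. (J, Y) \<in> points \<and> \<phi> (ecos u e J Y) = 1 \<and> (\<forall>(I, X)\<in>C. Y \<subseteq> X)"
  using assms(2,3)
proof (induction C rule: finite_induct)
  case empty
  show ?case
    using points_carrier spectrum_one[OF cstar_subalgebra_Dbar \<phi> one_in_Dbar] ecos_carrier
    by (intro exI[of _ "carrier \<O>"]) auto
next
  case (insert i C)
  note B = cstar_subalgebra_Dbar
  obtain I X where i: "i = (I, X)" "(I, X) \<in> points" "\<phi> (ecos u e I X) = 1" using insert.prems by (cases i) auto
  obtain J Y where J: "(J, Y) \<in> points" "\<phi> (ecos u e J Y) = 1" "\<forall>(I, X)\<in>C. Y \<subseteq> X"
    using insert.IH insert.prems by auto
  have prod: "\<phi> (ecos u e I X * ecos u e J Y) = 1"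
    using spectrum_mult[OF B \<phi> ecos_in_Dbar[OF i(2)] ecos_in_Dbar[OF J(1)]] i J by simp
  have ne: "X \<inter> Y \<noteq> {}"
    using ecos_mult_disjoint[OF i(2) J(1)] prod spectrum_zero[OF B \<phi>] by fastforce
  show ?case
    using points_Int[OF i(2) J(1) ne] ecos_mult_Int[OF i(2) J(1) ne] prod J(3) i(1)
    by (intro exI[of _ "I \<inter> J"] exI[of _ "X \<inter> Y"]) auto
qed

text \<open>\<open>C\<close> collects the finitely many relevant cosets with value 1, and
  \<open>Y\<close> lies in all of them. A coset over \<open>\<I>\<close> outside \<open>C\<close>
  has value 0 and does not contain \<open>Y\<close>, since value 1 at \<open>Y\<close> would
  propagate to every larger coset.\<close>

lemma coset_characters_dense:
  assumes \<alpha>: "\<alpha> > 1" and \<phi>: "\<phi> \<in> spectrum \<DD>" and \<epsilon>: "\<epsilon> > 0"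
  shows "\<exists>J Y. (J, Y) \<in> points \<and> d_alpha u e \<alpha> \<phi> (coset_character Y) \<le> \<epsilon>"
proof -
  note B = cstar_subalgebra_Dbar
  obtain \<I> where \<I>: "finite \<I>" "\<I> \<subseteq> nonzero_ideals"
    "\<And>\<phi> \<psi>. \<phi> \<in> spectrum \<DD> \<Longrightarrow> \<psi> \<in> spectrum \<DD> \<Longrightarrow>
      (\<And>I X. I \<in> \<I> \<Longrightarrow> (I, X) \<in> points \<Longrightarrow> \<phi> (ecos u e I X) = \<psi> (ecos u e I X)) \<Longrightarrow> d_alpha u e \<alpha> \<phi> \<psi> \<le> \<epsilon>"
    by (rule d_alpha_le_if_agree[OF \<alpha> \<epsilon>]) blast
  define C where "C = {(I, X) \<in> points. I \<in> \<I> \<and> \<phi> (ecos u e I X) = 1}"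
  have "finite C" using finite_points_over[OF \<I>(1,2)] by (rule rev_finite_subset) (auto simp: C_def)
  moreover have "C \<subseteq> {(I, X) \<in> points. \<phi> (ecos u e I X) = 1}" by (auto simp: C_def)
  ultimately have "\<exists>J Y. (J, Y) \<in> points \<and> \<phi> (ecos u e J Y) = 1 \<and> (\<forall>(I, X)\<in>C. Y \<subseteq> X)"
    by (rule spectrum_common_coset[OF \<phi>])
  then obtain J Y where J: "(J, Y) \<in> points" "\<phi> (ecos u e J Y) = 1" "\<forall>(I, X)\<in>C. Y \<subseteq> X"
    by (elim exE conjE)
  note ne = points_coset_subset[OF J(1)] points_coset_nonempty[OF J(1)]
  have "\<phi> (ecos u e I X) = coset_character Y (ecos u e I X)" if "I \<in> \<I>" "(I, X) \<in> points" for I X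
  proof (cases "Y \<subseteq> X")
    case True
    have "\<phi> (ecos u e I X) = 1"
      using spectrum_mult[OF B \<phi> ecos_in_Dbar[OF J(1)] ecos_in_Dbar[OF that(2)]] ecos_mult_subset[OF J(1) that(2) True] J(2)
      by simp
    thus ?thesis using coset_character_ecos[OF ne that(2)] True by simp
  next
    case False
    hence "\<phi> (ecos u e I X) \<noteq> 1" using J(3) that by (auto simp: C_def)
    hence "\<phi> (ecos u e I X) = 0" using spectrum_ecos[OF \<phi> that(2)] by auto
    thus ?thesis using coset_character_ecos[OF ne that(2)] False by simp
  qed
  hence "d_alpha u e \<alpha> \<phi> (coset_character Y) \<le> \<epsilon>"
    by (intro \<I>(3) \<phi> coset_character_spectrum[OF ne])
  thus ?thesis using J(1) by blast
qed

text \<open>The identity is continuous from the compact Gelfand topology to the Hausdorff metric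
  topology, hence a homeomorphism. Thus only one of the two comparisons is made by
  estimates.\<close>

lemma mtopology_d_alpha:
  assumes \<alpha>: "\<alpha> > 1"
  shows "Metric_space.mtopology (spectrum \<DD>) (d_alpha u e \<alpha>) = gelfand_topology \<DD>"
proof -
  interpret M: Metric_space "spectrum \<DD>" "d_alpha u e \<alpha>" by (rule Metric_space_d_alpha[OF \<alpha>])
  note B = cstar_subalgebra_Dbar
  note top = topspace_gelfand[OF B one_in_Dbar]
  have "continuous_map (gelfand_topology \<DD>) M.mtopology id"
    unfolding M.continuous_map_to_metric top
  proof (intro ballI allI impI)
    fix \<phi> and \<epsilon> :: real assume \<phi>: "\<phi> \<in> spectrum \<DD>" and \<epsilon>: "\<epsilon> > 0"
    obtain \<I> where \<I>: "finite \<I>" "\<I> \<subseteq> nonzero_ideals"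
      "\<And>\<phi> \<psi>. \<phi> \<in> spectrum \<DD> \<Longrightarrow> \<psi> \<in> spectrum \<DD> \<Longrightarrow>
        (\<And>I X. I \<in> \<I> \<Longrightarrow> (I, X) \<in> points \<Longrightarrow> \<phi> (ecos u e I X) = \<psi> (ecos u e I X)) \<Longrightarrow> d_alpha u e \<alpha> \<phi> \<psi> \<le> \<epsilon> / 2"
      by (rule d_alpha_le_if_agree[OF \<alpha> half_gt_zero[OF \<epsilon>]]) blast
    \<comment> \<open>Radius 1 suffices: the values are 0 or 1, so a distance below 1 means
      equality.\<close>
    define N where "N = (\<lambda>(I, X). {\<psi> \<in> spectrum \<DD>. \<psi> (ecos u e I X) \<in> ball (\<phi> (ecos u e I X)) 1})"
    \<comment> \<open>Intersecting with the spectrum keeps \<open>V\<close> inside the space also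
      when the family is empty.\<close>
    define V where "V = (\<Inter>i\<in>{(I, X) \<in> points. I \<in> \<I>}. N i) \<inter> spectrum \<DD>"
    have fin: "finite {(I, X) \<in> points. I \<in> \<I>}" by (rule finite_points_over[OF \<I>(1,2)])
    have openN: "openin (gelfand_topology \<DD>) (N i)" if "i \<in> {(I, X) \<in> points. I \<in> \<I>}" for i
    proof -
      from that obtain I X where i: "i = (I, X)" "(I, X) \<in> points" by auto
      show ?thesis
        unfolding i(1) N_def prod.case
        by (rule openin_gelfand_eval[OF B one_in_Dbar ecos_in_Dbar[OF i(2)] open_ball])
    qed
    have openV: "openin (gelfand_topology \<DD>) V"
      using openin_INT[OF fin openN] unfolding V_def top .
    moreover have "\<phi> \<in> V" using \<phi> by (auto simp: V_def N_def)
    moreover have "id \<psi> \<in> M.mball (id \<phi>) \<epsilon>" if \<psi>: "\<psi> \<in> V" for \<psi>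
    proof -
      have spec: "\<psi> \<in> spectrum \<DD>" using \<psi> by (simp add: V_def)
      have "\<phi> (ecos u e I X) = \<psi> (ecos u e I X)" if "I \<in> \<I>" "(I, X) \<in> points" for I X
      proof -
        have "dist (\<phi> (ecos u e I X)) (\<psi> (ecos u e I X)) < 1" using \<psi> that by (auto simp: V_def N_def)
        thus ?thesis using spectrum_ecos[OF \<phi> that(2)] spectrum_ecos[OF spec that(2)] by auto
      qed
      hence "d_alpha u e \<alpha> \<phi> \<psi> \<le> \<epsilon> / 2" by (intro \<I>(3) \<phi> spec)
      thus ?thesis using \<phi> spec \<epsilon> by simp
    qed
    ultimately show "\<exists>U. openin (gelfand_topology \<DD>) U \<and> \<phi> \<in> U \<and> (\<forall>\<psi>\<in>U. id \<psi> \<in> M.mball (id \<phi>) \<epsilon>)" by blast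
  qed
  hence hom: "homeomorphic_map (gelfand_topology \<DD>) M.mtopology id"
    using compact_space_gelfand[OF B one_in_Dbar] M.Hausdorff_space_mtopology
    by (intro continuous_imp_homeomorphic_map) (auto simp: top)
  show ?thesis
  proof (rule topology_eq[THEN iffD2], intro allI iffI)
    fix U assume "openin M.mtopology U"
    moreover from this have "U \<subseteq> spectrum \<DD>" using openin_subset by fastforce
    ultimately show "openin (gelfand_topology \<DD>) U" using homeomorphic_map_openness[OF hom, of U] by (simp add: top)
  next
    fix U assume "openin (gelfand_topology \<DD>) U"
    moreover from this have "U \<subseteq> spectrum \<DD>" using openin_subset by (fastforce simp: top)
    ultimately show "openin M.mtopology U" using homeomorphic_map_openness[OF hom, of U] by (simp add: top)
  qed
qed

end

theorem proposition4p9: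
  fixes u s :: "'k::number_field \<Rightarrow> 'a::cstar_algebra" and e :: "'k set \<Rightarrow> 'a"
  assumes "is_toeplitz_algebra u s e"
  shows "case_prod (eta u e) ` points \<subseteq> spectrum (Dbar u e) \<and>
     inj_on (case_prod (eta u e)) points \<and>
     gelfand_topology (Dbar u e) closure_of (case_prod (eta u e) ` points) = spectrum (Dbar u e) \<and>
     (\<forall>\<alpha>>1.
        (\<forall>\<phi>\<in>spectrum (Dbar u e). \<forall>\<psi>\<in>spectrum (Dbar u e).
           metric_term u e \<alpha> \<phi> \<psi> summable_on points) \<and>
        Metric_space (spectrum (Dbar u e)) (d_alpha u e \<alpha>) \<and>
        Metric_space.mcomplete (spectrum (Dbar u e)) (d_alpha u e \<alpha>) \<and>
        Metric_space.mtopology (spectrum (Dbar u e)) (d_alpha u e \<alpha>) = gelfand_topology (Dbar u e) \<and>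
        Metric_space.mtopology (spectrum (Dbar u e)) (d_alpha u e \<alpha>) closure_of
          (case_prod (eta u e) ` points) = spectrum (Dbar u e))"
proof -
  interpret toeplitz_relations u e by (rule toeplitz_relations[OF assms])
  have image: "case_prod (eta u e) ` points \<subseteq> spectrum \<DD>"
    using coset_character_spectrum[OF points_coset_subset points_coset_nonempty] by (auto simp: eta_eq)
  have "inj_on (case_prod (eta u e)) points"
  proof (rule inj_onI, clarify)
    fix I X J Y assume IX: "(I, X) \<in> points" and JY: "(J, Y) \<in> points" and "eta u e I X = eta u e J Y"
    hence eq: "coset_character X = coset_character Y" by (simp add: eta_eq)
    have iff: "X \<subseteq> Z \<longleftrightarrow> Y \<subseteq> Z" if "(K, Z) \<in> points" for K Z
    proof -
      have "of_bool (X \<subseteq> Z) = (of_bool (Y \<subseteq> Z) :: complex)"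
        using coset_character_ecos[OF points_coset_subset[OF IX] points_coset_nonempty[OF IX] that]
          coset_character_ecos[OF points_coset_subset[OF JY] points_coset_nonempty[OF JY] that]
        by (simp only: eq)
      thus ?thesis by (simp only: of_bool_eq_iff)
    qed
    \<comment> \<open>Each of the two cosets is contained in the same cosets as the other, in
      particular in the other one itself.\<close>
    from iff[OF IX] iff[OF JY] have XY: "X = Y" by blast
    with IX JY show "I = J \<and> X = Y" using points_determined by blast
  qed
  moreover have dense: "Metric_space.mtopology (spectrum \<DD>) (d_alpha u e \<alpha>) closure_of (case_prod (eta u e) ` points) = spectrum \<DD>"
    if \<alpha>: "\<alpha> > 1" for \<alpha>
  proof -
    interpret M: Metric_space "spectrum \<DD>" "d_alpha u e \<alpha>" by (rule Metric_space_d_alpha[OF \<alpha>])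
    have "\<exists>\<psi>\<in>case_prod (eta u e) ` points. \<psi> \<in> M.mcball \<phi> r" if \<phi>: "\<phi> \<in> spectrum \<DD>" and r: "r > 0" for \<phi> r
    proof -
      obtain J Y where J: "(J, Y) \<in> points" "d_alpha u e \<alpha> \<phi> (coset_character Y) \<le> r"
        using coset_characters_dense[OF \<alpha> \<phi> r] by blast
      have "eta u e J Y \<in> case_prod (eta u e) ` points" using J(1) by force
      thus ?thesis using image \<phi> J by (intro bexI[of _ "eta u e J Y"]) (auto simp: eta_eq)
    qed
    thus ?thesis unfolding M.metric_closure_of_alt by blast
  qed
  moreover have "gelfand_topology \<DD> closure_of (case_prod (eta u e) ` points) = spectrum \<DD>"
    \<comment> \<open>All these metrics induce the Gelfand topology, so density may be read off from
      any exponent above 1.\<close>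
    using dense[of 2] by (simp add: mtopology_d_alpha)
  moreover have "Metric_space.mcomplete (spectrum \<DD>) (d_alpha u e \<alpha>)" if \<alpha>: "\<alpha> > 1" for \<alpha>
  proof -
    interpret M: Metric_space "spectrum \<DD>" "d_alpha u e \<alpha>" by (rule Metric_space_d_alpha[OF \<alpha>])
    \<comment> \<open>The metric topology is the compact Gelfand topology, and compact metric spaces
      are complete.\<close>
    show ?thesis
      using compact_space_gelfand[OF cstar_subalgebra_Dbar one_in_Dbar] M.compact_space_imp_mcomplete
      by (simp add: mtopology_d_alpha[OF \<alpha>])
  qed
  ultimately show ?thesis
    using image metric_term_summable Metric_space_d_alpha mtopology_d_alpha by simp
qed

end
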